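(* Let $d\ge1$, $1\le p,q\le\infty$, $0<\gamma\le\infty$, $r>0$, let $\Theta_1$ and $\Theta(t)=t^r\Theta_1(t)$ belong to $\Phi_s^*$ for some $s\ge1$, and let $w$ be a doubling weight on $\mathbb S^d$ with critical index $s_w$. For each $n$, let $\{{\bf x}_k\}_{k=1}^{N}$ with weights $\{\tau_k\}_{k=1}^N$ be an $L_{p,w}$ Marcinkiewicz–Zygmund family for $\Pi_n(\mathbb S^d)$ (with constants independent of $n$), and let $L_{n,p}$ be the associated weighted least $\ell_p$ approximation. Then for every $f\in B^\Theta_\gamma(L_{p,w})$ with $r>s_w/p$, $$\|f-L_{n,p}(f)\|_{q,w}\le C\,\Theta(n^{-1})\,n^{(\frac1p-\frac1q)_+s_w}\,\|f\|_{B^\Theta_\gamma(L_{p,w})},$$ where $C>0$ is independent of $f$ and $n$.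
   Context: $\mathbb S^d$ is the unit sphere of $\mathbb R^{d+1}$ with normalized surface measure $d\sigma$; caps ${\rm c}({\bf x},\rho)$ w.r.t. geodesic distance, $cB={\rm c}({\bf x},c\rho)$. Doubling weight: nonnegative integrable $w$ with $w(2B)\le Lw(B)$ for all caps ($w(E)=\int_Ew\,d\sigma$); critical index: $s_w>0$ with $\sup_Bw(2^mB)/w(B)\le C2^{ms_w}$, $m=0,1,\dots$. $L_{p,w}$ ($p<\infty$): norm $\|f\|_{p,w}=(\int|f|^pw\,d\sigma)^{1/p}$; $L_{\infty,w}=C(\mathbb S^d)$ with sup norm. $\Pi_n(\mathbb S^d)$: polynomials of degree $\le n$ in $d+1$ variables restricted to $\mathbb S^d$; $E_n(f)_{p,w}=\inf_{g\in\Pi_n}\|f-g\|_{p,w}$. $\Theta\in\Phi_s^*$: continuous on $[0,\infty)$, $\Theta(0)=0$, positive on $(0,\infty)$, almost increasing, $\Theta(nt)\le Cn^s\Theta(t)$, $\Theta(t)/t^{\alpha_1}$ almost increasing for some $\alpha_1>0$, $\Theta(t)/t^{\alpha_2}$ almost decreasing for some $0<\alpha_2<s$. $B^\Theta_\gamma(L_{p,w})$: norm $\|f\|_{p,w}+(\sum_{j\ge0}(E_{2^j}(f)_{p,w}/\Theta(2^{-j}))^\gamma)^{1/\gamma}$. MZ family: points ${\bf x}_1,\dots,{\bf x}_N\in\mathbb S^d$ and positive numbers $\tau_1,\dots,\tau_N$ form an $L_{p,w}$-MZ family for $\Pi_n(\mathbb S^d)$ ($1\le p<\infty$) if $A\|P\|_{p,w}^p\le\sum_k\tau_k|P({\bf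 x}_k)|^p\le B\|P\|_{p,w}^p$ for all $P\in\Pi_n(\mathbb S^d)$, with $A,B>0$ independent of $n,N$; for $p=\infty$, if $\|P\|_\infty\le C\max_k|P({\bf x}_k)|$ for all $P\in\Pi_n(\mathbb S^d)$. Discrete norm: $\|f\|_{(p)}=(\sum_k\tau_k|f({\bf x}_k)|^p)^{1/p}$ for $p<\infty$, $\max_k|f({\bf x}_k)|$ for $p=\infty$. The weighted least $\ell_p$ approximation of $f\in C(\mathbb S^d)$ is $L_{n,p}(f)\in\arg\min_{P\in\Pi_n(\mathbb S^d)}\|f-P\|_{(p)}$ (any minimizer when not unique). *)

theory Defs
  imports "HOL-Analysis.Analysis"
begin

(* The unit sphere S^d of R^(d+1) is  sphere 0 1 :: (real^'n) set  with d + 1 = CARD('n). *)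

(* radial projection onto the unit sphere (the origin, a null set, is sent to a fixed point) *)
definition sph_proj :: "real^'n \<Rightarrow> real^'n" where
  "sph_proj x = (if x = 0 then (SOME e. norm e = (1::real)) else sgn x)"

(* normalized surface measure on S^d: push-forward of the normalized Lebesgue measure
   of the unit ball under radial projection *)
definition sphere_measure :: "(real^'n) measure" where
  "sphere_measure = distr (uniform_measure lborel (ball 0 1))
                          (restrict_space borel (sphere 0 1)) sph_proj"

definition cap :: "real^'n \<Rightarrow> real \<Rightarrow> (real^'n) set" where
  "cap x \<rho> = {y \<in> sphere 0 1. arccos (x \<bullet> y) \<le> \<rho>}"

definition wmeas :: "(real^'n \<Rightarrow> real) \<Rightarrow> (real^'n) set \<Rightarrow> real" where
  "wmeas w E = integral\<^sup>L sphere_measure (\<lambda>y. indicator E y * w y)"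

definition doubling_weight :: "(real^'n \<Rightarrow> real) \<Rightarrow> bool" where
  "doubling_weight w \<longleftrightarrow>
     (\<forall>x\<in>sphere 0 1. w x \<ge> 0) \<and> integrable sphere_measure w \<and>
     (\<exists>L. \<forall>x\<in>sphere 0 1. \<forall>\<rho>>0. wmeas w (cap x (2*\<rho>)) \<le> L * wmeas w (cap x \<rho>))"

definition critical_index :: "(real^'n \<Rightarrow> real) \<Rightarrow> real \<Rightarrow> bool" where
  "critical_index w sw \<longleftrightarrow> 0 < sw \<and>
     (\<exists>C. \<forall>x\<in>sphere 0 1. \<forall>\<rho>>0. \<forall>m::nat.
        wmeas w (cap x (2^m * \<rho>)) \<le> C * 2 powr (real m * sw) * wmeas w (cap x \<rho>))"

definition multi_idx :: "nat \<Rightarrow> ('n::finite \<Rightarrow> nat) set" where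
  "multi_idx n = {\<alpha>. (\<Sum>i\<in>UNIV. \<alpha> i) \<le> n}"

(* Pi_n: polynomials of degree <= n in the d+1 coordinates (regarded on S^d) *)
definition sph_poly :: "nat \<Rightarrow> (real^'n \<Rightarrow> real) set" where
  "sph_poly n = {P. \<exists>c. \<forall>x. P x = (\<Sum>\<alpha>\<in>multi_idx n. c \<alpha> * (\<Prod>i\<in>UNIV. (x $ i) ^ \<alpha> i))}"

definition inv_exp :: "ereal \<Rightarrow> real" where
  "inv_exp p = (if p = \<infinity> then 0 else 1 / real_of_ereal p)"

definition wnorm :: "(real^'n \<Rightarrow> real) \<Rightarrow> ereal \<Rightarrow> (real^'n \<Rightarrow> real) \<Rightarrow> real" where
  "wnorm w p f = (if p = \<infinity> then (SUP x\<in>sphere 0 1. \<bar>f x\<bar>)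
     else (integral\<^sup>L sphere_measure (\<lambda>x. \<bar>f x\<bar> powr real_of_ereal p * w x))
            powr (1 / real_of_ereal p))"

definition best_approx :: "(real^'n \<Rightarrow> real) \<Rightarrow> ereal \<Rightarrow> nat \<Rightarrow> (real^'n \<Rightarrow> real) \<Rightarrow> real" where
  "best_approx w p n f = Inf {wnorm w p (\<lambda>x. f x - P x) | P. P \<in> sph_poly n}"

definition almost_increasing_on :: "real set \<Rightarrow> (real \<Rightarrow> real) \<Rightarrow> bool" where
  "almost_increasing_on S g \<longleftrightarrow> (\<exists>C. \<forall>t\<in>S. \<forall>t'\<in>S. t \<le> t' \<longrightarrow> g t \<le> C * g t')"

definition almost_decreasing_on :: "real set \<Rightarrow> (real \<Rightarrow> real) \<Rightarrow> bool" where
  "almost_decreasing_on S g \<longleftrightarrow> (\<exists>C. \<forall>t\<in>S. \<forall>t'\<in>S. t \<le> t' \<longrightarrow> g t' \<le> C * g t)"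

definition Phi_star :: "real \<Rightarrow> (real \<Rightarrow> real) \<Rightarrow> bool" where
  "Phi_star s \<Theta> \<longleftrightarrow>
     continuous_on {0..} \<Theta> \<and> \<Theta> 0 = 0 \<and> (\<forall>t>0. \<Theta> t > 0) \<and>
     almost_increasing_on {0..} \<Theta> \<and>
     (\<exists>C. \<forall>n::nat. \<forall>t\<ge>0. n \<ge> 1 \<longrightarrow> \<Theta> (real n * t) \<le> C * real n powr s * \<Theta> t) \<and>
     (\<exists>\<alpha>1>0. almost_increasing_on {0<..} (\<lambda>t. \<Theta> t / t powr \<alpha>1)) \<and>
     (\<exists>\<alpha>2>0. \<alpha>2 < s \<and> almost_decreasing_on {0<..} (\<lambda>t. \<Theta> t / t powr \<alpha>2))"

definition besov_seq :: "(real \<Rightarrow> real) \<Rightarrow> (real^'n \<Rightarrow> real) \<Rightarrow> ereal \<Rightarrow> (real^'n \<Rightarrow> real) \<Rightarrow> nat \<Rightarrow> real" where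
  "besov_seq \<Theta> w p f j = best_approx w p (2^j) f / \<Theta> (2 powr (- real j))"

(* f \<in> B^Theta_gamma(L_{p,w}) (for f \<in> C(S^d), which lies in L_{p,w}) *)
definition in_besov :: "(real \<Rightarrow> real) \<Rightarrow> ereal \<Rightarrow> (real^'n \<Rightarrow> real) \<Rightarrow> ereal \<Rightarrow> (real^'n \<Rightarrow> real) \<Rightarrow> bool" where
  "in_besov \<Theta> \<gamma> w p f \<longleftrightarrow>
     (if \<gamma> = \<infinity> then bdd_above (range (besov_seq \<Theta> w p f))
      else summable (\<lambda>j. besov_seq \<Theta> w p f j powr real_of_ereal \<gamma>))"

definition besov_norm :: "(real \<Rightarrow> real) \<Rightarrow> ereal \<Rightarrow> (real^'n \<Rightarrow> real) \<Rightarrow> ereal \<Rightarrow> (real^'n \<Rightarrow> real) \<Rightarrow> real" where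
  "besov_norm \<Theta> \<gamma> w p f = wnorm w p f +
     (if \<gamma> = \<infinity> then (SUP j. besov_seq \<Theta> w p f j)
      else (\<Sum>j. besov_seq \<Theta> w p f j powr real_of_ereal \<gamma>) powr (1 / real_of_ereal \<gamma>))"

definition disc_norm :: "ereal \<Rightarrow> nat \<Rightarrow> (nat \<Rightarrow> real^'n) \<Rightarrow> (nat \<Rightarrow> real) \<Rightarrow> (real^'n \<Rightarrow> real) \<Rightarrow> real" where
  "disc_norm p N X \<tau> f = (if p = \<infinity> then Max {\<bar>f (X k)\<bar> | k. k < N}
     else (\<Sum>k<N. \<tau> k * \<bar>f (X k)\<bar> powr real_of_ereal p) powr (1 / real_of_ereal p))"

definition MZ_families :: "(real^'n \<Rightarrow> real) \<Rightarrow> ereal \<Rightarrow> (nat \<Rightarrow> nat) \<Rightarrow> (nat \<Rightarrow> nat \<Rightarrow> real^'n) \<Rightarrow> (nat \<Rightarrow> nat \<Rightarrow> real) \<Rightarrow> bool" where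
  "MZ_families w p N X \<tau> \<longleftrightarrow>
     (\<forall>n. 0 < N n \<and> (\<forall>k<N n. X n k \<in> sphere 0 1 \<and> 0 < \<tau> n k)) \<and>
     (p \<noteq> \<infinity> \<longrightarrow> (\<exists>A B. 0 < A \<and> 0 < B \<and> (\<forall>n. \<forall>P\<in>sph_poly n.
         A * wnorm w p P powr real_of_ereal p \<le> (\<Sum>k<N n. \<tau> n k * \<bar>P (X n k)\<bar> powr real_of_ereal p) \<and>
         (\<Sum>k<N n. \<tau> n k * \<bar>P (X n k)\<bar> powr real_of_ereal p) \<le> B * wnorm w p P powr real_of_ereal p))) \<and>
     (p = \<infinity> \<longrightarrow> (\<exists>C. \<forall>n. \<forall>P\<in>sph_poly n.
         (SUP x\<in>sphere 0 1. \<bar>P x\<bar>) \<le> C * Max {\<bar>P (X n k)\<bar> | k. k < N n}))"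

definition least_lp_approx :: "ereal \<Rightarrow> nat \<Rightarrow> (nat \<Rightarrow> real^'n) \<Rightarrow> (nat \<Rightarrow> real) \<Rightarrow> nat \<Rightarrow> (real^'n \<Rightarrow> real) \<Rightarrow> (real^'n \<Rightarrow> real) \<Rightarrow> bool" where
  "least_lp_approx p N X \<tau> n f L \<longleftrightarrow> L \<in> sph_poly n \<and>
     (\<forall>Q\<in>sph_poly n. disc_norm p N X \<tau> (\<lambda>x. f x - L x) \<le> disc_norm p N X \<tau> (\<lambda>x. f x - Q x))"

end

theory Submission
  imports Defs "HOL-Complex_Analysis.Conformal_Mappings"
begin

text \<open>
  For \<open>p < \<infinity>\<close> everything rests on the weighted mean value inequality
  \<open>|P x|^p \<mu>(B(x,1/n)) \<le> C \<integral> |P y|^p (1 + n |x - y|)^(-2 s - 1) d\<mu>(y)\<close> for \<open>P \<in> \<Pi>_n\<close>,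
  where \<open>\<mu> = w d\<sigma>\<close> and \<open>s = s_w\<close>. To obtain it for a weight that is merely doubling, multiply \<open>P\<close>
  by a polynomial peaked at \<open>x\<close> (a power of a Dirichlet kernel in \<open>x \<bullet> y\<close>) and look at a maximum point
  of the product: by a Bernstein estimate on great circles the product stays above half of its maximum
  on a ball of radius \<open>c/n\<close> about that point. The inequality yields the Nikolskii inequality
  and, because the upper MZ bound tested on peaked polynomials gives \<open>\<tau>(B(x,\<rho>)) \<le> C \<mu>(B(x,\<rho>))\<close> for
  \<open>\<rho> \<ge> 1/n\<close>, also the upper MZ bound with the extra factor \<open>(m/n)^s\<close> for polynomials of degree \<open>m \<ge> n\<close>.

  Near-best approximations \<open>P_i\<close> of degree about \<open>2^i n\<close> then telescope to \<open>f\<close>, with geometric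
  decay since \<open>r > s/p\<close>. This bounds \<open>f - P_0\<close> uniformly and in the discrete norm, the lower MZ bound
  transfers the discrete estimate to \<open>P_0 - L\<close>, and the \<open>L_q\<close> bound follows by interpolating
  between \<open>L_p\<close> and \<open>L_\<infinity>\<close>.
\<close>

text \<open>The obstacle is that a doubling weight has no pointwise size: it may vanish or blow up
  at points, so only measures of whole balls can be compared, and the peak of the product lies at an
  unknown point. Moving the centre of a ball of radius 1/n over a distance d costs a factor (1 + n
  d)^s. This fixes the exponents: the localised kernel decays with order at least 3s + 1; s is spent
  on moving the ball from the peak back to x, which leaves 2s + 1; another s is spent on moving
  balls from the nodes to the integration point, which leaves s + 1; and that suffices to sum dyadic
  balls, since 2^(-j(s+1)) 2^(js) = 2^(-j).

  The condition r > s/p balances the other loss: the Nikolskii inequality and the discrete estimate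
  both grow by 2^(s/p) when the degree doubles, against the gain 2^(-r) from smoothness. For p =
  infinity this loss does not occur, and P_0 alone with the Marcinkiewicz-Zygmund inequality gives
  the uniform bound.\<close>

section \<open>Algebra of polynomials on the sphere\<close>

definition monom_fun :: "('n::finite \<Rightarrow> nat) \<Rightarrow> real^'n \<Rightarrow> real" where
  "monom_fun \<alpha> x = (\<Prod>i\<in>UNIV. (x $ i) ^ \<alpha> i)"

lemma sph_poly_iff: "P \<in> sph_poly n \<longleftrightarrow> (\<exists>c. \<forall>x. P x = (\<Sum>\<alpha>\<in>multi_idx n. c \<alpha> * monom_fun \<alpha> x))"
  by (simp add: sph_poly_def monom_fun_def)

lemma finite_multi_idx [simp]: "finite (multi_idx n :: ('n::finite \<Rightarrow> nat) set)"
proof (rule finite_subset)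
  show "multi_idx n \<subseteq> PiE UNIV (\<lambda>_::'n. {..n})"
  proof
    fix \<alpha> :: "'n \<Rightarrow> nat" assume "\<alpha> \<in> multi_idx n"
    then have "sum \<alpha> UNIV \<le> n" by (simp add: multi_idx_def)
    moreover have "\<alpha> i \<le> sum \<alpha> UNIV" for i by (rule member_le_sum) auto
    ultimately show "\<alpha> \<in> PiE UNIV (\<lambda>_::'n. {..n})" by (auto intro: order_trans)
  qed
qed (auto intro: finite_PiE)

lemma sph_poly_monom: assumes "\<alpha> \<in> multi_idx n" shows "monom_fun \<alpha> \<in> sph_poly n"
  unfolding sph_poly_iff
  by (rule exI[of _ "\<lambda>\<beta>. if \<beta> = \<alpha> then 1 else 0"]) (use assms in \<open>simp add: if_distrib[of "\<lambda>c. c * _"] sum.delta cong: if_cong\<close>)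

lemma sph_poly_add:
  assumes "P \<in> sph_poly n" "Q \<in> sph_poly n"
  shows "(\<lambda>x. P x + Q x) \<in> sph_poly n"
proof -
  from assms obtain c d where "\<forall>x. P x = (\<Sum>\<alpha>\<in>multi_idx n. c \<alpha> * monom_fun \<alpha> x)"
    "\<forall>x. Q x = (\<Sum>\<alpha>\<in>multi_idx n. d \<alpha> * monom_fun \<alpha> x)" by (auto simp: sph_poly_iff)
  then show ?thesis unfolding sph_poly_iff
    by (intro exI[of _ "\<lambda>\<alpha>. c \<alpha> + d \<alpha>"]) (simp add: distrib_right sum.distrib)
qed

lemma sph_poly_cmult:
  assumes "P \<in> sph_poly n"
  shows "(\<lambda>x. a * P x) \<in> sph_poly n"
proof -
  from assms obtain c where "\<forall>x. P x = (\<Sum>\<alpha>\<in>multi_idx n. c \<alpha> * monom_fun \<alpha> x)"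
    by (auto simp: sph_poly_iff)
  then show ?thesis unfolding sph_poly_iff
    by (intro exI[of _ "\<lambda>\<alpha>. a * c \<alpha>"]) (simp add: sum_distrib_left mult.assoc)
qed

lemma sph_poly_zero: "(\<lambda>_. 0) \<in> sph_poly n"
  unfolding sph_poly_iff by (rule exI[of _ "\<lambda>_. 0"]) simp

lemma sph_poly_sum:
  assumes "\<And>i. i \<in> I \<Longrightarrow> P i \<in> sph_poly n"
  shows "(\<lambda>x. \<Sum>i\<in>I. P i x) \<in> sph_poly n"
  using assms
  by (induction I rule: infinite_finite_induct) (auto intro: sph_poly_add sph_poly_zero)

lemma sph_poly_diff:
  assumes "P \<in> sph_poly n" "Q \<in> sph_poly n"
  shows "(\<lambda>x. P x - Q x) \<in> sph_poly n"
  using sph_poly_add[OF assms(1) sph_poly_cmult[OF assms(2), of "-1"]] by simp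

lemma sph_poly_mult:
  assumes "P \<in> sph_poly n" "Q \<in> sph_poly m"
  shows "(\<lambda>x. P x * Q x) \<in> sph_poly (n + m)"
proof -
  from assms obtain c d where P: "\<forall>x. P x = (\<Sum>\<alpha>\<in>multi_idx n. c \<alpha> * monom_fun \<alpha> x)"
    and Q: "\<forall>x. Q x = (\<Sum>\<alpha>\<in>multi_idx m. d \<alpha> * monom_fun \<alpha> x)" by (auto simp: sph_poly_iff)
  have eq: "(\<lambda>x. P x * Q x) = (\<lambda>x. \<Sum>\<alpha>\<in>multi_idx n. \<Sum>\<beta>\<in>multi_idx m.
      (c \<alpha> * d \<beta>) * monom_fun (\<lambda>i. \<alpha> i + \<beta> i) x)"
    by (simp add: P Q sum_product monom_fun_def power_add prod.distrib mult_ac)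
  show ?thesis unfolding eq
    by (intro sph_poly_sum sph_poly_cmult sph_poly_monom) (simp add: multi_idx_def sum.distrib add_mono)
qed

lemma sph_poly_mono:
  assumes "P \<in> sph_poly n" "n \<le> m"
  shows "P \<in> sph_poly m"
proof -
  from assms obtain c where "\<forall>x. P x = (\<Sum>\<alpha>\<in>multi_idx n. c \<alpha> * monom_fun \<alpha> x)"
    by (auto simp: sph_poly_iff)
  then have "P = (\<lambda>x. \<Sum>\<alpha>\<in>multi_idx n. c \<alpha> * monom_fun \<alpha> x)" by auto
  also have "\<dots> \<in> sph_poly m"
    by (intro sph_poly_sum sph_poly_cmult sph_poly_monom) (use assms(2) in \<open>auto simp: multi_idx_def\<close>)
  finally show ?thesis .
qed

lemma sph_poly_const: "(\<lambda>_. a) \<in> sph_poly n"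
  using sph_poly_cmult[OF sph_poly_monom[of "\<lambda>_. 0" n], of a]
  by (simp add: multi_idx_def monom_fun_def)

lemma sph_poly_inner:
  fixes x :: "real^'n"
  assumes "n \<ge> 1"
  shows "(\<lambda>y. x \<bullet> y) \<in> sph_poly n"
proof -
  have eq: "(\<lambda>y. x \<bullet> y) = (\<lambda>y. \<Sum>i\<in>UNIV. x $ i * monom_fun (\<lambda>j. if j = i then 1 else 0) y)"
  proof
    fix y :: "real^'n"
    have "monom_fun (\<lambda>j. if j = i then 1 else 0) y = y $ i" for i
      unfolding monom_fun_def
      by (subst prod.cong[OF refl, of UNIV _ "\<lambda>j. if j = i then y $ j else 1"]) auto
    then show "x \<bullet> y = (\<Sum>i\<in>UNIV. x $ i * monom_fun (\<lambda>j. if j = i then 1 else 0) y)"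
      by (simp add: inner_vec_def)
  qed
  show ?thesis unfolding eq
    by (intro sph_poly_sum sph_poly_cmult sph_poly_monom) (use assms in \<open>auto simp: multi_idx_def\<close>)
qed

lemma sph_poly_power:
  assumes "P \<in> sph_poly n"
  shows "(\<lambda>x. P x ^ b) \<in> sph_poly (b * n)"
  by (induction b) (use sph_poly_mult[OF assms] in \<open>auto simp: sph_poly_const\<close>)

lemma continuous_on_sph_poly: "P \<in> sph_poly n \<Longrightarrow> continuous_on S P"
proof -
  assume "P \<in> sph_poly n"
  then obtain c where "\<forall>x. P x = (\<Sum>\<alpha>\<in>multi_idx n. c \<alpha> * monom_fun \<alpha> x)"
    by (auto simp: sph_poly_iff)
  then have "P = (\<lambda>x. \<Sum>\<alpha>\<in>multi_idx n. c \<alpha> * monom_fun \<alpha> x)" by auto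
  moreover have "continuous_on S (\<lambda>x. \<Sum>\<alpha>\<in>multi_idx n. c \<alpha> * monom_fun \<alpha> x)"
    unfolding monom_fun_def by (intro continuous_intros)
  ultimately show ?thesis by simp
qed

subsection \<open>Localised polynomials\<close>

text \<open>Chebyshev polynomials of the first kind. The recursion shows the degree of
  \<open>cheb k (x \<bullet> y)\<close> in \<open>y\<close>, the identity \<open>cheb_cos\<close>
  its size.\<close>

fun cheb :: "nat \<Rightarrow> real \<Rightarrow> real" where
  "cheb 0 t = 1"
| "cheb (Suc 0) t = t"
| "cheb (Suc (Suc k)) t = 2 * t * cheb (Suc k) t - cheb k t"

lemma cheb_cos: "cheb k (cos \<theta>) = cos (real k * \<theta>)"
proof (induction k "cos \<theta>" rule: cheb.induct)
  case (3 k)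
  have "cos (real (Suc (Suc k)) * \<theta>) + cos (real k * \<theta>) = 2 * cos \<theta> * cos (real (Suc k) * \<theta>)"
    using cos_plus_cos[of "real (Suc (Suc k)) * \<theta>" "real k * \<theta>"]
    by (simp add: algebra_simps add_divide_distrib)
  with 3 show ?case by simp
qed auto

lemma sph_poly_cheb: "(\<lambda>y. cheb k (x \<bullet> y)) \<in> sph_poly k"
\<comment> \<open>\<open>cheb.induct\<close> also carries a real argument; \<open>0\<close> is a
  placeholder for it, as the claim concerns \<open>k\<close> alone.\<close>
proof (induction k "0::real" rule: cheb.induct)
  case (3 k)
  have "(\<lambda>y. (x \<bullet> y) * cheb (Suc k) (x \<bullet> y)) \<in> sph_poly (1 + Suc k)"
    by (intro sph_poly_mult sph_poly_inner 3) auto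
  then have "(\<lambda>y. 2 * ((x \<bullet> y) * cheb (Suc k) (x \<bullet> y))) \<in> sph_poly (Suc (Suc k))"
    by (intro sph_poly_cmult) auto
  moreover have "(\<lambda>y. cheb k (x \<bullet> y)) \<in> sph_poly (Suc (Suc k))"
    using 3 by (auto intro: sph_poly_mono)
  ultimately show ?case using sph_poly_diff by (simp add: mult.assoc)
qed (auto simp: sph_poly_const sph_poly_inner)

text \<open>At the cosine of an angle a this is sin((m + 1/2) a) / ((2m + 1) sin(a/2)), the
  Dirichlet kernel normalised to the value 1 at \<open>t = 1\<close>.\<close>

definition dirichlet :: "nat \<Rightarrow> real \<Rightarrow> real" where
  "dirichlet m t = (1 + 2 * (\<Sum>k=1..m. cheb k t)) / (2 * real m + 1)"

lemma sph_poly_dirichlet: "(\<lambda>y. dirichlet m (x \<bullet> y)) \<in> sph_poly m"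
proof -
  have "(\<lambda>y. 1 + 2 * (\<Sum>k=1..m. cheb k (x \<bullet> y))) \<in> sph_poly m"
    by (intro sph_poly_add sph_poly_const sph_poly_cmult sph_poly_sum)
       (auto intro: sph_poly_mono[OF sph_poly_cheb])
  from sph_poly_cmult[OF this, of "1 / (2 * real m + 1)"] show ?thesis
    by (simp add: dirichlet_def)
qed

lemma dirichlet_1: "dirichlet m 1 = 1"
proof -
  have "cheb k 1 = 1" for k using cheb_cos[of k 0] by simp
  then show ?thesis by (simp add: dirichlet_def)
qed

lemma abs_dirichlet_le_1: "\<bar>dirichlet m (cos \<theta>)\<bar> \<le> 1"
proof -
  have "\<bar>\<Sum>k=1..m. cos (real k * \<theta>)\<bar> \<le> (\<Sum>k=1..m. 1)"
    by (rule order_trans[OF sum_abs]) (intro sum_mono, auto)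
  then have "\<bar>1 + 2 * (\<Sum>k=1..m. cos (real k * \<theta>))\<bar> \<le> 2 * real m + 1" by simp
  then show ?thesis by (simp add: dirichlet_def cheb_cos abs_divide)
qed

text \<open>The closed form of the kernel, multiplied through by its denominator so that the angle 0
  needs no separate case. The sum telescopes because 2 cos a sin b is a difference of sines.\<close>

lemma dirichlet_sin:
  "sin (\<theta> / 2) * (1 + 2 * (\<Sum>k=1..m. cos (real k * \<theta>))) = sin ((real m + 1/2) * \<theta>)"
proof (induction m)
  case (Suc m)
  have "sin (\<theta>/2) * (1 + 2 * (\<Sum>k=1..Suc m. cos (real k * \<theta>)))
      = sin ((real m + 1/2) * \<theta>) + 2 * cos (real (Suc m) * \<theta>) * sin (\<theta>/2)"
    using Suc by (simp add: algebra_simps)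
  also have "2 * cos (real (Suc m) * \<theta>) * sin (\<theta>/2)
      = sin (real (Suc m) * \<theta> + \<theta>/2) - sin (real (Suc m) * \<theta> - \<theta>/2)"
    by (simp add: sin_add sin_diff)
  also have "real (Suc m) * \<theta> - \<theta>/2 = (real m + 1/2) * \<theta>" by (simp add: algebra_simps)
  also have "real (Suc m) * \<theta> + \<theta>/2 = (real (Suc m) + 1/2) * \<theta>" by (simp add: algebra_simps)
  finally show ?case by simp
qed auto

text \<open>The half-angle sine is also the denominator of the Dirichlet kernel, so that the kernel
  naturally decays in the chordal distance.\<close>

lemma dist_sphere_eq:
  fixes x y :: "real^'n"
  assumes "norm x = 1" "norm y = 1"
  shows "norm (x - y) = 2 * sin (arccos (x \<bullet> y) / 2)"
proof -
  have b: "\<bar>x \<bullet> y\<bar> \<le> 1" using Cauchy_Schwarz_ineq2[of x y] assms by simp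
  define \<theta> where "\<theta> = arccos (x \<bullet> y)"
  have th: "0 \<le> \<theta>" "\<theta> \<le> pi" "cos \<theta> = x \<bullet> y"
    using b arccos_bounded[of "x \<bullet> y"] by (auto simp: \<theta>_def abs_le_iff)
  have "(norm (x - y))\<^sup>2 = 2 - 2 * cos \<theta>"
    using assms by (simp add: power2_norm_eq_inner inner_diff inner_commute th flip: norm_eq_1)
       (simp add: norm_eq_1 inner_commute)
  also have "\<dots> = (2 * sin (\<theta>/2))\<^sup>2"
    using cos_double_sin[of "\<theta>/2"] by (simp add: power_mult_distrib)
  finally have "(norm (x - y))\<^sup>2 = (2 * sin (\<theta>/2))\<^sup>2" .
  moreover have "0 \<le> 2 * sin (\<theta>/2)" using th by (auto intro: sin_ge_zero)
  ultimately show ?thesis unfolding \<theta>_def by (metis power2_eq_iff_nonneg norm_ge_zero)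
qed

text \<open>The witness is the \<open>b\<close>-th power of a Dirichlet kernel of degree about
  \<open>n / b\<close>: the degrees add up to at most \<open>n\<close>, and each factor contributes
  one order of decay at scale \<open>1 / n\<close>.\<close>

lemma exists_localised_poly:
  fixes x :: "real^'n"
  assumes x: "norm x = 1" and b: "b \<ge> 1"
  shows "\<exists>K\<in>sph_poly n. K x = 1 \<and> (\<forall>y\<in>sphere 0 1. \<bar>K y\<bar> \<le> 1 \<and>
           \<bar>K y\<bar> \<le> ((1 + 2 * real b) / (1 + real n * norm (x - y))) ^ b)"
proof -
  define m where "m = n div b"
  let ?K = "\<lambda>y. dirichlet m (x \<bullet> y) ^ b"
  have nm: "real n \<le> real b * (2 * real m + 1)"
  proof -
    have "n < b * (m + 1)" unfolding m_def using b dividend_less_times_div[of b n] by (simp add: algebra_simps)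
    then have "real n \<le> real b * (real m + 1)" by (metis less_imp_le of_nat_1 of_nat_add of_nat_le_iff of_nat_mult)
    also have "\<dots> \<le> real b * (2 * real m + 1)" by (intro mult_left_mono) auto
    finally show ?thesis .
  qed
  have "?K \<in> sph_poly (b * m)" by (intro sph_poly_power sph_poly_dirichlet)
  moreover have "b * m \<le> n" by (simp add: m_def)
  ultimately have mem: "?K \<in> sph_poly n" by (rule sph_poly_mono)
  have K1: "?K x = 1" using x by (simp add: dot_square_norm dirichlet_1)
  have bd: "\<bar>?K y\<bar> \<le> 1 \<and> \<bar>?K y\<bar> \<le> ((1 + 2 * real b) / (1 + real n * norm (x - y))) ^ b"
    if y: "y \<in> sphere 0 1" for y
  proof -
    have ny: "norm y = 1" using y by simp
    have "\<bar>x \<bullet> y\<bar> \<le> 1" using Cauchy_Schwarz_ineq2[of x y] x ny by simp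
    then obtain \<theta> where \<theta>: "\<theta> = arccos (x \<bullet> y)" "cos \<theta> = x \<bullet> y" by (simp add: abs_le_iff)
    let ?D = "\<bar>dirichlet m (x \<bullet> y)\<bar>" and ?r = "norm (x - y)"
    have D1: "?D \<le> 1" using abs_dirichlet_le_1[of m \<theta>] \<theta> by simp
    have r: "?r = 2 * sin (\<theta>/2)" using dist_sphere_eq[OF x ny] \<theta> by simp
    have "sin (\<theta>/2) * ((2 * real m + 1) * dirichlet m (x \<bullet> y)) = sin ((real m + 1/2) * \<theta>)"
      by (simp add: dirichlet_def cheb_cos \<theta>(2)[symmetric] dirichlet_sin[simplified])
    then have "\<bar>sin (\<theta>/2) * ((2 * real m + 1) * dirichlet m (x \<bullet> y))\<bar> \<le> 1"
      by (metis abs_sin_le_one)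
    then have D2: "?r * ((2 * real m + 1) * ?D) \<le> 2"
      using norm_ge_zero[of "x-y"] unfolding r by (simp add: abs_mult)
    have "?D * (real n * ?r) \<le> ?D * ((real b * (2 * real m + 1)) * ?r)"
      by (intro mult_left_mono mult_right_mono nm) auto
    also have "\<dots> = real b * (?r * ((2 * real m + 1) * ?D))" by (simp add: mult_ac)
    also have "\<dots> \<le> real b * 2" by (intro mult_left_mono D2) auto
    \<comment> \<open>The \<open>1\<close> in the denominator comes from adding the trivial bound
      \<open>?D \<le> 1\<close>; it keeps the estimate meaningful near \<open>x\<close>.\<close>
    finally have "?D * (1 + real n * ?r) \<le> 1 + 2 * real b" using D1 by (simp add: distrib_left)
    moreover have "0 < 1 + real n * ?r" by (simp add: add_pos_nonneg)
    ultimately have "?D \<le> (1 + 2 * real b) / (1 + real n * ?r)" by (simp add: pos_le_divide_eq)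
    then show ?thesis using D1 by (auto simp: power_abs intro: power_mono power_le_one)
  qed
  show ?thesis using mem K1 bd by (intro bexI[of _ ?K]) auto
qed

subsection \<open>Great circles and a Bernstein estimate\<close>

text \<open>
  The reciprocal \<open>h\<close> controls the growth of \<open>g\<close> outside the unit disc, so that the Cauchy estimate
  applies on circles of radius \<open>1 / k\<close>.
\<close>

lemma bernstein_reciprocal:
  fixes g h :: "complex \<Rightarrow> complex"
  assumes g: "g holomorphic_on UNIV" and h: "h holomorphic_on UNIV"
    and gh: "\<And>z. z \<noteq> 0 \<Longrightarrow> g z = z ^ k * h (1 / z)"
    and gM: "\<And>z. norm z = 1 \<Longrightarrow> norm (g z) \<le> M" and hM: "\<And>z. norm z = 1 \<Longrightarrow> norm (h z) \<le> M"
    and k: "k \<ge> 1" and z: "norm z \<le> 1" "norm z' \<le> 1"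
  shows "norm (g z - g z') \<le> 3 * real k * M * norm (z - z')"
proof -
  have mm: "norm (f z) \<le> M" if "f holomorphic_on UNIV" "\<And>z. norm z = 1 \<Longrightarrow> norm (f z) \<le> M" "norm z \<le> 1"
    for f :: "complex \<Rightarrow> complex" and z
  proof (rule maximum_modulus_frontier[of f "cball 0 1"])
    show "f holomorphic_on interior (cball 0 1)" using that(1) holomorphic_on_subset by blast
    show "continuous_on (closure (cball 0 1)) f"
      using that(1) holomorphic_on_imp_continuous_on holomorphic_on_subset by blast
  qed (use that in \<open>auto simp: frontier_cball\<close>)
  have M0: "0 \<le> M" using gM[of 1] norm_ge_zero[of "g 1"] by (simp del: norm_ge_zero)
  have out: "norm (g z) \<le> M * 3" if z: "norm z \<le> 1 + 1 / real k" for z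
  proof (cases "norm z \<le> 1")
    case True
    then show ?thesis using mm[OF g gM True] M0 by linarith
  next
    case False
    then have "z \<noteq> 0" by auto
    have "norm (1 / z) \<le> 1" using False by (simp add: norm_divide divide_simps)
    have "norm (g z) = norm z ^ k * norm (h (1 / z))"
      using gh[OF \<open>z \<noteq> 0\<close>] by (simp add: norm_mult norm_power)
    also have "\<dots> \<le> (1 + 1 / real k) ^ k * M"
      by (intro mult_mono power_mono z mm[OF h hM]) (use \<open>norm (1/z) \<le> 1\<close> in auto)
    \<comment> \<open>This is why the radius is \<open>1 / k\<close>: the growth factor is at most
      e, and rounding e up to 3 produces the constant of the lemma.\<close>
    also have "(1 + 1 / real k) ^ k \<le> exp 1"
      using exp_ge_one_plus_x_over_n_power_n[of k 1] k by simp
    also have "exp 1 \<le> (3::real)" by (rule exp_le)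
    finally show ?thesis using M0 by (simp add: mult.commute mult_right_mono)
  qed
  have der: "norm (deriv g z) \<le> 3 * real k * M" if z: "norm z \<le> 1" for z
  proof -
    have "norm ((deriv ^^ 1) g z) \<le> fact 1 * (M * 3) / (1 / real k) ^ 1"
    proof (rule Cauchy_inequality)
      fix w assume w: "norm (z - w) = 1 / real k"
      have "norm w \<le> norm z + norm (z - w)" by (metis norm_minus_commute norm_triangle_sub)
      then show "norm (g w) \<le> M * 3" using z w by (intro out) auto
    qed (use g k in \<open>auto intro: holomorphic_on_subset holomorphic_on_imp_continuous_on\<close>)
    then show ?thesis by (simp add: mult_ac)
  qed
  show ?thesis
  proof (rule field_differentiable_bound[of "cball 0 1" g "deriv g"])
    show "(g has_field_derivative deriv g z) (at z within cball 0 1)" for z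
      using g by (meson UNIV_I has_field_derivative_at_within holomorphic_derivI open_UNIV)
  qed (use der z in auto)
qed

text \<open>
  On \<open>z = cis \<phi>\<close> this is \<open>z ^ n\<close> times the restriction of the polynomial to a great circle; exchanging
  \<open>a\<close> and \<open>b\<close> reverses the orientation, which is why \<open>z \<mapsto> 1 / z\<close> is a symmetry.
\<close>

definition circ_poly :: "nat \<Rightarrow> (('n::finite \<Rightarrow> nat) \<Rightarrow> real) \<Rightarrow> ('n \<Rightarrow> complex) \<Rightarrow> ('n \<Rightarrow> complex) \<Rightarrow> complex \<Rightarrow> complex" where
  "circ_poly n c a b z = (\<Sum>\<alpha>\<in>multi_idx n. complex_of_real (c \<alpha>) *
     (z ^ (n - sum \<alpha> UNIV) * (\<Prod>i\<in>UNIV. (a i * z\<^sup>2 + b i) ^ \<alpha> i)))"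

lemma holomorphic_circ_poly: "circ_poly n c a b holomorphic_on S"
  unfolding circ_poly_def[abs_def] by (intro holomorphic_intros)

text \<open>Pulling z^2 out of each factor swaps \<open>a\<close> and \<open>b\<close>. The padding
  z^(n - |\<alpha>|) makes every term symmetric about degree \<open>n\<close>, so that all of them
  acquire the same power z^(2n).\<close>

lemma circ_poly_reciprocal:
  assumes "z \<noteq> 0"
  shows "circ_poly n c a b z = z ^ (2 * n) * circ_poly n c b a (1 / z)"
proof -
  have "z ^ (n - sum \<alpha> UNIV) * (\<Prod>i\<in>UNIV. (a i * z\<^sup>2 + b i) ^ \<alpha> i)
     = z ^ (2 * n) * ((1 / z) ^ (n - sum \<alpha> UNIV) * (\<Prod>i\<in>UNIV. (b i * (1 / z)\<^sup>2 + a i) ^ \<alpha> i))"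
    if "\<alpha> \<in> multi_idx n" for \<alpha>
  proof -
    define s where "s = sum \<alpha> UNIV"
    have s: "s \<le> n" using that by (simp add: multi_idx_def s_def)
    have "a i * z\<^sup>2 + b i = z\<^sup>2 * (b i * (1 / z)\<^sup>2 + a i)" for i
      using assms by (simp add: field_simps)
    then have "(\<Prod>i\<in>UNIV. (a i * z\<^sup>2 + b i) ^ \<alpha> i) = (\<Prod>i\<in>UNIV. (z\<^sup>2) ^ \<alpha> i * (b i * (1 / z)\<^sup>2 + a i) ^ \<alpha> i)"
      by (simp add: power_mult_distrib)
    also have "\<dots> = (z\<^sup>2) ^ s * (\<Prod>i\<in>UNIV. (b i * (1 / z)\<^sup>2 + a i) ^ \<alpha> i)"
      by (simp add: prod.distrib power_sum s_def)
    finally have 1: "(\<Prod>i\<in>UNIV. (a i * z\<^sup>2 + b i) ^ \<alpha> i)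
       = (z\<^sup>2) ^ s * (\<Prod>i\<in>UNIV. (b i * (1 / z)\<^sup>2 + a i) ^ \<alpha> i)" .
    have "z ^ (n - s) * (z\<^sup>2) ^ s * z ^ (n - s) = z ^ (2 * n)"
      using s by (simp add: mult_2 flip: power_mult power_add)
    then have "z ^ (n - s) * (z\<^sup>2) ^ s = z ^ (2 * n) * (1 / z) ^ (n - s)"
      using assms by (simp add: field_simps)
    then show ?thesis unfolding 1 s_def[symmetric] by (simp add: mult.assoc[symmetric])
  qed
  then show ?thesis unfolding circ_poly_def sum_distrib_left
    by (intro sum.cong refl) (simp add: mult.left_commute)
qed

text \<open>With z = cis phi, cos phi = (z + 1/z)/2 and sin phi = (z - 1/z)/(2i). Multiplying a
  coordinate of the point on the circle by z gives the quadratic a z^2 + b with these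
  coefficients.\<close>

lemma circ_poly_cis:
  fixes x u :: "real^'n"
  assumes P: "\<forall>x. P x = (\<Sum>\<alpha>\<in>multi_idx n. c \<alpha> * monom_fun \<alpha> x)"
  shows "circ_poly n c (\<lambda>i. Complex (x$i/2) (- (u$i)/2)) (\<lambda>i. Complex (x$i/2) (u$i/2)) (cis \<phi>)
    = cis \<phi> ^ n * complex_of_real (P (cos \<phi> *\<^sub>R x + sin \<phi> *\<^sub>R u))"
proof -
  let ?z = "cis \<phi>" and ?y = "cos \<phi> *\<^sub>R x + sin \<phi> *\<^sub>R u"
  have cs: "(cos \<phi>)\<^sup>2 + (sin \<phi>)\<^sup>2 = 1" by simp
  have 1: "Complex (x$i/2) (- (u$i)/2) * ?z\<^sup>2 + Complex (x$i/2) (u$i/2) = ?z * complex_of_real (?y $ i)" for i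
  proof -
    have z2: "?z\<^sup>2 = Complex (2 * (cos \<phi>)\<^sup>2 - 1) (2 * sin \<phi> * cos \<phi>)"
      by (simp add: complex_eq_iff Complex.DeMoivre sin_double cos_double_cos)
    have e: "u$i * (sin \<phi>)\<^sup>2 = u$i * (1 - (cos \<phi>)\<^sup>2)"
      by (simp add: sin_squared_eq)
    show ?thesis unfolding z2
    proof (rule complex_eqI)
      show "Im (Complex (x$i/2) (- (u$i)/2) * Complex (2 * (cos \<phi>)\<^sup>2 - 1) (2 * sin \<phi> * cos \<phi>) + Complex (x$i/2) (u$i/2))
          = Im (?z * complex_of_real (?y $ i))"
        using e by (simp add: power2_eq_square algebra_simps)
    qed (simp add: power2_eq_square algebra_simps)
  qed
  have "?z ^ (n - sum \<alpha> UNIV) * (\<Prod>i\<in>UNIV. (Complex (x$i/2) (- (u$i)/2) * ?z\<^sup>2 + Complex (x$i/2) (u$i/2)) ^ \<alpha> i)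
      = ?z ^ n * complex_of_real (monom_fun \<alpha> ?y)" if "\<alpha> \<in> multi_idx n" for \<alpha>
  proof -
    have s: "sum \<alpha> UNIV \<le> n" using that by (simp add: multi_idx_def)
    have "(\<Prod>i\<in>UNIV. (?z * complex_of_real (?y $ i)) ^ \<alpha> i)
       = ?z ^ (sum \<alpha> UNIV) * complex_of_real (monom_fun \<alpha> ?y)"
      by (simp add: power_mult_distrib prod.distrib power_sum monom_fun_def)
    then show ?thesis unfolding 1 using s by (simp add: mult.assoc[symmetric] flip: power_add)
  qed
  then show ?thesis unfolding circ_poly_def P[rule_format] of_real_sum sum_distrib_left
    by (intro sum.cong refl) (simp add: mult.left_commute)
qed

text \<open>The extension of \<open>P\<close> from the great circle through \<open>x\<close> and
  \<open>y\<close> satisfies the reciprocal relation with exponent 2n and is bounded by |P x| on the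
  unit circle, so Bernstein allows a change of at most 3 * 2n * |P x| / (24n) = |P x| / 4.\<close>

lemma sph_poly_near_max:
  fixes x :: "real^'n"
  assumes P: "P \<in> sph_poly n" and n: "n \<ge> 1" and x: "norm x = 1" and y: "norm y = 1"
    and max: "\<And>z. norm z = 1 \<Longrightarrow> \<bar>P z\<bar> \<le> \<bar>P x\<bar>" and xy: "norm (x - y) \<le> 1 / (24 * real n)"
  shows "\<bar>P x\<bar> \<le> 2 * \<bar>P y\<bar>"
proof (cases "y = x")
  case False
  obtain c where c: "\<forall>x. P x = (\<Sum>\<alpha>\<in>multi_idx n. c \<alpha> * monom_fun \<alpha> x)"
    using P by (auto simp: sph_poly_iff)
  have xx: "x \<bullet> x = 1" "y \<bullet> y = 1" using x y by (simp_all add: norm_eq_1)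
  define t where "t = x \<bullet> y"
  have "0 < (norm (x - y))\<^sup>2" using False by simp
  also have "(norm (x - y))\<^sup>2 = 2 - 2 * t"
    by (simp add: power2_norm_eq_inner inner_diff xx t_def inner_commute)
  finally have t1: "t < 1" and nxy: "(norm (x - y))\<^sup>2 = 2 - 2 * t"
    using \<open>(norm (x - y))\<^sup>2 = 2 - 2 * t\<close> by auto
  \<comment> \<open>This excludes the antipode, so that \<open>x\<close> and \<open>y\<close>
    determine a great circle.\<close>
  have small: "norm (x - y) \<le> 1" using xy n by (smt (verit) divide_le_eq_1 of_nat_1 of_nat_le_iff)
  then have "(norm (x - y))\<^sup>2 \<le> 1" by (simp add: power_le_one)
  then have t0: "0 < t" using nxy by simp
  define \<sigma> where "\<sigma> = sqrt (1 - t\<^sup>2)"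
  have "t\<^sup>2 < 1" using t0 t1 by (simp add: power_less_one_iff abs_square_less_1)
  then have \<sigma>: "0 < \<sigma>" "\<sigma>\<^sup>2 = 1 - t\<^sup>2" by (auto simp: \<sigma>_def)
  \<comment> \<open>The unit tangent at \<open>x\<close> pointing towards \<open>y\<close>, by
    Gram-Schmidt.\<close>
  define u where "u = (1 / \<sigma>) *\<^sub>R (y - t *\<^sub>R x)"
  have xu: "x \<bullet> u = 0" "u \<bullet> x = 0" by (simp_all add: u_def inner_diff xx t_def inner_commute)
  have "(y - t *\<^sub>R x) \<bullet> (y - t *\<^sub>R x) = \<sigma>\<^sup>2"
    unfolding \<sigma>(2) by (simp add: inner_diff xx inner_commute t_def[symmetric] power2_eq_square)
  then have uu: "u \<bullet> u = 1" using \<sigma>(1) by (simp add: u_def power2_eq_square)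
  have unit: "norm (cos \<phi> *\<^sub>R x + sin \<phi> *\<^sub>R u) = 1" "norm (cos \<phi> *\<^sub>R x - sin \<phi> *\<^sub>R u) = 1" for \<phi>
    unfolding norm_eq_1 by (simp_all add: inner_add inner_diff xx xu uu power2_eq_square[symmetric])
  define \<theta> where "\<theta> = arccos t"
  have th: "cos \<theta> = t" "sin \<theta> = \<sigma>" using t0 t1 by (auto simp: \<theta>_def \<sigma>_def sin_arccos)
  have y_eq: "y = cos \<theta> *\<^sub>R x + sin \<theta> *\<^sub>R u" using \<sigma>(1) by (simp add: th u_def)
  define g h where "g = circ_poly n c (\<lambda>i. Complex (x$i/2) (- (u$i)/2)) (\<lambda>i. Complex (x$i/2) (u$i/2))"
    and "h = circ_poly n c (\<lambda>i. Complex (x$i/2) (u$i/2)) (\<lambda>i. Complex (x$i/2) (- (u$i)/2))"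
  have g: "norm (g (cis \<phi>)) = \<bar>P (cos \<phi> *\<^sub>R x + sin \<phi> *\<^sub>R u)\<bar>" for \<phi>
    using circ_poly_cis[OF c, of x u \<phi>] by (simp add: g_def norm_mult norm_power)
  \<comment> \<open>Reversing the tangent swaps the two coefficient families, so \<open>h\<close> is
    the extension for \<open>-u\<close> and obeys the same bound.\<close>
  have h: "norm (h (cis \<phi>)) = \<bar>P (cos \<phi> *\<^sub>R x - sin \<phi> *\<^sub>R u)\<bar>" for \<phi>
    using circ_poly_cis[OF c, of x "-u" \<phi>] by (simp add: h_def norm_mult norm_power)
  have cis: "\<exists>\<phi>. z = cis \<phi>" if "norm z = 1" for z
    using rcis_cmod_Arg[of z] that by (metis cis_rcis_eq)
  have bern: "norm (g (cis 0) - g (cis \<theta>)) \<le> 3 * real (2 * n) * \<bar>P x\<bar> * norm (cis 0 - cis \<theta>)"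
  proof (rule bernstein_reciprocal[of g h])
    show "g z = z ^ (2 * n) * h (1 / z)" if "z \<noteq> 0" for z
      unfolding g_def h_def by (rule circ_poly_reciprocal[OF that])
    show "norm (g z) \<le> \<bar>P x\<bar>" if "norm z = 1" for z
      using cis[OF that] max unit by (auto simp: g)
    show "norm (h z) \<le> \<bar>P x\<bar>" if "norm z = 1" for z
      using cis[OF that] max unit by (auto simp: h)
  qed (use n in \<open>auto simp: g_def h_def holomorphic_circ_poly\<close>)
  have "norm (cis 0 - cis \<theta>) = norm (x - y)"
  proof -
    have "(norm (cis 0 - cis \<theta>))\<^sup>2 = (1 - t)\<^sup>2 + \<sigma>\<^sup>2"
      by (simp add: cmod_power2 th)
    also have "\<dots> = (norm (x - y))\<^sup>2" unfolding nxy \<sigma>(2) by (simp add: power2_eq_square algebra_simps)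
    finally show ?thesis by (simp add: power2_eq_iff_nonneg)
  qed
  then have "norm (cis 0 - cis \<theta>) \<le> 1 / (24 * real n)" using xy by simp
  then have "3 * real (2 * n) * \<bar>P x\<bar> * norm (cis 0 - cis \<theta>) \<le> 3 * real (2 * n) * \<bar>P x\<bar> * (1 / (24 * real n))"
    by (intro mult_left_mono) auto
  also have "\<dots> = \<bar>P x\<bar> / 4" using n by (simp add: field_simps)
  finally have "norm (g (cis 0) - g (cis \<theta>)) \<le> \<bar>P x\<bar> / 4" using bern by linarith
  moreover have "norm (g (cis 0)) \<le> norm (g (cis \<theta>)) + norm (g (cis 0) - g (cis \<theta>))"
    by (metis norm_triangle_sub)
  moreover have "norm (g (cis 0)) = \<bar>P x\<bar>" "norm (g (cis \<theta>)) = \<bar>P y\<bar>"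
    using g[of 0] g[of \<theta>] by (simp_all add: y_eq[symmetric])
  ultimately show ?thesis by linarith
qed auto

text \<open>
  Chordal balls replace the geodesic caps: they are comparable up to a factor \<open>2\<close> in the radius, and the
  triangle inequality comes for free.
\<close>

definition sball :: "real^'n \<Rightarrow> real \<Rightarrow> (real^'n) set" where
  "sball x \<rho> = cball x \<rho> \<inter> sphere 0 1"

lemma mem_sball: "y \<in> sball x \<rho> \<longleftrightarrow> norm (x - y) \<le> \<rho> \<and> norm y = 1"
  by (auto simp: sball_def dist_norm)

lemma sball_subset: "norm (x - y) + \<rho> \<le> \<rho>' \<Longrightarrow> sball x \<rho> \<subseteq> sball y \<rho>'"
proof
  fix z assume "norm (x - y) + \<rho> \<le> \<rho>'" "z \<in> sball x \<rho>"
  then show "z \<in> sball y \<rho>'"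
    using norm_triangle_ineq[of "y - x" "x - z"] by (simp add: mem_sball norm_minus_commute)
qed

lemma sball_2: "x \<in> sphere 0 1 \<Longrightarrow> 2 \<le> \<rho> \<Longrightarrow> sball x \<rho> = sphere 0 1"
proof -
  assume "x \<in> sphere 0 1" "2 \<le> \<rho>"
  then have "norm (x - y) \<le> \<rho>" if "norm y = 1" for y
    using norm_triangle_ineq4[of x y] that by simp
  then show ?thesis by (auto simp: mem_sball)
qed

text \<open>Indicators of balls replace those of annuli, so that doubling can be applied term by
  term. The bound is carried by the least \<open>j\<close> with t <= 2^j; if \<open>j\<close> is
  positive then t > 2^(j-1), and this factor 2 becomes \<open>2 powr \<sigma>\<close>.\<close>

lemma dyadic_decay:
  fixes t \<sigma> :: real
  assumes "0 \<le> t" "0 \<le> \<sigma>" "t \<le> 2 ^ J"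
  shows "(1 + t) powr - \<sigma> \<le> 2 powr \<sigma> * (\<Sum>j\<le>J. 2 powr (- (real j * \<sigma>)) * (if t \<le> 2 ^ j then 1 else 0))"
  using assms(3)
proof (induction J)
  case 0
  have "(1 + t) powr - \<sigma> \<le> 1" using assms powr_mono2'[of "-\<sigma>" 1 "1+t"] by simp
  also have "1 \<le> 2 powr \<sigma>" using assms by (simp add: ge_one_powr_ge_zero)
  finally show ?case using 0 by simp
next
  case (Suc J)
  show ?case
  proof (cases "t \<le> 2 ^ J")
    case True
    then have "(1 + t) powr - \<sigma> \<le> 2 powr \<sigma> * (\<Sum>j\<le>J. 2 powr (- (real j * \<sigma>)) * (if t \<le> 2 ^ j then 1 else 0))"
      by (rule Suc.IH)
    also have "\<dots> \<le> 2 powr \<sigma> * (\<Sum>j\<le>Suc J. 2 powr (- (real j * \<sigma>)) * (if t \<le> 2 ^ j then 1 else 0))"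
      by (intro mult_left_mono) auto
    finally show ?thesis .
  next
    case False
    have "(1 + t) powr - \<sigma> \<le> (2 ^ J) powr - \<sigma>"
      using False assms by (intro powr_mono2') auto
    also have "\<dots> = 2 powr \<sigma> * 2 powr (- (real (Suc J) * \<sigma>))"
      by (simp add: powr_realpow[symmetric] powr_powr powr_add[symmetric] algebra_simps)
    also have "2 powr (- (real (Suc J) * \<sigma>)) \<le> (\<Sum>j\<le>Suc J. 2 powr (- (real j * \<sigma>)) * (if t \<le> 2 ^ j then 1 else 0))"
      using Suc.prems by (simp add: sum_nonneg)
    finally show ?thesis by simp
  qed
qed

subsection \<open>Doubling measures on the sphere\<close>

text \<open>Isolates what the argument needs from the weight. Here \<open>s\<close> is the critical
  index, not the order of the class \<open>Phi_star\<close>.\<close>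

locale doubling_sphere = finite_measure M for M :: "(real^'n) measure" +
  fixes s C0 :: real
  assumes space_M: "space M = sphere 0 1"
    and sets_M: "sets M = sets (restrict_space borel (sphere 0 1))"
    and s_pos: "0 < s" and C0: "1 \<le> C0"
    and doubling: "\<And>x \<rho> m. x \<in> sphere 0 1 \<Longrightarrow> 0 < \<rho> \<Longrightarrow>
       measure M (sball x (2 ^ m * \<rho>)) \<le> C0 * 2 powr (real m * s) * measure M (sball x \<rho>)"
begin

lemma sball_sets [measurable]: "sball x \<rho> \<in> sets M"
  unfolding sets_M sball_def by (auto simp: sets_restrict_space)

lemma borel_measurable_cont: "continuous_on (sphere 0 1) g \<Longrightarrow> g \<in> borel_measurable M"
  for g :: "real^'n \<Rightarrow> real"
  using borel_measurable_continuous_on_restrict[of "sphere 0 1" g] measurable_cong_sets[OF sets_M refl] by blast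

lemma integrable_cont: 
  fixes g :: "real^'n \<Rightarrow> real"
  assumes "continuous_on (sphere 0 1) g" shows "integrable M g"
proof -
  have "compact (g ` sphere 0 1)" using assms by (intro compact_continuous_image) auto
  then obtain B where "\<And>x. x \<in> sphere 0 1 \<Longrightarrow> norm (g x) \<le> B"
    using compact_imp_bounded bounded_iff by (metis imageI)
  then show ?thesis
    by (intro integrable_const_bound[where B = B] borel_measurable_cont assms) (auto simp: space_M)
qed

text \<open>The factor \<open>2 powr s\<close> pays for rounding the dilation up to a power of
  two.\<close>

lemma growth:
  assumes x: "x \<in> sphere 0 1" and \<rho>: "0 < \<rho>" and l: "1 \<le> l"
  shows "measure M (sball x (l * \<rho>)) \<le> C0 * 2 powr s * l powr s * measure M (sball x \<rho>)"
proof -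
  define m where "m = nat \<lceil>log 2 l\<rceil>"
  have l0: "0 \<le> log 2 l" using l by simp
  have m: "log 2 l \<le> real m" "real m \<le> log 2 l + 1" using l0 by (auto simp: m_def)
  have "l = 2 powr log 2 l" using l by simp
  also have "\<dots> \<le> 2 powr real m" using m by (intro powr_mono) auto
  finally have lm: "l \<le> 2 ^ m" by (simp add: powr_realpow)
  have "2 powr (real m * s) \<le> 2 powr ((log 2 l + 1) * s)"
    using m s_pos by (intro powr_mono mult_right_mono) auto
  also have "\<dots> = 2 powr s * l powr s"
    using l by (simp add: distrib_right powr_add powr_powr[symmetric])
  finally have e: "2 powr (real m * s) \<le> 2 powr s * l powr s" .
  have "measure M (sball x (l * \<rho>)) \<le> measure M (sball x (2 ^ m * \<rho>))"
    using lm \<rho> by (intro finite_measure_mono sball_sets sball_subset) (simp add: mult_right_mono)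
  also have "\<dots> \<le> C0 * 2 powr (real m * s) * measure M (sball x \<rho>)" by (rule doubling[OF x \<rho>])
  also have "\<dots> \<le> C0 * (2 powr s * l powr s) * measure M (sball x \<rho>)"
    using C0 by (intro mult_right_mono mult_left_mono e) auto
  finally show ?thesis by (simp add: mult.assoc)
qed

text \<open>Changing the centre costs the power \<open>s\<close> of the distance measured in units
  of the radius; the loss of decay in the kernel estimates comes from here.\<close>

lemma growth_move:
  assumes x: "x \<in> sphere 0 1" "y \<in> sphere 0 1" and \<rho>: "0 < \<rho>" and l: "1 \<le> l"
    and le: "norm (x - y) + \<rho>' \<le> l * \<rho>"
  shows "measure M (sball x \<rho>') \<le> C0 * 2 powr s * l powr s * measure M (sball y \<rho>)"
proof -
  have "measure M (sball x \<rho>') \<le> measure M (sball y (l * \<rho>))"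
    using le by (intro finite_measure_mono sball_sets sball_subset)
  also have "\<dots> \<le> C0 * 2 powr s * l powr s * measure M (sball y \<rho>)" by (rule growth[OF x(2) \<rho> l])
  finally show ?thesis .
qed

text \<open>One order of decay beyond \<open>s\<close> leaves terms proportional to 2^(-j), whose
  sum stays below 2 for every \<open>J\<close>.\<close>

lemma dyadic_sum_measure:
  assumes x: "x \<in> sphere 0 1" and \<rho>: "0 < \<rho>" and \<sigma>: "s + 1 \<le> \<sigma>"
  shows "(\<Sum>j\<le>J. 2 powr (- (real j * \<sigma>)) * measure M (sball x (2 ^ j * \<rho>))) \<le> 2 * C0 * measure M (sball x \<rho>)"
proof -
  have "(\<Sum>j\<le>J. 2 powr (- (real j * \<sigma>)) * measure M (sball x (2 ^ j * \<rho>)))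
     \<le> (\<Sum>j\<le>J. C0 * measure M (sball x \<rho>) * (1/2) ^ j)"
  proof (rule sum_mono)
    fix j
    have "2 powr (- (real j * \<sigma>)) * 2 powr (real j * s) = 2 powr (real j * (s - \<sigma>))"
      by (simp add: powr_add[symmetric] algebra_simps)
    also have "\<dots> \<le> 2 powr (real j * (- 1))" using \<sigma> by (intro powr_mono mult_left_mono) auto
    also have "\<dots> = (1/2) ^ j" by (simp add: powr_minus powr_realpow power_one_over field_simps)
    finally have e: "2 powr (- (real j * \<sigma>)) * 2 powr (real j * s) \<le> (1/2) ^ j" .
    have "2 powr (- (real j * \<sigma>)) * measure M (sball x (2 ^ j * \<rho>))
       \<le> 2 powr (- (real j * \<sigma>)) * (C0 * 2 powr (real j * s) * measure M (sball x \<rho>))"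
      by (intro mult_left_mono doubling x \<rho>) auto
    also have "\<dots> = C0 * measure M (sball x \<rho>) * (2 powr (- (real j * \<sigma>)) * 2 powr (real j * s))"
      by (simp add: mult_ac)
    also have "\<dots> \<le> C0 * measure M (sball x \<rho>) * (1/2) ^ j"
      using C0 by (intro mult_left_mono e) auto
    finally show "2 powr (- (real j * \<sigma>)) * measure M (sball x (2 ^ j * \<rho>)) \<le> C0 * measure M (sball x \<rho>) * (1/2) ^ j" .
  qed
  also have "\<dots> = C0 * measure M (sball x \<rho>) * (\<Sum>j\<le>J. (1/2) ^ j)" by (simp add: sum_distrib_left)
  also have "\<dots> \<le> C0 * measure M (sball x \<rho>) * 2"
    using C0 by (intro mult_left_mono) (auto simp: sum_gp0)
  finally show ?thesis by (simp add: mult_ac)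
qed

lemma exists_dyadic_bound: "\<exists>J. \<forall>x\<in>sphere 0 1. \<forall>y\<in>sphere 0 1. a * norm (x - y :: real^'n) \<le> 2 ^ J"
  if "0 < a" for a :: real
proof -
  obtain J where J: "2 * a < 2 ^ J" using real_arch_pow[of 2 "2 * a"] by auto
  have "a * norm (x - y) \<le> 2 ^ J" if "norm x = 1" "norm y = 1" for x y :: "real^'n"
  proof -
    have "norm (x - y) \<le> 2" using norm_triangle_ineq4[of x y] that by simp
    then have "a * norm (x - y) \<le> a * 2" using \<open>0 < a\<close> by (intro mult_left_mono) auto
    then show ?thesis using J by simp
  qed
  then show ?thesis by (intro exI[of _ J]) auto
qed

lemma continuous_on_decay:
  assumes "0 < a" shows "continuous_on S (\<lambda>y. (1 + a * norm (x - y)) powr b)"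
proof -
  have "1 + a * norm (x - y) \<noteq> 0" for y using assms by (smt (verit) mult_nonneg_nonneg norm_ge_zero)
  then show ?thesis by (intro continuous_intros) auto
qed

lemma integral_decay:
  assumes x: "x \<in> sphere 0 1" and a: "0 < a" and \<sigma>: "s + 1 \<le> \<sigma>"
  shows "(\<integral>y. (1 + a * norm (x - y)) powr - \<sigma> \<partial>M) \<le> 2 powr \<sigma> * (2 * C0) * measure M (sball x (1 / a))"
proof -
  obtain J where J: "\<forall>x\<in>sphere 0 1. \<forall>y\<in>sphere 0 1. a * norm (x - y :: real^'n) \<le> 2 ^ J"
    using exists_dyadic_bound[OF a] by blast
  have "(\<integral>y. (1 + a * norm (x - y)) powr - \<sigma> \<partial>M)
     \<le> (\<integral>y. 2 powr \<sigma> * (\<Sum>j\<le>J. 2 powr (- (real j * \<sigma>)) * indicator (sball x (2 ^ j * (1 / a))) y) \<partial>M)"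
  proof (rule integral_mono)
    show "integrable M (\<lambda>y. (1 + a * norm (x - y)) powr - \<sigma>)"
      by (intro integrable_cont continuous_on_decay a)
    fix y assume "y \<in> space M"
    then have y: "y \<in> sphere 0 1" by (simp add: space_M)
    have "(1 + a * norm (x - y)) powr - \<sigma>
      \<le> 2 powr \<sigma> * (\<Sum>j\<le>J. 2 powr (- (real j * \<sigma>)) * (if a * norm (x - y) \<le> 2 ^ j then 1 else 0))"
      using a s_pos \<sigma> J x y by (intro dyadic_decay) auto
    also have "(\<lambda>j::nat. if a * norm (x - y) \<le> 2 ^ j then 1 else 0::real)
       = (\<lambda>j. indicator (sball x (2 ^ j * (1 / a))) y)"
      using a y by (auto simp: fun_eq_iff indicator_def mem_sball field_simps)
    finally show "(1 + a * norm (x - y)) powr - \<sigma>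
      \<le> 2 powr \<sigma> * (\<Sum>j\<le>J. 2 powr (- (real j * \<sigma>)) * indicator (sball x (2 ^ j * (1 / a))) y)" by meson
  qed (intro integrable_mult_right Bochner_Integration.integrable_sum integrable_real_indicator; auto simp: less_top[symmetric])
  also have "\<dots> = 2 powr \<sigma> * (\<Sum>j\<le>J. 2 powr (- (real j * \<sigma>)) * measure M (sball x (2 ^ j * (1 / a))))"
    by (subst integral_mult_right_zero, subst Bochner_Integration.integral_sum)
       (simp_all add: less_top[symmetric])
  also have "\<dots> \<le> 2 powr \<sigma> * (2 * C0 * measure M (sball x (1 / a)))"
    using a by (intro mult_left_mono dyadic_sum_measure x \<sigma>) auto
  finally show ?thesis by (simp add: mult_ac)
qed

text \<open>Discrete counterpart of \<open>integral_decay\<close>. The mass bound is required for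
  radii from \<open>1 / a\<close> on, where the dyadic balls start; this matches what an upper
  Marcinkiewicz-Zygmund bound can supply.\<close>

lemma sum_decay:
  fixes X :: "nat \<Rightarrow> real^'n"
  assumes y: "y \<in> sphere 0 1" and a: "0 < a" and \<sigma>: "s + 1 \<le> \<sigma>"
    and X: "\<And>k. k < N \<Longrightarrow> X k \<in> sphere 0 1" and \<tau>: "\<And>k. k < N \<Longrightarrow> 0 \<le> \<tau> k"
    and A: "0 \<le> A" "\<And>\<rho>. 1 / a \<le> \<rho> \<Longrightarrow> (\<Sum>k<N. \<tau> k * indicator (sball y \<rho>) (X k)) \<le> A * measure M (sball y \<rho>)"
  shows "(\<Sum>k<N. \<tau> k * (1 + a * norm (y - X k)) powr - \<sigma>) \<le> A * (2 powr \<sigma> * (2 * C0)) * measure M (sball y (1 / a))"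
proof -
  obtain J where J: "\<forall>x\<in>sphere 0 1. \<forall>y\<in>sphere 0 1. a * norm (x - y :: real^'n) \<le> 2 ^ J"
    using exists_dyadic_bound[OF a] by blast
  let ?c = "\<lambda>j. 2 powr (- (real j * \<sigma>))"
  have "(\<Sum>k<N. \<tau> k * (1 + a * norm (y - X k)) powr - \<sigma>)
     \<le> (\<Sum>k<N. \<tau> k * (2 powr \<sigma> * (\<Sum>j\<le>J. ?c j * indicator (sball y (2 ^ j * (1 / a))) (X k))))"
  proof (intro sum_mono mult_left_mono)
    fix k assume k: "k \<in> {..<N}"
    then have Xk: "X k \<in> sphere 0 1" using X by auto
    have "(1 + a * norm (y - X k)) powr - \<sigma>
      \<le> 2 powr \<sigma> * (\<Sum>j\<le>J. ?c j * (if a * norm (y - X k) \<le> 2 ^ j then 1 else 0))"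
      using a s_pos \<sigma> J y Xk by (intro dyadic_decay) auto
    also have "(\<lambda>j::nat. if a * norm (y - X k) \<le> 2 ^ j then 1 else 0::real)
       = (\<lambda>j. indicator (sball y (2 ^ j * (1 / a))) (X k))"
      using a Xk by (auto simp: fun_eq_iff indicator_def mem_sball field_simps)
    finally show "(1 + a * norm (y - X k)) powr - \<sigma>
      \<le> 2 powr \<sigma> * (\<Sum>j\<le>J. ?c j * indicator (sball y (2 ^ j * (1 / a))) (X k))" by meson
    show "0 \<le> \<tau> k" using k \<tau> by auto
  qed
  also have "\<dots> = 2 powr \<sigma> * (\<Sum>j\<le>J. ?c j * (\<Sum>k<N. \<tau> k * indicator (sball y (2 ^ j * (1 / a))) (X k)))"
    unfolding sum_distrib_left by (subst sum.swap) (simp add: mult_ac)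
  also have "\<dots> \<le> 2 powr \<sigma> * (\<Sum>j\<le>J. ?c j * (A * measure M (sball y (2 ^ j * (1 / a)))))"
    using a by (intro mult_left_mono sum_mono A) (auto simp: divide_simps)
  also have "\<dots> = 2 powr \<sigma> * A * (\<Sum>j\<le>J. ?c j * measure M (sball y (2 ^ j * (1 / a))))"
    by (simp add: sum_distrib_left mult_ac)
  also have "\<dots> \<le> 2 powr \<sigma> * A * (2 * C0 * measure M (sball y (1 / a)))"
    using a A(1) by (intro mult_left_mono dyadic_sum_measure y \<sigma>) auto
  finally show ?thesis by (simp add: mult_ac)
qed

lemma continuous_on_powr_sph_poly:
  "P \<in> sph_poly n \<Longrightarrow> 0 < p \<Longrightarrow> continuous_on S (\<lambda>y. \<bar>P y\<bar> powr p)"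
  by (intro continuous_on_powr' continuous_on_sph_poly continuous_intros) auto

lemma pointwise_bound:
  assumes p: "1 \<le> p"
  shows "\<exists>C>0. \<forall>n\<ge>1. \<forall>P\<in>sph_poly n. \<forall>x\<in>sphere 0 1.
     \<bar>P x\<bar> powr p * measure M (sball x (1 / real n))
       \<le> C * (\<integral>y. \<bar>P y\<bar> powr p * (1 + real n * norm (x - y)) powr - (2 * s + 1) \<partial>M)"
proof -
  \<comment> \<open>Order 3s + 1: s for the change of centre, 2s + 1 for the decay that is
    claimed.\<close>
  define b where "b = nat \<lceil>3 * s + 1\<rceil>"
  have b: "3 * s + 1 \<le> real b" unfolding b_def by (rule real_nat_ceiling_ge)
  then have "1 < real b" using s_pos by linarith
  then have b1: "1 \<le> b" by simp
  define B where "B = (1 + 2 * real b) ^ b"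
  have B: "0 < B" by (simp add: B_def)
  define C where "C = C0 * 2 powr s * 48 powr s * (2 powr p * B * 2 powr s)"
  have "C > 0" using C0 B by (simp add: C_def)
  moreover have "\<bar>P x\<bar> powr p * measure M (sball x (1 / real n))
       \<le> C * (\<integral>y. \<bar>P y\<bar> powr p * (1 + real n * norm (x - y)) powr - (2 * s + 1) \<partial>M)"
    if n: "n \<ge> 1" and P: "P \<in> sph_poly n" and x: "x \<in> sphere 0 1" for n P x
  proof -
    let ?r = "\<lambda>z. 1 + real n * norm (x - z)"
    have r1: "1 \<le> ?r z" for z by simp
    obtain K where K: "K \<in> sph_poly n" "K x = 1" and
      Kle: "\<And>y. y \<in> sphere 0 1 \<Longrightarrow> \<bar>K y\<bar> \<le> 1 \<and> \<bar>K y\<bar> \<le> ((1 + 2 * real b) / ?r y) ^ b"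
      using exists_localised_poly[of x b n] x b1 by auto
    let ?G = "\<lambda>y. P y * K y"
    have G: "?G \<in> sph_poly (n + n)" by (rule sph_poly_mult[OF P K(1)])
    have "continuous_on (sphere 0 1) (\<lambda>y. \<bar>?G y\<bar>)"
      by (intro continuous_intros continuous_on_sph_poly[OF P] continuous_on_sph_poly[OF K(1)])
    then have "\<exists>y0\<in>sphere 0 1. \<forall>z\<in>sphere 0 1. \<bar>?G z\<bar> \<le> \<bar>?G y0\<bar>"
      using x by (intro continuous_attains_sup) auto
    then obtain y0 where y0: "y0 \<in> sphere 0 1" "\<And>z. z \<in> sphere 0 1 \<Longrightarrow> \<bar>?G z\<bar> \<le> \<bar>?G y0\<bar>"
      by blast
    \<comment> \<open>The product has degree \<open>n + n\<close>, and 1/(24 * 2n) is the radius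
      allowed by \<open>sph_poly_near_max\<close>.\<close>
    define \<rho> where "\<rho> = 1 / (48 * real n)"
    have \<rho>: "0 < \<rho>" using n by (simp add: \<rho>_def)
    have pt: "\<bar>P x\<bar> powr p * ?r y0 powr s \<le> 2 powr p * B * 2 powr s * (\<bar>P z\<bar> powr p * ?r z powr - (2 * s + 1))"
      if z: "z \<in> sball y0 \<rho>" for z
    proof -
      have zS: "z \<in> sphere 0 1" using z by (simp add: mem_sball)
      have "\<bar>?G y0\<bar> \<le> 2 * \<bar>?G z\<bar>"
        by (rule sph_poly_near_max[OF G]) (use n y0 z in \<open>auto simp: mem_sball \<rho>_def\<close>)
      then have "\<bar>P x\<bar> \<le> 2 * \<bar>?G z\<bar>" using y0(2)[OF x] K(2) by simp
      then have "\<bar>P x\<bar> powr p \<le> (2 * \<bar>?G z\<bar>) powr p" using p by (intro powr_mono2) auto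
      also have "\<dots> = 2 powr p * (\<bar>P z\<bar> powr p * \<bar>K z\<bar> powr p)"
        by (simp add: powr_mult abs_mult)
      also have "\<bar>K z\<bar> powr p \<le> \<bar>K z\<bar> powr 1"
        using Kle[OF zS] p by (intro powr_mono') auto
      also have "\<bar>K z\<bar> powr 1 \<le> B * ?r z powr - real b"
      proof -
        have "?r z powr real b = ?r z ^ b" using r1[of z] by (intro powr_realpow) linarith
        then show ?thesis using Kle[OF zS] by (simp add: B_def power_divide powr_minus divide_inverse power_mult_distrib power_inverse)
      qed
      also have "?r z powr - real b \<le> ?r z powr - (3 * s + 1)"
        using b r1 by (intro powr_mono) auto
      finally have 1: "\<bar>P x\<bar> powr p \<le> 2 powr p * (\<bar>P z\<bar> powr p * (B * ?r z powr - (3 * s + 1)))"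
        using B by (simp add: mult_left_mono)
      \<comment> \<open>As \<open>z\<close> is within \<open>1 / n\<close> of \<open>y0\<close>, the
        factor at the unknown \<open>y0\<close> is at most twice the one at \<open>z\<close> and can
        be traded for decay at \<open>z\<close>.\<close>
      have "norm (x - y0) \<le> norm (x - z) + norm (z - y0)" using norm_triangle_ineq[of "x - z" "z - y0"] by simp
      also have "norm (z - y0) \<le> \<rho>" using z by (simp add: mem_sball norm_minus_commute)
      also have "\<rho> \<le> 1 / real n" using n by (simp add: \<rho>_def field_simps)
      finally have "real n * norm (x - y0) \<le> real n * (norm (x - z) + 1 / real n)"
        by (intro mult_left_mono) auto
      then have "real n * norm (x - y0) \<le> real n * norm (x - z) + 1" using n by (simp add: distrib_left)
      moreover have "0 \<le> real n * norm (x - z)" by simp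
      ultimately have "1 + real n * norm (x - y0) \<le> 2 + 2 * (real n * norm (x - z))" by linarith
      then have "?r y0 \<le> 2 * ?r z" by (simp add: distrib_left)
      then have "?r y0 powr s \<le> (2 * ?r z) powr s" using s_pos by (intro powr_mono2) auto
      then have 2: "?r y0 powr s \<le> 2 powr s * ?r z powr s" unfolding powr_mult .
      have "\<bar>P x\<bar> powr p * ?r y0 powr s \<le> (2 powr p * (\<bar>P z\<bar> powr p * (B * ?r z powr - (3 * s + 1)))) * (2 powr s * ?r z powr s)"
        using B by (intro mult_mono 1 2) auto
      also have "\<dots> = 2 powr p * B * 2 powr s * (\<bar>P z\<bar> powr p * (?r z powr - (3 * s + 1) * ?r z powr s))"
        by (simp add: mult_ac)
      also have "?r z powr - (3 * s + 1) * ?r z powr s = ?r z powr - (2 * s + 1)"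
        by (simp add: powr_add[symmetric])
      finally show ?thesis .
    qed
    have ci: "integrable M (\<lambda>z. \<bar>P z\<bar> powr p * ?r z powr - (2 * s + 1))"
      using n p by (intro integrable_cont continuous_intros continuous_on_decay continuous_on_powr_sph_poly[OF P]) auto
    have "\<bar>P x\<bar> powr p * ?r y0 powr s * measure M (sball y0 \<rho>)
      = (\<integral>z. \<bar>P x\<bar> powr p * ?r y0 powr s * indicator (sball y0 \<rho>) z \<partial>M)"
      by (subst integral_mult_right_zero) simp
    also have "\<dots> \<le> (\<integral>z. 2 powr p * B * 2 powr s * (\<bar>P z\<bar> powr p * ?r z powr - (2 * s + 1)) \<partial>M)"
    proof (rule integral_mono)
      show "integrable M (\<lambda>z. \<bar>P x\<bar> powr p * ?r y0 powr s * indicator (sball y0 \<rho>) z)"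
        by (intro integrable_mult_right integrable_real_indicator) (auto simp: less_top[symmetric])
      show "integrable M (\<lambda>z. 2 powr p * B * 2 powr s * (\<bar>P z\<bar> powr p * ?r z powr - (2 * s + 1)))"
        by (intro integrable_mult_right ci)
      show "\<bar>P x\<bar> powr p * ?r y0 powr s * indicator (sball y0 \<rho>) z
        \<le> 2 powr p * B * 2 powr s * (\<bar>P z\<bar> powr p * ?r z powr - (2 * s + 1))" for z
        using pt[of z] B by (auto simp: indicator_def)
    qed
    also have "\<dots> = 2 powr p * B * 2 powr s * (\<integral>z. \<bar>P z\<bar> powr p * ?r z powr - (2 * s + 1) \<partial>M)"
      by (rule integral_mult_right_zero)
    finally have I: "\<bar>P x\<bar> powr p * ?r y0 powr s * measure M (sball y0 \<rho>)
       \<le> 2 powr p * B * 2 powr s * (\<integral>z. \<bar>P z\<bar> powr p * ?r z powr - (2 * s + 1) \<partial>M)" .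
    \<comment> \<open>The dilation is chosen so that 48 (1 + n |x - y0|) \<rho> equals |x - y0| +
      1/n.\<close>
    have "measure M (sball x (1 / real n)) \<le> C0 * 2 powr s * (48 * ?r y0) powr s * measure M (sball y0 \<rho>)"
    proof (rule growth_move[OF x y0(1) \<rho>])
      show "1 \<le> 48 * ?r y0" using r1[of y0] by simp
      show "norm (x - y0) + 1 / real n \<le> 48 * ?r y0 * \<rho>" using n by (simp add: \<rho>_def field_simps)
    qed
    then have "\<bar>P x\<bar> powr p * measure M (sball x (1 / real n))
       \<le> \<bar>P x\<bar> powr p * (C0 * 2 powr s * (48 * ?r y0) powr s * measure M (sball y0 \<rho>))"
      by (intro mult_left_mono) auto
    also have "\<dots> = C0 * 2 powr s * 48 powr s * (\<bar>P x\<bar> powr p * ?r y0 powr s * measure M (sball y0 \<rho>))"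
      unfolding powr_mult by (simp only: mult_ac)
    also have "\<dots> \<le> C0 * 2 powr s * 48 powr s * (2 powr p * B * 2 powr s * (\<integral>z. \<bar>P z\<bar> powr p * ?r z powr - (2 * s + 1) \<partial>M))"
      using C0 by (intro mult_left_mono I) auto
    finally show ?thesis by (simp add: C_def mult_ac)
  qed
  ultimately show ?thesis by blast
qed

end

subsection \<open>Consequences of the upper Marcinkiewicz--Zygmund bound\<close>

text \<open>Stated for one degree and one set of nodes with explicit \<open>p\<close>,
  \<open>B\<close> and \<open>M\<close>, so that later constants can be chosen before the
  nodes.\<close>

definition MZ_upper :: "real \<Rightarrow> real \<Rightarrow> (real^'n) measure \<Rightarrow> nat \<Rightarrow> nat \<Rightarrow> (nat \<Rightarrow> real^'n) \<Rightarrow> (nat \<Rightarrow> real) \<Rightarrow> bool" where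
  "MZ_upper p B M n N X \<tau> \<longleftrightarrow> (\<forall>k<N. X k \<in> sphere 0 1 \<and> 0 \<le> \<tau> k) \<and>
     (\<forall>P\<in>sph_poly n. (\<Sum>k<N. \<tau> k * \<bar>P (X k)\<bar> powr p) \<le> B * (\<integral>y. \<bar>P y\<bar> powr p \<partial>M))"

context doubling_sphere begin

text \<open>Testing the mass of a ball takes a polynomial that is at least 1/2 on the whole ball and
  decays at the scale of its radius. The peak of full degree \<open>n\<close> would be too narrow
  for \<open>\<rho>\<close> much larger than \<open>1 / n\<close>, so the degree is lowered to
  fit.\<close>

lemma exists_localised_poly_at_scale:
  assumes b: "1 \<le> b"
  shows "\<exists>C>0. \<forall>n x \<rho>. 1 \<le> n \<longrightarrow> x \<in> sphere 0 1 \<longrightarrow> 1 / real n \<le> \<rho> \<longrightarrow>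
    (\<exists>K\<in>sph_poly n. (\<forall>y\<in>sball x \<rho>. 1 \<le> 2 * \<bar>K y\<bar>) \<and>
      (\<forall>y\<in>sphere 0 1. \<bar>K y\<bar> \<le> 1 \<and> \<bar>K y\<bar> \<le> C * (1 + 1 / \<rho> * norm (x - y :: real^'n)) powr - real b))"
proof -
  define B where "B = 1 + 2 * real b"
  have B1: "1 \<le> B" by (simp add: B_def)
  define C where "C = (49 * B) ^ b"
  have C: "0 < C" using B1 by (simp add: C_def)
  have "\<exists>K\<in>sph_poly n. (\<forall>y\<in>sball x \<rho>. 1 \<le> 2 * \<bar>K y\<bar>) \<and>
      (\<forall>y\<in>sphere 0 1. \<bar>K y\<bar> \<le> 1 \<and> \<bar>K y\<bar> \<le> C * (1 + 1 / \<rho> * norm (x - y)) powr - real b)"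
    if n: "1 \<le> n" and x: "x \<in> sphere 0 1" and \<rho>: "1 / real n \<le> \<rho>" for n \<rho> and x :: "real^'n"
  proof -
    have \<rho>0: "0 < \<rho>" using \<rho> n by (smt (verit) divide_pos_pos of_nat_0_less_iff less_le_trans zero_less_one)
    \<comment> \<open>the degree \<open>m\<close> for which \<open>1 / (24 m)\<close>, the radius in the near-maximum lemma, is about \<open>\<rho>\<close>; it may be \<open>0\<close>\<close>
    define m where "m = nat \<lfloor>1 / (24 * \<rho>)\<rfloor>"
    have q0: "0 \<le> 1 / (24 * \<rho>)" using \<rho>0 by simp
    have m: "real m \<le> 1 / (24 * \<rho>)" "1 / (24 * \<rho>) \<le> real m + 1"
      unfolding m_def using q0 by linarith+
    have "1 / (24 * \<rho>) \<le> 1 / \<rho>" using \<rho>0 by (simp add: field_simps)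
    also have "\<dots> \<le> real n" using \<rho> \<rho>0 n by (simp add: field_simps)
    finally have mn: "m \<le> n" using m(1) by linarith
    \<comment> \<open>From 1/\<rho> <= 24 (m + 1) and |x - y| <= 2 comes 1 + 24 * 2 = 49: the
      diameter absorbs the rounding of \<open>m\<close>.\<close>
    have scale: "1 + 1 / \<rho> * norm (x - y) \<le> 49 * (1 + real m * norm (x - y))" if "y \<in> sphere 0 1" for y
    proof -
      have n2: "norm (x - y) \<le> 2" using x that norm_triangle_ineq4[of x y] by simp
      have "1 / \<rho> \<le> 24 * (real m + 1)" using m(2) by (simp add: field_simps)
      then have "1 / \<rho> * norm (x - y) \<le> 24 * (real m + 1) * norm (x - y)"
        by (intro mult_right_mono) auto
      also have "\<dots> = 24 * (real m * norm (x - y)) + 24 * norm (x - y)" by (simp add: algebra_simps)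
      also have "\<dots> \<le> 49 * (real m * norm (x - y)) + 48"
        using n2 mult_nonneg_nonneg[of "real m" "norm (x - y)"] by (simp del: mult_nonneg_nonneg zero_le_mult_iff)
      finally show ?thesis by (simp add: distrib_left)
    qed
    have pos: "1 \<le> 1 + 1 / \<rho> * norm (x - y)" for y using \<rho>0 by simp
    have conv: "(B / (1 + real m * norm (x - y))) ^ b \<le> C * (1 + 1 / \<rho> * norm (x - y)) powr - real b"
      if y: "y \<in> sphere 0 1" for y
    proof -
      have rp: "(1 + 1 / \<rho> * norm (x - y)) powr real b = (1 + 1 / \<rho> * norm (x - y)) ^ b"
        using pos[of y] by (intro powr_realpow) linarith
      have m0: "0 < 1 + real m * norm (x - y)" by (simp add: add_pos_nonneg)
      have "B / (1 + real m * norm (x - y)) \<le> 49 * B / (1 + 1 / \<rho> * norm (x - y))"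
      proof -
        have "B * (1 + 1 / \<rho> * norm (x - y)) \<le> B * (49 * (1 + real m * norm (x - y)))"
          using B1 by (intro mult_left_mono scale y) auto
        moreover have "0 < 1 + 1 / \<rho> * norm (x - y)" using pos[of y] by linarith
        ultimately show ?thesis using m0
          by (subst frac_le_eq) (simp_all add: divide_le_0_iff mult_ac)
      qed
      then have "(B / (1 + real m * norm (x - y))) ^ b \<le> (49 * B / (1 + 1 / \<rho> * norm (x - y))) ^ b"
        using B1 m0 by (intro power_mono) auto
      then show ?thesis unfolding powr_minus rp
        by (simp add: C_def power_divide divide_inverse power_inverse power_mult_distrib)
    qed
    show ?thesis
    proof (cases "m = 0")
      \<comment> \<open>Here \<open>\<rho>\<close> exceeds 1/24, which is comparable to the
        diameter, and the constant 1 is peaked enough.\<close>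
      case True
      have "1 \<le> C * (1 + 1 / \<rho> * norm (x - y)) powr - real b" if "y \<in> sphere 0 1" for y
        using conv[OF that] True one_le_power[OF B1, of b] by simp
      then show ?thesis by (intro bexI[of _ "\<lambda>_. 1"] sph_poly_const) auto
    next
      case False
      obtain K where K: "K \<in> sph_poly m" "K x = 1" and
        Kle: "\<And>y. y \<in> sphere 0 1 \<Longrightarrow> \<bar>K y\<bar> \<le> 1 \<and> \<bar>K y\<bar> \<le> (B / (1 + real m * norm (x - y))) ^ b"
        using exists_localised_poly[of x b m] x b by (auto simp: B_def)
      have "1 \<le> 2 * \<bar>K y\<bar>" if y: "y \<in> sball x \<rho>" for y
      proof -
        have "\<rho> \<le> 1 / (24 * real m)" using m(1) False \<rho>0 by (simp add: field_simps)
        then have "\<bar>K x\<bar> \<le> 2 * \<bar>K y\<bar>"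
          using K(1) False x y Kle K(2) by (intro sph_poly_near_max[of K m x y]) (auto simp: mem_sball)
        then show ?thesis using K by simp
      qed
      moreover have "\<bar>K y\<bar> \<le> C * (1 + 1 / \<rho> * norm (x - y)) powr - real b" if "y \<in> sphere 0 1" for y
        using Kle[OF that] conv[OF that] by linarith
      ultimately show ?thesis using sph_poly_mono[OF K(1) mn] Kle by (intro bexI[of _ K]) auto
    qed
  qed
  then show ?thesis using C by blast
qed

lemma MZ_upper_sball:
  assumes p: "1 \<le> p" and B: "0 < B"
  shows "\<exists>A>0. \<forall>n N X \<tau> x \<rho>. 1 \<le> n \<longrightarrow> MZ_upper p B M n N X \<tau> \<longrightarrow> x \<in> sphere 0 1 \<longrightarrow> 1 / real n \<le> \<rho> \<longrightarrow>
     (\<Sum>k<N. \<tau> k * indicator (sball x \<rho>) (X k)) \<le> A * measure M (sball x \<rho>)"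
proof -
  define b where "b = nat \<lceil>s + 1\<rceil>"
  have b: "s + 1 \<le> real b" unfolding b_def by (rule real_nat_ceiling_ge)
  then have "1 < real b" using s_pos by linarith
  then have b1: "1 \<le> b" by simp
  obtain C where C: "0 < C" and loc: "\<And>n x \<rho>. 1 \<le> n \<Longrightarrow> x \<in> sphere 0 1 \<Longrightarrow> 1 / real n \<le> \<rho> \<Longrightarrow>
    (\<exists>K\<in>sph_poly n. (\<forall>y\<in>sball x \<rho>. 1 \<le> 2 * \<bar>K y\<bar>) \<and>
      (\<forall>y\<in>sphere 0 1. \<bar>K y\<bar> \<le> 1 \<and> \<bar>K y\<bar> \<le> C * (1 + 1 / \<rho> * norm (x - y :: real^'n)) powr - real b))"
    using exists_localised_poly_at_scale[OF b1] by metis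
  define A where "A = 2 powr p * B * C * (2 powr real b * (2 * C0))"
  have "0 < A" using B C C0 by (simp add: A_def)
  moreover have "(\<Sum>k<N. \<tau> k * indicator (sball x \<rho>) (X k)) \<le> A * measure M (sball x \<rho>)"
    if n: "1 \<le> n" and mz: "MZ_upper p B M n N X \<tau>" and x: "x \<in> sphere 0 1" and \<rho>: "1 / real n \<le> \<rho>"
    for n N X \<tau> x \<rho>
  proof -
    have \<rho>0: "0 < \<rho>" using \<rho> n by (smt (verit) divide_pos_pos of_nat_0_less_iff less_le_trans zero_less_one)
    obtain K where K: "K \<in> sph_poly n" and K1: "\<And>y. y \<in> sball x \<rho> \<Longrightarrow> 1 \<le> 2 * \<bar>K y\<bar>"
      and K2: "\<And>y. y \<in> sphere 0 1 \<Longrightarrow> \<bar>K y\<bar> \<le> 1 \<and> \<bar>K y\<bar> \<le> C * (1 + 1 / \<rho> * norm (x - y)) powr - real b"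
      using loc[OF n x \<rho>] by blast
    have "(\<Sum>k<N. \<tau> k * indicator (sball x \<rho>) (X k)) \<le> (\<Sum>k<N. \<tau> k * (2 powr p * \<bar>K (X k)\<bar> powr p))"
    proof (intro sum_mono mult_left_mono)
      fix k assume k: "k \<in> {..<N}"
      show "0 \<le> \<tau> k" using k mz by (auto simp: MZ_upper_def)
      show "indicator (sball x \<rho>) (X k) \<le> 2 powr p * \<bar>K (X k)\<bar> powr p"
      proof (cases "X k \<in> sball x \<rho>")
        case True
        then have "1 \<le> (2 * \<bar>K (X k)\<bar>) powr p" using K1 p by (intro ge_one_powr_ge_zero) auto
        then show ?thesis using True by (simp add: powr_mult)
      qed simp
    qed
    also have "\<dots> = 2 powr p * (\<Sum>k<N. \<tau> k * \<bar>K (X k)\<bar> powr p)" by (simp add: sum_distrib_left mult_ac)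
    also have "\<dots> \<le> 2 powr p * (B * (\<integral>y. \<bar>K y\<bar> powr p \<partial>M))"
      using mz K by (intro mult_left_mono) (auto simp: MZ_upper_def)
    also have "(\<integral>y. \<bar>K y\<bar> powr p \<partial>M) \<le> (\<integral>y. C * (1 + 1 / \<rho> * norm (x - y)) powr - real b \<partial>M)"
    proof (rule integral_mono)
      show "integrable M (\<lambda>y. \<bar>K y\<bar> powr p)"
        using p by (intro integrable_cont continuous_on_powr_sph_poly[OF K]) auto
      show "integrable M (\<lambda>y. C * (1 + 1 / \<rho> * norm (x - y)) powr - real b)"
        using \<rho>0 by (intro integrable_mult_right integrable_cont continuous_on_decay) auto
      fix y assume "y \<in> space M"
      then have y: "y \<in> sphere 0 1" by (simp add: space_M)
      have "\<bar>K y\<bar> powr p \<le> \<bar>K y\<bar> powr 1" using K2[OF y] p by (intro powr_mono') auto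
      then show "\<bar>K y\<bar> powr p \<le> C * (1 + 1 / \<rho> * norm (x - y)) powr - real b" using K2[OF y] by auto
    qed
    also have "\<dots> = C * (\<integral>y. (1 + 1 / \<rho> * norm (x - y)) powr - real b \<partial>M)" by (rule integral_mult_right_zero)
    also have "\<dots> \<le> C * (2 powr real b * (2 * C0) * measure M (sball x (1 / (1 / \<rho>))))"
      using C \<rho>0 by (intro mult_left_mono integral_decay x b) auto
    finally show ?thesis using B by (simp add: A_def mult_ac)
  qed
  ultimately show ?thesis by blast
qed

text \<open>Some dilate of every ball is the whole sphere, so doubling would spread measure zero to
  all of it.\<close>

lemma measure_sball_pos:
  assumes "0 < measure M (sphere 0 1)" "x \<in> sphere 0 1" "0 < \<rho>"
  shows "0 < measure M (sball x \<rho>)"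
proof -
  define l where "l = max 1 (2 / \<rho>)"
  have "2 \<le> l * \<rho>" using assms(3) by (auto simp: l_def max_def field_simps)
  then have "measure M (sphere 0 1) \<le> C0 * 2 powr s * l powr s * measure M (sball x \<rho>)"
    using growth[OF assms(2,3), of l] sball_2[OF assms(2)] by (simp add: l_def)
  with assms(1) have "0 < C0 * 2 powr s * l powr s * measure M (sball x \<rho>)" by linarith
  then show ?thesis by (auto simp: zero_less_mult_iff less_le)
qed

text \<open>Inserting the mean value inequality of degree \<open>m\<close> at the nodes reduces the
  claim to a bound, uniform in \<open>y\<close>, for a weighted sum over the nodes. The kernel lives
  at scale \<open>1 / m\<close>, but node masses are controlled from radius \<open>1 / n\<close> on;
  passing between the scales costs (m/n)^s.\<close>

lemma MZ_upper_higher_degree: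
  assumes p: "1 \<le> p" and B: "0 < B" and pos: "0 < measure M (sphere 0 1)"
  shows "\<exists>C>0. \<forall>n m N X \<tau> P. 1 \<le> n \<longrightarrow> n \<le> m \<longrightarrow> MZ_upper p B M n N X \<tau> \<longrightarrow> P \<in> sph_poly m \<longrightarrow>
     (\<Sum>k<N. \<tau> k * \<bar>P (X k)\<bar> powr p) \<le> C * (real m / real n) powr s * (\<integral>y. \<bar>P y\<bar> powr p \<partial>M)"
proof -
  obtain A where A: "0 < A" and tau: "\<And>n N X \<tau> x \<rho>. 1 \<le> n \<Longrightarrow> MZ_upper p B M n N X \<tau> \<Longrightarrow> x \<in> sphere 0 1 \<Longrightarrow> 1 / real n \<le> \<rho> \<Longrightarrow>
     (\<Sum>k<N. \<tau> k * indicator (sball x \<rho>) (X k)) \<le> A * measure M (sball x \<rho>)"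
    using MZ_upper_sball[OF p B] by blast
  obtain D where D: "0 < D" and pw: "\<And>n P x. n \<ge> 1 \<Longrightarrow> P \<in> sph_poly n \<Longrightarrow> x \<in> sphere 0 1 \<Longrightarrow>
     \<bar>P x\<bar> powr p * measure M (sball x (1 / real n))
       \<le> D * (\<integral>y. \<bar>P y\<bar> powr p * (1 + real n * norm (x - y)) powr - (2 * s + 1) \<partial>M)"
    using pointwise_bound[OF p] by blast
  define C1 where "C1 = C0 * 2 powr s"
  have C1: "0 < C1" using C0 by (simp add: C1_def)
  define E where "E = C1 * C1 * (A * (2 powr (s + 1) * (2 * C0)))"
  have E: "0 < E" using C1 A C0 by (simp add: E_def)
  have "(\<Sum>k<N. \<tau> k * \<bar>P (X k)\<bar> powr p) \<le> D * E * (real m / real n) powr s * (\<integral>y. \<bar>P y\<bar> powr p \<partial>M)"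
    if n: "1 \<le> n" and nm: "n \<le> m" and mz: "MZ_upper p B M n N X \<tau>" and P: "P \<in> sph_poly m" for n m N X \<tau> P
  proof -
    have m: "1 \<le> m" using n nm by simp
    have X: "X k \<in> sphere 0 1" "0 \<le> \<tau> k" if "k < N" for k using mz that by (auto simp: MZ_upper_def)
    let ?\<mu> = "\<lambda>x. measure M (sball x (1 / real m))"
    have \<mu>: "0 < ?\<mu> x" if "x \<in> sphere 0 1" for x
      using m by (intro measure_sball_pos pos that) auto
    let ?f = "\<lambda>k y. \<tau> k * (D / ?\<mu> (X k)) * (\<bar>P y\<bar> powr p * (1 + real m * norm (X k - y)) powr - (2 * s + 1))"
    have int: "integrable M (\<lambda>y. \<bar>P y\<bar> powr p * (1 + real m * norm (x - y)) powr - (2 * s + 1))" for x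
      using m p by (intro integrable_cont continuous_intros continuous_on_decay continuous_on_powr_sph_poly[OF P]) auto
    have "(\<Sum>k<N. \<tau> k * \<bar>P (X k)\<bar> powr p) \<le> (\<Sum>k<N. \<integral>y. ?f k y \<partial>M)"
    proof (rule sum_mono)
      fix k assume "k \<in> {..<N}"
      then have k: "k < N" by simp
      have "\<bar>P (X k)\<bar> powr p \<le> D * (\<integral>y. \<bar>P y\<bar> powr p * (1 + real m * norm (X k - y)) powr - (2 * s + 1) \<partial>M) / ?\<mu> (X k)"
        using pw[OF m P X(1)[OF k]] \<mu>[OF X(1)[OF k]] by (simp add: pos_le_divide_eq)
      then have "\<tau> k * \<bar>P (X k)\<bar> powr p \<le> \<tau> k * (D * (\<integral>y. \<bar>P y\<bar> powr p * (1 + real m * norm (X k - y)) powr - (2 * s + 1) \<partial>M) / ?\<mu> (X k))"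
        using X(2)[OF k] by (rule mult_left_mono)
      also have "\<dots> = (\<integral>y. ?f k y \<partial>M)"
        by (subst integral_mult_right_zero) simp
      finally show "\<tau> k * \<bar>P (X k)\<bar> powr p \<le> (\<integral>y. ?f k y \<partial>M)" .
    qed
    also have "\<dots> = (\<integral>y. (\<Sum>k<N. ?f k y) \<partial>M)"
      by (intro Bochner_Integration.integral_sum[symmetric] integrable_mult_right int)
    also have "\<dots> \<le> (\<integral>y. D * E * (real m / real n) powr s * \<bar>P y\<bar> powr p \<partial>M)"
    proof (rule integral_mono)
      show "integrable M (\<lambda>y. \<Sum>k<N. ?f k y)"
        by (intro Bochner_Integration.integrable_sum integrable_mult_right int)
      show "integrable M (\<lambda>y. D * E * (real m / real n) powr s * \<bar>P y\<bar> powr p)"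
        using p by (intro integrable_mult_right integrable_cont continuous_on_powr_sph_poly[OF P]) auto
      fix y assume "y \<in> space M"
      then have y: "y \<in> sphere 0 1" by (simp add: space_M)
      let ?c = "C1 * C1 * (real m / real n) powr s / measure M (sball y (1 / real n))"
      have \<mu>n: "0 < measure M (sball y (1 / real n))" using n by (intro measure_sball_pos pos y) auto
      have tm: "(1 + real m * norm (X k - y)) powr - (2 * s + 1) / ?\<mu> (X k) \<le> ?c * (1 + real n * norm (y - X k)) powr - (s + 1)"
        if k: "k < N" for k
      proof -
        let ?r = "1 + real m * norm (X k - y)"
        have r1: "1 \<le> ?r" by simp
        \<comment> \<open>The radius about \<open>y\<close> shrinks to \<open>1 / m\<close> before
          the centre moves to the node; the move uses up \<open>s\<close> of the decay
          \<open>2 * s + 1\<close>.\<close>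
        have "measure M (sball y (1 / real n)) \<le> C1 * (real m / real n) powr s * ?\<mu> y"
          using growth[OF y, of "1 / real m" "real m / real n"] n nm by (simp add: C1_def)
        also have "\<dots> \<le> C1 * (real m / real n) powr s * (C1 * ?r powr s * ?\<mu> (X k))"
        proof (rule mult_left_mono)
          show "?\<mu> y \<le> C1 * ?r powr s * ?\<mu> (X k)"
            unfolding C1_def using m r1 X(1)[OF k]
            by (intro growth_move y) (auto simp: field_simps norm_minus_commute)
        qed (use C1 in auto)
        finally have "measure M (sball y (1 / real n)) \<le> C1 * (real m / real n) powr s * (C1 * ?r powr s * ?\<mu> (X k))" .
        then have "1 / ?\<mu> (X k) \<le> ?c * ?r powr s"
          using \<mu>[OF X(1)[OF k]] \<mu>n by (simp add: divide_simps mult_ac)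
        then have "?r powr - (2 * s + 1) * (1 / ?\<mu> (X k)) \<le> ?r powr - (2 * s + 1) * (?c * ?r powr s)"
          by (intro mult_left_mono) auto
        also have "\<dots> = ?c * (?r powr - (2 * s + 1) * ?r powr s)" by simp
        also have "?r powr - (2 * s + 1) * ?r powr s = ?r powr - (s + 1)"
          by (simp add: powr_add[symmetric])
        \<comment> \<open>The decay is weakened to scale \<open>1 / n\<close>, where
          \<open>sum_decay\<close> can use the node masses.\<close>
        also have "?c * ?r powr - (s + 1) \<le> ?c * (1 + real n * norm (y - X k)) powr - (s + 1)"
        proof (intro mult_left_mono powr_mono2')
          show "1 + real n * norm (y - X k) \<le> ?r" using nm by (simp add: norm_minus_commute mult_right_mono)
          show "0 < 1 + real n * norm (y - X k)" by (simp add: add_pos_nonneg)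
        qed (use C1 s_pos in auto)
        finally show ?thesis by simp
      qed
      have "(\<Sum>k<N. ?f k y) = D * \<bar>P y\<bar> powr p * (\<Sum>k<N. \<tau> k * ((1 + real m * norm (X k - y)) powr - (2 * s + 1) / ?\<mu> (X k)))"
        by (simp add: sum_distrib_left mult_ac)
      also have "\<dots> \<le> D * \<bar>P y\<bar> powr p * (\<Sum>k<N. \<tau> k * (?c * (1 + real n * norm (y - X k)) powr - (s + 1)))"
        using D X(2) tm by (intro mult_left_mono sum_mono) auto
      also have "\<dots> = D * \<bar>P y\<bar> powr p * (?c * (\<Sum>k<N. \<tau> k * (1 + real n * norm (y - X k)) powr - (s + 1)))"
        by (simp add: sum_distrib_left mult_ac)
      also have "\<dots> \<le> D * \<bar>P y\<bar> powr p * (?c * (A * (2 powr (s + 1) * (2 * C0)) * measure M (sball y (1 / real n))))"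
        using D C1 n A X by (intro mult_left_mono sum_decay y tau[OF n mz y]) auto
      also have "\<dots> = D * E * (real m / real n) powr s * \<bar>P y\<bar> powr p"
        using \<mu>n by (simp add: E_def mult_ac)
      finally show "(\<Sum>k<N. ?f k y) \<le> D * E * (real m / real n) powr s * \<bar>P y\<bar> powr p" .
    qed
    also have "\<dots> = D * E * (real m / real n) powr s * (\<integral>y. \<bar>P y\<bar> powr p \<partial>M)" by (rule integral_mult_right_zero)
    finally show ?thesis .
  qed
  then show ?thesis using D E by (intro exI[of _ "D * E"]) auto
qed

text \<open>Dropping the decay factor leaves the full integral, and doubling from radius
  \<open>1 / n\<close> up to the diameter shows that the ball carries at least a constant times
  n^(-s) of the total mass.\<close>

lemma nikolskii:
  assumes p: "1 \<le> p" and pos: "0 < measure M (sphere 0 1)"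
  shows "\<exists>C>0. \<forall>n\<ge>1. \<forall>P\<in>sph_poly n. \<forall>x\<in>sphere 0 1. \<bar>P x\<bar> powr p \<le> C * real n powr s * (\<integral>y. \<bar>P y\<bar> powr p \<partial>M)"
proof -
  obtain D where D: "0 < D" and pw: "\<And>n P x. n \<ge> 1 \<Longrightarrow> P \<in> sph_poly n \<Longrightarrow> x \<in> sphere 0 1 \<Longrightarrow>
     \<bar>P x\<bar> powr p * measure M (sball x (1 / real n))
       \<le> D * (\<integral>y. \<bar>P y\<bar> powr p * (1 + real n * norm (x - y)) powr - (2 * s + 1) \<partial>M)"
    using pointwise_bound[OF p] by blast
  define C1 where "C1 = C0 * 2 powr s * 2 powr s"
  have C1: "0 < C1" using C0 by (simp add: C1_def)
  define S where "S = measure M (sphere 0 1)"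
  have S: "0 < S" using pos by (simp add: S_def)
  have "\<bar>P x\<bar> powr p \<le> D * C1 / S * real n powr s * (\<integral>y. \<bar>P y\<bar> powr p \<partial>M)"
    if n: "n \<ge> 1" and P: "P \<in> sph_poly n" and x: "x \<in> sphere 0 1" for n P x
  proof -
    let ?I = "\<integral>y. \<bar>P y\<bar> powr p \<partial>M"
    have "S \<le> C0 * 2 powr s * (2 * real n) powr s * measure M (sball x (1 / real n))"
      using growth[OF x, of "1 / real n" "2 * real n"] n sball_2[OF x order_refl] by (simp add: S_def)
    then have S': "S \<le> C1 * real n powr s * measure M (sball x (1 / real n))" by (simp add: C1_def powr_mult)
    have "\<bar>P x\<bar> powr p * S \<le> \<bar>P x\<bar> powr p * (C1 * real n powr s * measure M (sball x (1 / real n)))"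
      by (intro mult_left_mono S') auto
    also have "\<dots> = C1 * real n powr s * (\<bar>P x\<bar> powr p * measure M (sball x (1 / real n)))" by simp
    also have "\<dots> \<le> C1 * real n powr s * (D * (\<integral>y. \<bar>P y\<bar> powr p * (1 + real n * norm (x - y)) powr - (2 * s + 1) \<partial>M))"
      using C1 by (intro mult_left_mono pw n P x) auto
    also have "\<dots> \<le> C1 * real n powr s * (D * ?I)"
    proof (intro mult_left_mono integral_mono)
      show "integrable M (\<lambda>y. \<bar>P y\<bar> powr p * (1 + real n * norm (x - y)) powr - (2 * s + 1))"
        using n p by (intro integrable_cont continuous_intros continuous_on_decay continuous_on_powr_sph_poly[OF P]) auto
      show "integrable M (\<lambda>y. \<bar>P y\<bar> powr p)"
        using p by (intro integrable_cont continuous_on_powr_sph_poly[OF P]) auto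
      fix y
      have "(1 + real n * norm (x - y)) powr - (2 * s + 1) \<le> (1 + real n * norm (x - y)) powr 0"
        using s_pos by (intro powr_mono) auto
      also have "\<dots> \<le> 1" by simp
      finally have "(1 + real n * norm (x - y)) powr - (2 * s + 1) \<le> 1" .
      then show "\<bar>P y\<bar> powr p * (1 + real n * norm (x - y)) powr - (2 * s + 1) \<le> \<bar>P y\<bar> powr p"
        using mult_left_mono[of _ 1 "\<bar>P y\<bar> powr p"] by simp
    qed (use C1 D in auto)
    finally show ?thesis using S by (simp add: pos_le_divide_eq mult_ac)
  qed
  then show ?thesis using D C1 S by (intro exI[of _ "D * C1 / S"]) auto
qed

end

subsection \<open>The telescoping argument\<close>

lemma abs_diff_powr_le:
  fixes a b :: real
  assumes "0 \<le> p"
  shows "\<bar>a - b\<bar> powr p \<le> 2 powr p * (\<bar>a\<bar> powr p + \<bar>b\<bar> powr p)"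
proof -
  have "\<bar>a - b\<bar> powr p \<le> (2 * max \<bar>a\<bar> \<bar>b\<bar>) powr p" using assms by (intro powr_mono2) auto
  also have "\<dots> = 2 powr p * max \<bar>a\<bar> \<bar>b\<bar> powr p" by (simp add: powr_mult)
  also have "\<dots> \<le> 2 powr p * (\<bar>a\<bar> powr p + \<bar>b\<bar> powr p)"
    by (intro mult_left_mono) (auto simp: max_def)
  finally show ?thesis .
qed

text \<open>
  Substitute for Minkowski's inequality: with geometric weights \<open>A\<close> it sums a series of geometrically
  decaying \<open>L_p\<close> norms.
\<close>

lemma abs_sum_powr_le:
  fixes a A :: "'i \<Rightarrow> real"
  assumes "finite I" "0 < p" and A: "\<And>i. i \<in> I \<Longrightarrow> 0 < A i"
  shows "\<bar>\<Sum>i\<in>I. a i\<bar> powr p \<le> (\<Sum>i\<in>I. A i) powr p * (\<Sum>i\<in>I. \<bar>a i\<bar> powr p / A i powr p)"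
proof -
  define q where "q = (\<Sum>i\<in>I. \<bar>a i\<bar> powr p / A i powr p)"
  have q0: "0 \<le> q" unfolding q_def by (intro sum_nonneg) auto
  have "\<bar>a i\<bar> \<le> A i * q powr (1 / p)" if i: "i \<in> I" for i
  proof -
    have "(\<bar>a i\<bar> / A i) powr p = \<bar>a i\<bar> powr p / A i powr p"
      using A[OF i] by (simp add: powr_divide)
    also have "\<dots> \<le> q" unfolding q_def using i assms(1) by (intro member_le_sum) auto
    finally have "((\<bar>a i\<bar> / A i) powr p) powr (1 / p) \<le> q powr (1 / p)"
      using assms(2) by (intro powr_mono2) auto
    then show ?thesis using A[OF i] assms(2) by (simp add: powr_powr pos_divide_le_eq mult.commute)
  qed
  then have "\<bar>\<Sum>i\<in>I. a i\<bar> \<le> (\<Sum>i\<in>I. A i * q powr (1 / p))"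
    by (intro order_trans[OF sum_abs] sum_mono)
  also have "\<dots> = (\<Sum>i\<in>I. A i) * q powr (1 / p)" by (simp add: sum_distrib_right)
  finally have "\<bar>\<Sum>i\<in>I. a i\<bar> powr p \<le> ((\<Sum>i\<in>I. A i) * q powr (1 / p)) powr p"
    using assms(2) by (intro powr_mono2) auto
  also have "\<dots> = (\<Sum>i\<in>I. A i) powr p * q"
    using assms(2) q0 by (simp add: powr_mult powr_powr)
  finally show ?thesis by (simp add: q_def)
qed

lemma sum_power_le_geometric: "0 \<le> x \<Longrightarrow> x < 1 \<Longrightarrow> (\<Sum>i<n. x ^ i) \<le> 1 / (1 - x)" for x :: real
  by (simp add: sum_gp_strict divide_right_mono)

lemma le_powr_inverse:
  fixes a b p :: real
  assumes "0 < p" "0 \<le> a" "0 \<le> b" "a powr p \<le> b"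
  shows "a \<le> b powr (1 / p)"
proof -
  have "(a powr p) powr (1 / p) \<le> b powr (1 / p)" using assms by (intro powr_mono2) auto
  then show ?thesis using assms by (simp add: powr_powr)
qed

context doubling_sphere begin

text \<open>Convergence in \<open>L_p\<close> alone says nothing at a point. But if the bound failed
  at \<open>x\<close>, continuity would keep \<open>f\<close> away from all later \<open>P i\<close>
  on a ball of positive measure, and the \<open>L_p\<close> distances could not tend to 0.\<close>

lemma sup_bound_from_Lp_convergence:
  fixes f :: "real^'n \<Rightarrow> real" and P :: "nat \<Rightarrow> real^'n \<Rightarrow> real"
  assumes pos: "0 < measure M (sphere 0 1)" and p: "0 < p"
    and f: "continuous_on (sphere 0 1) f" and P: "\<And>i. continuous_on (sphere 0 1) (P i)"
    and conv: "(\<lambda>i. \<integral>y. \<bar>f y - P i y\<bar> powr p \<partial>M) \<longlonglongrightarrow> 0"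
    and near: "\<And>i x. k \<le> i \<Longrightarrow> x \<in> sphere 0 1 \<Longrightarrow> \<bar>P i x - P k x\<bar> \<le> e" and x: "x \<in> sphere 0 1"
  shows "\<bar>f x - P k x\<bar> \<le> e"
proof (rule ccontr)
  assume neg: "\<not> \<bar>f x - P k x\<bar> \<le> e"
  \<comment> \<open>Half of the excess is given up to continuity; the other half remains as a lower
    bound on the ball.\<close>
  define \<eta> where "\<eta> = (\<bar>f x - P k x\<bar> - e) / 2"
  have \<eta>: "0 < \<eta>" "\<bar>f x - P k x\<bar> = e + 2 * \<eta>" using neg by (auto simp: \<eta>_def field_simps)
  have "continuous_on (sphere 0 1) (\<lambda>y. f y - P k y)" by (intro continuous_intros f P)
  then obtain d where d: "0 < d" "\<And>y. y \<in> sphere 0 1 \<Longrightarrow> dist y x < d \<Longrightarrow> dist (f y - P k y) (f x - P k x) < \<eta>"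
    using x \<eta>(1) unfolding continuous_on_iff by meson
  have big: "\<eta> \<le> \<bar>f y - P i y\<bar>" if "y \<in> sball x (d / 2)" "k \<le> i" for y i
  proof -
    have y: "y \<in> sphere 0 1" using that by (simp add: mem_sball)
    have "dist y x < d" using that d by (simp add: mem_sball dist_norm norm_minus_commute)
    then have "\<bar>(f y - P k y) - (f x - P k x)\<bar> < \<eta>" using d(2)[OF y] by (simp add: dist_real_def)
    then show ?thesis using near[OF that(2) y] \<eta> by linarith
  qed
  let ?m = "\<eta> powr p * measure M (sball x (d / 2))"
  have m: "0 < ?m" using \<eta> d by (auto intro!: mult_pos_pos measure_sball_pos pos x)
  have "?m \<le> (\<integral>y. \<bar>f y - P i y\<bar> powr p \<partial>M)" if "k \<le> i" for i
  proof -
    have "?m = (\<integral>y. \<eta> powr p * indicator (sball x (d / 2)) y \<partial>M)"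
      by (subst integral_mult_right_zero) simp
    also have "\<dots> \<le> (\<integral>y. \<bar>f y - P i y\<bar> powr p \<partial>M)"
    proof (rule integral_mono)
      show "integrable M (\<lambda>y. \<eta> powr p * indicator (sball x (d / 2)) y)"
        by (intro integrable_mult_right integrable_real_indicator) (auto simp: less_top[symmetric])
      show "integrable M (\<lambda>y. \<bar>f y - P i y\<bar> powr p)"
        using p by (intro integrable_cont continuous_on_powr' continuous_intros f P) auto
      show "\<eta> powr p * indicator (sball x (d / 2)) y \<le> \<bar>f y - P i y\<bar> powr p" for y
        using big[OF _ that, of y] \<eta> p by (auto simp: indicator_def intro!: powr_mono2)
    qed
    finally show ?thesis .
  qed
  then have "?m \<le> 0"
    by (intro tendsto_lowerbound[OF conv]) (auto simp: eventually_sequentially)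
  with m show False by simp
qed

text \<open>Smoothness is reduced to a geometric rate with amplitude \<open>T\<close>, which keeps
  \<open>\<Theta>\<close> and the Besov norm outside. Taking \<open>m\<close> within a factor 2 of
  \<open>n\<close> puts \<open>P 0\<close> into the space of degree \<open>n\<close>, while the
  degree bounds of all differences exceed \<open>n\<close>.\<close>

lemma least_approx_core:
  assumes p: "1 \<le> p" and pos: "0 < measure M (sphere 0 1)" and A: "0 < A" and B: "0 < B" and r: "s / p < r"
  shows "\<exists>C>0. \<forall>n m N X \<tau> f L P T. 1 \<le> n \<longrightarrow> m \<le> n \<longrightarrow> n < 2 * m \<longrightarrow> 0 < T \<longrightarrow>
    continuous_on (sphere 0 1) f \<longrightarrow>
    (\<forall>i. P i \<in> sph_poly (2 ^ i * m)) \<longrightarrow>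
    (\<forall>i. (\<integral>y. \<bar>f y - P i y\<bar> powr p \<partial>M) \<le> (T * (2 powr - r) ^ i) powr p) \<longrightarrow>
    MZ_upper p B M n N X \<tau> \<longrightarrow>
    (\<forall>Q\<in>sph_poly n. A * (\<integral>y. \<bar>Q y\<bar> powr p \<partial>M) \<le> (\<Sum>k<N. \<tau> k * \<bar>Q (X k)\<bar> powr p)) \<longrightarrow>
    L \<in> sph_poly n \<longrightarrow>
    (\<forall>Q\<in>sph_poly n. (\<Sum>k<N. \<tau> k * \<bar>f (X k) - L (X k)\<bar> powr p) \<le> (\<Sum>k<N. \<tau> k * \<bar>f (X k) - Q (X k)\<bar> powr p)) \<longrightarrow>
    (\<integral>y. \<bar>f y - L y\<bar> powr p \<partial>M) \<le> (C * T) powr p \<and>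
    (\<forall>x\<in>sphere 0 1. \<bar>f x - L x\<bar> \<le> C * real n powr (s / p) * T)"
proof -
  obtain D where D: "0 < D" and nik: "\<And>n P x. 1 \<le> n \<Longrightarrow> P \<in> sph_poly n \<Longrightarrow> x \<in> sphere 0 1 \<Longrightarrow>
      \<bar>P x\<bar> powr p \<le> D * real n powr s * (\<integral>y. \<bar>P y\<bar> powr p \<partial>M)"
    using nikolskii[OF p pos] by blast
  obtain E where E: "0 < E" and high: "\<And>n m N X \<tau> P. 1 \<le> n \<Longrightarrow> n \<le> m \<Longrightarrow> MZ_upper p B M n N X \<tau> \<Longrightarrow> P \<in> sph_poly m \<Longrightarrow>
     (\<Sum>k<N. \<tau> k * \<bar>P (X k)\<bar> powr p) \<le> E * (real m / real n) powr s * (\<integral>y. \<bar>P y\<bar> powr p \<partial>M)"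
    using MZ_upper_higher_degree[OF p B pos] by blast
  have p0: "0 < p" using p by simp
  define \<rho> where "\<rho> = 2 powr - r"
  \<comment> \<open>Ratio of the uniform bounds for consecutive differences: Nikolskii costs 2^(s/p)
    per doubling of the degree, smoothness gains 2^(-r). It is below 1 exactly when r > s/p.\<close>
  define \<beta> where "\<beta> = 2 powr (s / p) * \<rho>"
  have \<rho>: "0 < \<rho>" by (simp add: \<rho>_def)
  have "s / p > 0" using s_pos p by simp
  then have \<rho>1: "\<rho> < 1" unfolding \<rho>_def using r by (intro powr_less_one) auto
  have \<beta>: "0 < \<beta>" "\<beta> < 1"
    using r by (auto simp: \<beta>_def \<rho>_def powr_add[symmetric] intro!: powr_less_one)
  \<comment> \<open>The weights for \<open>abs_sum_powr_le\<close> are \<alpha>^i; as \<alpha> *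
    \<alpha> = \<beta>, the quotients \<beta>^i / \<alpha>^i = \<alpha>^i are summable as
    well.\<close>
  define \<alpha> where "\<alpha> = sqrt \<beta>"
  have \<alpha>: "0 < \<alpha>" "\<alpha> < 1" "\<alpha> * \<alpha> = \<beta>" using \<beta> by (auto simp: \<alpha>_def)
  define K where "K = D powr (1 / p) * 2 powr (s / p) * 4"
  define G where "G = E * 2 powr s * 4 powr p * (1 / (1 - \<alpha>)) powr p * (1 / (1 - \<alpha>))"
  define H where "H = 1 / A * 2 powr p * 2 * (2 powr p * G)"
  \<comment> \<open>The first summand serves the \<open>L_p\<close> bound, the other two the uniform
    bounds of f - P 0 and P 0 - L.\<close>
  define C where "C = (2 powr p * (1 + H)) powr (1 / p) + K / (1 - \<beta>) + (D * H) powr (1 / p)"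
  have K: "0 < K" using D by (simp add: K_def)
  have G: "0 < G" using E \<alpha> by (simp add: G_def)
  have H: "0 < H" using A G by (simp add: H_def)
  have C: "0 < C" using K \<beta> H D by (simp add: C_def add_pos_nonneg)
  have "(\<integral>y. \<bar>f y - L y\<bar> powr p \<partial>M) \<le> (C * T) powr p \<and>
    (\<forall>x\<in>sphere 0 1. \<bar>f x - L x\<bar> \<le> C * real n powr (s / p) * T)"
    if n: "1 \<le> n" and m: "m \<le> n" "n < 2 * m" and T: "0 < T" and f: "continuous_on (sphere 0 1) f"
      and P: "\<forall>i. P i \<in> sph_poly (2 ^ i * m)"
      and fP: "\<forall>i. (\<integral>y. \<bar>f y - P i y\<bar> powr p \<partial>M) \<le> (T * (2 powr - r) ^ i) powr p"
      and mz: "MZ_upper p B M n N X \<tau>"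
      and lower: "\<forall>Q\<in>sph_poly n. A * (\<integral>y. \<bar>Q y\<bar> powr p \<partial>M) \<le> (\<Sum>k<N. \<tau> k * \<bar>Q (X k)\<bar> powr p)"
      and L: "L \<in> sph_poly n"
      and least: "\<forall>Q\<in>sph_poly n. (\<Sum>k<N. \<tau> k * \<bar>f (X k) - L (X k)\<bar> powr p) \<le> (\<Sum>k<N. \<tau> k * \<bar>f (X k) - Q (X k)\<bar> powr p)"
    for n m N X \<tau> f L P T
  proof -
    have cP: "continuous_on (sphere 0 1) (P i)" for i using P continuous_on_sph_poly by blast
    have cL: "continuous_on (sphere 0 1) L" by (rule continuous_on_sph_poly[OF L])
    have fP': "(\<integral>y. \<bar>f y - P i y\<bar> powr p \<partial>M) \<le> (T * \<rho> ^ i) powr p" for i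
      using fP by (simp add: \<rho>_def)
    have X: "X k \<in> sphere 0 1" "0 \<le> \<tau> k" if "k < N" for k using mz that by (auto simp: MZ_upper_def)
    have int: "integrable M (\<lambda>y. \<bar>g y\<bar> powr p)" if "continuous_on (sphere 0 1) g" for g :: "real^'n \<Rightarrow> real"
      using p that by (intro integrable_cont continuous_on_powr' continuous_intros) auto
    have quasi: "(\<integral>y. \<bar>g y - h y\<bar> powr p \<partial>M) \<le> 2 powr p * ((\<integral>y. \<bar>g y\<bar> powr p \<partial>M) + (\<integral>y. \<bar>h y\<bar> powr p \<partial>M))"
      if "continuous_on (sphere 0 1) g" "continuous_on (sphere 0 1) h" for g h :: "real^'n \<Rightarrow> real"
    proof -
      have "(\<integral>y. \<bar>g y - h y\<bar> powr p \<partial>M) \<le> (\<integral>y. 2 powr p * (\<bar>g y\<bar> powr p + \<bar>h y\<bar> powr p) \<partial>M)"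
        using that p by (intro integral_mono integrable_mult_right Bochner_Integration.integrable_add int abs_diff_powr_le continuous_intros) auto
      also have "\<dots> = 2 powr p * ((\<integral>y. \<bar>g y\<bar> powr p \<partial>M) + (\<integral>y. \<bar>h y\<bar> powr p \<partial>M))"
        using that by (subst integral_mult_right_zero, subst Bochner_Integration.integral_add) (auto intro: int)
      finally show ?thesis .
    qed
    define R where "R i x = P (Suc i) x - P i x" for i x
    have R: "R i \<in> sph_poly (2 ^ Suc i * m)" for i
      unfolding R_def[abs_def] using P[rule_format, of i] P[rule_format, of "Suc i"]
      by (intro sph_poly_diff) (auto intro: sph_poly_mono)
    have RI: "(\<integral>y. \<bar>R i y\<bar> powr p \<partial>M) \<le> (4 * T * \<rho> ^ i) powr p" for i
    proof -
      have "(\<integral>y. \<bar>R i y\<bar> powr p \<partial>M) = (\<integral>y. \<bar>(f y - P i y) - (f y - P (Suc i) y)\<bar> powr p \<partial>M)"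
        by (simp add: R_def)
      also have "\<dots> \<le> 2 powr p * ((\<integral>y. \<bar>f y - P i y\<bar> powr p \<partial>M) + (\<integral>y. \<bar>f y - P (Suc i) y\<bar> powr p \<partial>M))"
        by (intro quasi continuous_intros f cP)
      also have "\<dots> \<le> 2 powr p * ((T * \<rho> ^ i) powr p + (T * \<rho> ^ i) powr p)"
      proof (intro mult_left_mono add_mono fP' order_trans[OF fP'[of "Suc i"]] powr_mono2)
        show "\<rho> ^ Suc i \<le> \<rho> ^ i" using \<rho> \<rho>1 by (intro power_decreasing) auto
      qed (use p T \<rho> in auto)
      also have "\<dots> = 2 powr p * 2 * (T * \<rho> ^ i) powr p" by simp
      also have "\<dots> \<le> 2 powr p * 2 powr p * (T * \<rho> ^ i) powr p"
        using powr_mono[of 1 p "2::real"] p by (intro mult_right_mono mult_left_mono) auto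
      also have "\<dots> = (4 * T * \<rho> ^ i) powr p"
        by (simp add: powr_mult[symmetric] mult.assoc)
      finally show ?thesis .
    qed
    define c where "c = K * real n powr (s / p) * T"
    have c: "0 < c" using K n T by (simp add: c_def)
    have Rsup: "\<bar>R i x\<bar> \<le> c * \<beta> ^ i" if x: "x \<in> sphere 0 1" for i x
    proof -
      have m1: "1 \<le> 2 ^ Suc i * m" using m n by simp
      have "\<bar>R i x\<bar> powr p \<le> D * real (2 ^ Suc i * m) powr s * (\<integral>y. \<bar>R i y\<bar> powr p \<partial>M)"
        by (rule nik[OF m1 R x])
      also have "\<dots> \<le> D * real (2 ^ Suc i * n) powr s * (4 * T * \<rho> ^ i) powr p"
        using D m s_pos by (intro mult_mono RI mult_left_mono powr_mono2) auto
      finally have "\<bar>R i x\<bar> \<le> (D * real (2 ^ Suc i * n) powr s * (4 * T * \<rho> ^ i) powr p) powr (1 / p)"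
        using D by (intro le_powr_inverse[OF p0]) auto
      also have "\<dots> = D powr (1 / p) * real (2 ^ Suc i * n) powr (s / p) * (4 * T * \<rho> ^ i)"
        using p0 T \<rho> by (simp add: powr_mult powr_powr)
      also have "real (2 ^ Suc i * n) powr (s / p) = 2 powr (s / p) * (2 powr (s / p)) ^ i * real n powr (s / p)"
        by (simp add: powr_mult powr_power powr_realpow[symmetric] powr_powr mult.commute)
      also have "D powr (1 / p) * (2 powr (s / p) * (2 powr (s / p)) ^ i * real n powr (s / p)) * (4 * T * \<rho> ^ i) = c * \<beta> ^ i"
        by (simp add: c_def K_def \<beta>_def power_mult_distrib)
      finally show ?thesis .
    qed
    have tele: "P (k + j) x - P k x = (\<Sum>i<j. R (k + i) x)" for k j x
      by (induction j) (auto simp: R_def)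
    have near: "\<bar>P i x - P k x\<bar> \<le> c * \<beta> ^ k / (1 - \<beta>)" if ki: "k \<le> i" and x: "x \<in> sphere 0 1" for i k x
    proof -
      obtain j where j: "i = k + j" using ki le_Suc_ex by blast
      have "\<bar>P i x - P k x\<bar> \<le> (\<Sum>i<j. \<bar>R (k + i) x\<bar>)" unfolding j tele by (rule sum_abs)
      also have "\<dots> \<le> (\<Sum>i<j. c * \<beta> ^ (k + i))" by (intro sum_mono Rsup x)
      also have "\<dots> = c * \<beta> ^ k * (\<Sum>i<j. \<beta> ^ i)" by (simp add: sum_distrib_left power_add mult_ac)
      also have "\<dots> \<le> c * \<beta> ^ k * (1 / (1 - \<beta>))"
        using c \<beta> by (intro mult_left_mono sum_power_le_geometric) auto
      finally show ?thesis by simp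
    qed
    have conv: "(\<lambda>i. \<integral>y. \<bar>f y - P i y\<bar> powr p \<partial>M) \<longlonglongrightarrow> 0"
    proof (rule tendsto_sandwich[OF _ _ tendsto_const])
      have "(\<lambda>i. T * \<rho> ^ i) \<longlonglongrightarrow> T * 0"
        using \<rho> \<rho>1 by (intro tendsto_intros LIMSEQ_realpow_zero) auto
      then have "(\<lambda>i. (T * \<rho> ^ i) powr p) \<longlonglongrightarrow> 0 powr p"
        using p0 T \<rho> by (intro tendsto_powr') (auto intro: tendsto_const)
      then show "(\<lambda>i. (T * \<rho> ^ i) powr p) \<longlonglongrightarrow> 0" by simp
    qed (use fP' in auto)
    have sup: "\<bar>f x - P k x\<bar> \<le> c * \<beta> ^ k / (1 - \<beta>)" if "x \<in> sphere 0 1" for k x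
      by (rule sup_bound_from_Lp_convergence[OF pos p0 f cP conv near that])
    have Rdisc: "(\<Sum>k<N. \<tau> k * \<bar>R i (X k)\<bar> powr p) \<le> E * 2 powr s * 4 powr p * T powr p * (\<beta> ^ i) powr p" for i
    proof -
      \<comment> \<open>Already the first difference has degree bound 2m > n, so \<open>high\<close>
        applies from \<open>i = 0\<close> on.\<close>
      have "2 * m \<le> 2 ^ Suc i * m" by simp
      then have nm: "n \<le> 2 ^ Suc i * m" using m by linarith
      have "(\<Sum>k<N. \<tau> k * \<bar>R i (X k)\<bar> powr p) \<le> E * (real (2 ^ Suc i * m) / real n) powr s * (\<integral>y. \<bar>R i y\<bar> powr p \<partial>M)"
        by (rule high[OF n nm mz R])
      also have "\<dots> \<le> E * (2 ^ Suc i) powr s * (4 * T * \<rho> ^ i) powr p"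
        using E m n s_pos by (intro mult_mono RI mult_left_mono powr_mono2) (auto simp: field_simps)
      also have "(2 ^ Suc i) powr s = 2 powr s * ((2 powr (s / p)) ^ i) powr p"
        using p0 by (simp add: powr_mult powr_power powr_realpow[symmetric] powr_powr mult.commute)
      also have "E * (2 powr s * ((2 powr (s / p)) ^ i) powr p) * (4 * T * \<rho> ^ i) powr p
         = E * 2 powr s * 4 powr p * T powr p * (\<beta> ^ i) powr p"
        by (simp add: powr_mult \<beta>_def power_mult_distrib)
      finally show ?thesis .
    qed
    define S where "S = (\<Sum>k<N. \<tau> k * \<bar>f (X k) - P 0 (X k)\<bar> powr p)"
    \<comment> \<open>The tail f - P I is bounded uniformly, times the total node mass. That mass
      may depend on \<open>n\<close>: the nodes stay fixed while \<open>I\<close> tends to infinity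
      and the tail vanishes.\<close>
    have disc: "S \<le> 2 powr p * ((\<Sum>k<N. \<tau> k) * (c * \<beta> ^ I / (1 - \<beta>)) powr p + G * T powr p)" for I
    proof -
      have "S \<le> (\<Sum>k<N. \<tau> k * (2 powr p * (\<bar>f (X k) - P I (X k)\<bar> powr p + \<bar>- (\<Sum>i<I. R i (X k))\<bar> powr p)))"
        unfolding S_def
      proof (intro sum_mono mult_left_mono)
        fix k assume "k \<in> {..<N}"
        have eq: "f (X k) - P 0 (X k) = (f (X k) - P I (X k)) - - (\<Sum>i<I. R i (X k))"
          using tele[of 0 I "X k"] by simp
        show "\<bar>f (X k) - P 0 (X k)\<bar> powr p \<le> 2 powr p * (\<bar>f (X k) - P I (X k)\<bar> powr p + \<bar>- (\<Sum>i<I. R i (X k))\<bar> powr p)"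
          unfolding eq using p0 by (intro abs_diff_powr_le) simp
      qed (use X in auto)
      also have "\<dots> = 2 powr p * ((\<Sum>k<N. \<tau> k * \<bar>f (X k) - P I (X k)\<bar> powr p) + (\<Sum>k<N. \<tau> k * \<bar>\<Sum>i<I. R i (X k)\<bar> powr p))"
        by (simp add: sum_distrib_left sum.distrib[symmetric] algebra_simps)
      also have "\<dots> \<le> 2 powr p * ((\<Sum>k<N. \<tau> k) * (c * \<beta> ^ I / (1 - \<beta>)) powr p + G * T powr p)"
      proof (intro mult_left_mono add_mono)
        show "(\<Sum>k<N. \<tau> k * \<bar>f (X k) - P I (X k)\<bar> powr p) \<le> (\<Sum>k<N. \<tau> k) * (c * \<beta> ^ I / (1 - \<beta>)) powr p"
          unfolding sum_distrib_right using X sup p0 by (intro sum_mono mult_left_mono powr_mono2) auto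
        have "(\<Sum>k<N. \<tau> k * \<bar>\<Sum>i<I. R i (X k)\<bar> powr p)
          \<le> (\<Sum>k<N. \<tau> k * ((\<Sum>i<I. \<alpha> ^ i) powr p * (\<Sum>i<I. \<bar>R i (X k)\<bar> powr p / (\<alpha> ^ i) powr p)))"
          using X p0 \<alpha> by (intro sum_mono mult_left_mono abs_sum_powr_le) auto
        also have "\<dots> = (\<Sum>i<I. \<alpha> ^ i) powr p * (\<Sum>i<I. (\<Sum>k<N. \<tau> k * \<bar>R i (X k)\<bar> powr p) / (\<alpha> ^ i) powr p)"
          unfolding sum_distrib_left sum_divide_distrib by (subst sum.swap) (simp add: mult_ac)
        also have "\<dots> \<le> (1 / (1 - \<alpha>)) powr p * (\<Sum>i<I. E * 2 powr s * 4 powr p * T powr p * \<alpha> ^ i)"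
        proof (intro mult_mono powr_mono2 sum_power_le_geometric sum_mono)
          fix i
          have "(\<Sum>k<N. \<tau> k * \<bar>R i (X k)\<bar> powr p) / (\<alpha> ^ i) powr p
             \<le> E * 2 powr s * 4 powr p * T powr p * (\<beta> ^ i) powr p / (\<alpha> ^ i) powr p"
            by (intro divide_right_mono Rdisc) auto
          also have "\<dots> = E * 2 powr s * 4 powr p * T powr p * (\<alpha> ^ i) powr p"
            using \<alpha>(1) by (simp add: \<alpha>(3)[symmetric] power_mult_distrib powr_mult)
          also have "\<dots> \<le> E * 2 powr s * 4 powr p * T powr p * (\<alpha> ^ i) powr 1"
            using E \<alpha> p by (intro mult_left_mono powr_mono') (auto intro: power_le_one)
          finally show "(\<Sum>k<N. \<tau> k * \<bar>R i (X k)\<bar> powr p) / (\<alpha> ^ i) powr p \<le> E * 2 powr s * 4 powr p * T powr p * \<alpha> ^ i"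
            using \<alpha> by simp
        qed (use \<alpha> p0 X in \<open>auto intro!: sum_nonneg divide_nonneg_nonneg\<close>)
        also have "\<dots> = (1 / (1 - \<alpha>)) powr p * (E * 2 powr s * 4 powr p * T powr p * (\<Sum>i<I. \<alpha> ^ i))"
          by (simp add: sum_distrib_left)
        also have "\<dots> \<le> (1 / (1 - \<alpha>)) powr p * (E * 2 powr s * 4 powr p * T powr p * (1 / (1 - \<alpha>)))"
          using \<alpha> E by (intro mult_left_mono sum_power_le_geometric) auto
        also have "\<dots> = G * T powr p" by (simp add: G_def mult_ac)
        finally show "(\<Sum>k<N. \<tau> k * \<bar>\<Sum>i<I. R i (X k)\<bar> powr p) \<le> G * T powr p" .
      qed auto
      finally show ?thesis .
    qed
    have S: "S \<le> 2 powr p * G * T powr p"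
    proof -
      have "(\<lambda>I. c * \<beta> ^ I / (1 - \<beta>)) \<longlonglongrightarrow> c * 0 / (1 - \<beta>)"
        using \<beta> by (intro tendsto_intros LIMSEQ_realpow_zero) auto
      then have lim: "(\<lambda>I. (c * \<beta> ^ I / (1 - \<beta>)) powr p) \<longlonglongrightarrow> 0 powr p"
        using p0 c \<beta> by (intro tendsto_powr') (auto intro: tendsto_const)
      have "(\<lambda>I. 2 powr p * ((\<Sum>k<N. \<tau> k) * (c * \<beta> ^ I / (1 - \<beta>)) powr p + G * T powr p))
        \<longlonglongrightarrow> 2 powr p * ((\<Sum>k<N. \<tau> k) * (0 powr p) + G * T powr p)"
        by (intro tendsto_mult tendsto_add tendsto_const lim)
      from LIMSEQ_le_const[OF this] disc have "S \<le> 2 powr p * ((\<Sum>k<N. \<tau> k) * (0 powr p) + G * T powr p)" by blast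
      then show ?thesis by simp
    qed
    have P0: "P 0 \<in> sph_poly n" using P[rule_format, of 0] m by (auto intro: sph_poly_mono)
    have PL: "(\<lambda>x. P 0 x - L x) \<in> sph_poly n" by (rule sph_poly_diff[OF P0 L])
    \<comment> \<open>The lower bound holds for polynomials, hence the comparison of
      \<open>L\<close> with \<open>P 0\<close> instead of \<open>f\<close>.\<close>
    have "A * (\<integral>y. \<bar>P 0 y - L y\<bar> powr p \<partial>M) \<le> (\<Sum>k<N. \<tau> k * \<bar>P 0 (X k) - L (X k)\<bar> powr p)"
      using lower PL by auto
    also have "\<dots> \<le> (\<Sum>k<N. \<tau> k * (2 powr p * (\<bar>f (X k) - L (X k)\<bar> powr p + \<bar>f (X k) - P 0 (X k)\<bar> powr p)))"
    proof (intro sum_mono mult_left_mono)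
      fix k
      show "\<bar>P 0 (X k) - L (X k)\<bar> powr p \<le> 2 powr p * (\<bar>f (X k) - L (X k)\<bar> powr p + \<bar>f (X k) - P 0 (X k)\<bar> powr p)"
        using abs_diff_powr_le[of p "f (X k) - L (X k)" "f (X k) - P 0 (X k)"] p0 by simp
    qed (use X in auto)
    also have "\<dots> = 2 powr p * ((\<Sum>k<N. \<tau> k * \<bar>f (X k) - L (X k)\<bar> powr p) + S)"
      by (simp add: S_def sum_distrib_left sum.distrib[symmetric] algebra_simps)
    \<comment> \<open>\<open>P 0\<close> competes in the minimisation, so the error of
      \<open>L\<close> at the nodes is at most \<open>S\<close>.\<close>
    also have "\<dots> \<le> 2 powr p * (S + S)"
      using least P0 by (intro mult_left_mono add_mono) (auto simp: S_def)
    also have "\<dots> \<le> 2 powr p * (2 powr p * G * T powr p + 2 powr p * G * T powr p)"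
      using S by (intro mult_left_mono add_mono) auto
    finally have PLI: "(\<integral>y. \<bar>P 0 y - L y\<bar> powr p \<partial>M) \<le> H * T powr p"
      using A by (simp add: H_def field_simps)
    have fI: "(\<integral>y. \<bar>f y - L y\<bar> powr p \<partial>M) \<le> 2 powr p * (1 + H) * T powr p"
    proof -
      have "(\<integral>y. \<bar>f y - L y\<bar> powr p \<partial>M) = (\<integral>y. \<bar>(f y - P 0 y) - (L y - P 0 y)\<bar> powr p \<partial>M)" by simp
      also have "\<dots> \<le> 2 powr p * ((\<integral>y. \<bar>f y - P 0 y\<bar> powr p \<partial>M) + (\<integral>y. \<bar>L y - P 0 y\<bar> powr p \<partial>M))"
        by (intro quasi continuous_intros f cP cL)
      also have "\<dots> \<le> 2 powr p * (T powr p + H * T powr p)"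
        using fP'[of 0] PLI by (intro mult_left_mono add_mono) (auto simp: abs_minus_commute)
      finally show ?thesis by (simp add: algebra_simps)
    qed
    have "2 powr p * (1 + H) * T powr p = ((2 powr p * (1 + H)) powr (1 / p) * T) powr p"
      using p0 H by (simp add: powr_mult powr_powr)
    also have "\<dots> \<le> (C * T) powr p"
    proof (intro powr_mono2 mult_right_mono)
      show "(2 powr p * (1 + H)) powr (1 / p) \<le> C" using K \<beta> by (simp add: C_def)
    qed (use p0 T in auto)
    finally have res1: "(\<integral>y. \<bar>f y - L y\<bar> powr p \<partial>M) \<le> (C * T) powr p" using fI by linarith
    have res2: "\<bar>f x - L x\<bar> \<le> C * real n powr (s / p) * T" if x: "x \<in> sphere 0 1" for x
    proof -
      have "\<bar>P 0 x - L x\<bar> powr p \<le> D * real n powr s * (\<integral>y. \<bar>P 0 y - L y\<bar> powr p \<partial>M)"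
        using nik[OF n PL x] .
      also have "\<dots> \<le> D * real n powr s * (H * T powr p)"
        using D by (intro mult_left_mono PLI) auto
      finally have "\<bar>P 0 x - L x\<bar> \<le> (D * real n powr s * (H * T powr p)) powr (1 / p)"
        using D H by (intro le_powr_inverse[OF p0]) auto
      also have "\<dots> = (D * H) powr (1 / p) * real n powr (s / p) * T"
        using p0 T by (simp add: powr_mult powr_powr)
      finally have "\<bar>P 0 x - L x\<bar> \<le> (D * H) powr (1 / p) * real n powr (s / p) * T" .
      moreover have "\<bar>f x - P 0 x\<bar> \<le> K / (1 - \<beta>) * real n powr (s / p) * T"
        using sup[OF x, of 0] by (simp add: c_def)
      ultimately have "\<bar>f x - L x\<bar> \<le> (K / (1 - \<beta>) + (D * H) powr (1 / p)) * (real n powr (s / p) * T)"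
        by (simp add: distrib_right mult.assoc)
      also have "\<dots> \<le> C * (real n powr (s / p) * T)"
        using T by (intro mult_right_mono) (auto simp: C_def)
      finally show ?thesis by (simp add: mult.assoc)
    qed
    show ?thesis using res1 res2 by blast
  qed
  then show ?thesis using C by blast
qed

end

section \<open>Geodesic caps and chordal balls\<close>

text \<open>With v = u/2, sin u = 2 sin v cos v >= 2 v cos^2 v by v <= tan v, and cos^2 v >= 1/2
  because cos u >= 0.\<close>

lemma half_le_sin:
  fixes u :: real
  assumes "0 \<le> u" "u \<le> pi / 2"
  shows "u / 2 \<le> sin u"
proof -
  define v where "v = u / 2"
  have v: "0 \<le> v" "v < pi / 2" using assms pi_gt_zero unfolding v_def by linarith+
  then have c: "0 < cos v" by (intro cos_gt_zero_pi) auto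
  then have "0 \<le> tan v" using v by (simp add: tan_def sin_ge_zero)
  then have "v \<le> tan v" using abs_tan_ge[of v] v by simp
  then have "v * cos v \<le> sin v" using c by (simp add: tan_def pos_le_divide_eq)
  then have "(v * cos v) * cos v \<le> sin v * cos v" using c by (intro mult_right_mono) auto
  moreover have "sin u = 2 * (sin v * cos v)" using sin_double[of v] by (simp add: v_def)
  moreover have "cos u = 2 * (cos v * cos v) - 1"
    using cos_double_cos[of v] by (simp add: v_def power2_eq_square)
  moreover have "0 \<le> cos u" using assms by (intro cos_ge_zero) auto
  then have "v * (1 / 2) \<le> v * (cos v * cos v)"
    using calculation(3) v by (intro mult_left_mono) auto
  ultimately show ?thesis by (simp add: v_def)
qed

lemma cap_subset_sball:
  assumes "x \<in> sphere 0 1"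
  shows "cap x \<rho> \<subseteq> sball x \<rho>"
proof
  fix y assume y: "y \<in> cap x \<rho>"
  then have n: "norm x = 1" "norm y = 1" and le: "arccos (x \<bullet> y) \<le> \<rho>"
    using assms by (auto simp: cap_def)
  have "\<bar>x \<bullet> y\<bar> \<le> 1" using Cauchy_Schwarz_ineq2[of x y] n by simp
  then have "0 \<le> arccos (x \<bullet> y)" by (simp add: abs_le_iff arccos_lbound)
  then have "2 * sin (arccos (x \<bullet> y) / 2) \<le> arccos (x \<bullet> y)"
    using sin_x_le_x[of "arccos (x \<bullet> y) / 2"] by simp
  then show "y \<in> sball x \<rho>" using dist_sphere_eq[OF n] le n by (simp add: mem_sball)
qed

text \<open>For the angle a between the points, \<open>half_le_sin\<close> at a/2 gives a <= 2 |x -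
  y|. The factor 2 later costs one doubling step.\<close>

lemma sball_subset_cap:
  assumes "x \<in> sphere 0 1"
  shows "sball x \<rho> \<subseteq> cap x (2 * \<rho>)"
proof
  fix y assume y: "y \<in> sball x \<rho>"
  then have n: "norm x = 1" "norm y = 1" and le: "norm (x - y) \<le> \<rho>"
    using assms by (auto simp: mem_sball)
  have "\<bar>x \<bullet> y\<bar> \<le> 1" using Cauchy_Schwarz_ineq2[of x y] n by simp
  then have "0 \<le> arccos (x \<bullet> y)" "arccos (x \<bullet> y) \<le> pi"
    by (simp_all add: abs_le_iff arccos_lbound arccos_ubound)
  then have "arccos (x \<bullet> y) / 2 / 2 \<le> sin (arccos (x \<bullet> y) / 2)"
    by (intro half_le_sin) auto
  then show "y \<in> cap x (2 * \<rho>)" using dist_sphere_eq[OF n] le n by (simp add: cap_def)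
qed

subsection \<open>The weighted measure\<close>

definition weighted_measure :: "(real^'n \<Rightarrow> real) \<Rightarrow> (real^'n) measure" where
  "weighted_measure w = density sphere_measure (\<lambda>x. ennreal (w x))"

lemma space_sphere_measure [simp]: "space sphere_measure = sphere 0 1"
  by (simp add: sphere_measure_def space_restrict_space)

lemma sets_sphere_measure: "sets sphere_measure = sets (restrict_space borel (sphere 0 1))"
  by (simp add: sphere_measure_def)

lemma cap_sets: "cap x \<rho> \<in> sets sphere_measure" if "x \<in> sphere 0 1" for x :: "real^'n"
proof -
  have eq: "cap x \<rho> = sphere 0 1 \<inter> (\<lambda>y. arccos (x \<bullet> y)) -` {..\<rho>} " by (auto simp: cap_def)
  have "continuous_on (sphere 0 1) (\<lambda>y. arccos (x \<bullet> y))"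
  proof (intro continuous_on_arccos continuous_intros ballI)
    fix y :: "real^'n" assume "y \<in> sphere 0 1"
    then have "\<bar>x \<bullet> y\<bar> \<le> 1" using Cauchy_Schwarz_ineq2[of x y] that by simp
    then show "- 1 \<le> x \<bullet> y \<and> x \<bullet> y \<le> 1" by (simp add: abs_le_iff)
  qed
  then have "closed (cap x \<rho>)" unfolding eq by (intro continuous_closed_preimage) auto
  then have "cap x \<rho> \<in> sets borel" by simp
  moreover have "cap x \<rho> = sphere 0 1 \<inter> cap x \<rho>" by (auto simp: cap_def)
  ultimately show ?thesis unfolding sets_sphere_measure sets_restrict_space by blast
qed

context
  fixes w :: "real^'n \<Rightarrow> real"
  assumes w: "doubling_weight w"
begin

lemma weight_nonneg: "x \<in> sphere 0 1 \<Longrightarrow> 0 \<le> w x"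
  using w by (auto simp: doubling_weight_def)

lemma weight_integrable: "integrable sphere_measure w"
  using w by (auto simp: doubling_weight_def)

lemma integral_weighted_measure:
  assumes "g \<in> borel_measurable sphere_measure"
  shows "(\<integral>x. g x \<partial>weighted_measure w) = (\<integral>x. g x * w x \<partial>sphere_measure)"
proof -
  have "AE x in sphere_measure. 0 \<le> w x" using weight_nonneg by (intro AE_I2) auto
  then show ?thesis unfolding weighted_measure_def
    using integral_density[OF assms, of w] weight_integrable by (simp add: mult.commute)
qed

lemma finite_measure_weighted: "finite_measure (weighted_measure w)"
proof
  have "sphere 0 1 \<in> sets (sphere_measure :: (real^'n) measure)"
    using sets.top[of "sphere_measure :: (real^'n) measure"] by simp
  then have "emeasure (weighted_measure w) (space (weighted_measure w)) = (\<integral>\<^sup>+x. ennreal (w x) * indicator (space sphere_measure) x \<partial>sphere_measure)"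
    unfolding weighted_measure_def using weight_integrable by (subst emeasure_density) auto
  also have "\<dots> \<le> (\<integral>\<^sup>+x. ennreal (norm (w x)) \<partial>sphere_measure)"
    by (intro nn_integral_mono) (auto simp: indicator_def intro!: ennreal_leI)
  also have "\<dots> < \<infinity>" using weight_integrable by (simp add: integrable_iff_bounded)
  finally show "emeasure (weighted_measure w) (space (weighted_measure w)) \<noteq> \<infinity>" by simp
qed

lemma measure_weighted:
  assumes "E \<in> sets sphere_measure"
  shows "measure (weighted_measure w) E = wmeas w E"
proof -
  have "measure (weighted_measure w) E = (\<integral>x. indicator E x \<partial>weighted_measure w)"
    using assms sets.sets_into_space[of E sphere_measure] by (simp add: weighted_measure_def Int_absorb2)
  also have "\<dots> = wmeas w E" unfolding wmeas_def
    using assms by (intro integral_weighted_measure) auto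
  finally show ?thesis .
qed

lemma doubling_sphere_weighted:
  assumes sw: "critical_index w sw"
  shows "\<exists>C0. doubling_sphere (weighted_measure w) sw C0"
proof -
  obtain C where sw0: "0 < sw" and C: "\<And>x \<rho> m. x \<in> sphere 0 1 \<Longrightarrow> 0 < \<rho> \<Longrightarrow>
     wmeas w (cap x (2 ^ m * \<rho>)) \<le> C * 2 powr (real m * sw) * wmeas w (cap x \<rho>)"
    using sw unfolding critical_index_def by blast
  interpret finite_measure "weighted_measure w" by (rule finite_measure_weighted)
  let ?\<mu> = "measure (weighted_measure w)"
  \<comment> \<open>\<open>critical_index\<close> does not fix the sign of its constant, hence
    \<open>max 0 C\<close>; \<open>2 powr sw\<close> pays for enclosing a chordal ball in a cap of
    twice the radius.\<close>
  define C0 where "C0 = max 1 (max 0 C * 2 powr sw)"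
  have sets: "sets (weighted_measure w) = sets sphere_measure" by (simp add: weighted_measure_def)
  have sb: "sball x \<rho> \<in> sets sphere_measure" for x :: "real^'n" and \<rho>
    unfolding sball_def sets_sphere_measure by (auto simp: sets_restrict_space)
  have "doubling_sphere (weighted_measure w) sw C0"
  proof
    fix x :: "real^'n" and \<rho> :: real and m :: nat
    assume x: "x \<in> sphere 0 1" and \<rho>: "0 < \<rho>"
    have "?\<mu> (sball x (2 ^ m * \<rho>)) \<le> ?\<mu> (cap x (2 ^ Suc m * \<rho>))"
      using sball_subset_cap[OF x, of "2 ^ m * \<rho>"] cap_sets[OF x]
      by (intro finite_measure_mono) (auto simp: sets mult.assoc)
    also have "\<dots> \<le> C * 2 powr (real (Suc m) * sw) * ?\<mu> (cap x \<rho>)"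
      using C[OF x \<rho>, of "Suc m"] cap_sets[OF x] by (simp add: measure_weighted)
    also have "\<dots> \<le> max 0 C * 2 powr (real (Suc m) * sw) * ?\<mu> (sball x \<rho>)"
      using cap_subset_sball[OF x] by (intro mult_mono finite_measure_mono) (auto simp: sets sb)
    also have "\<dots> = (max 0 C * 2 powr sw) * (2 powr (real m * sw) * ?\<mu> (sball x \<rho>))"
      by (simp add: distrib_right powr_add)
    also have "\<dots> \<le> C0 * (2 powr (real m * sw) * ?\<mu> (sball x \<rho>))"
      by (intro mult_right_mono) (auto simp: C0_def)
    finally show "?\<mu> (sball x (2 ^ m * \<rho>)) \<le> C0 * 2 powr (real m * sw) * ?\<mu> (sball x \<rho>)"
      by (simp add: mult.assoc)
  qed (auto simp: sw0 C0_def sets sets_sphere_measure, simp_all add: weighted_measure_def)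
  then show ?thesis ..
qed

lemma cont_measurable:
  fixes g :: "real^'n \<Rightarrow> real"
  shows "continuous_on (sphere 0 1) g \<Longrightarrow> g \<in> borel_measurable sphere_measure"
  using borel_measurable_continuous_on_restrict[of "sphere 0 1" g] measurable_cong_sets[OF sets_sphere_measure refl] by blast

lemma wnorm_eq:
  fixes h :: "real^'n \<Rightarrow> real"
  assumes h: "continuous_on (sphere 0 1) h" and p: "1 \<le> p"
  shows "wnorm w (ereal p) h = (\<integral>x. \<bar>h x\<bar> powr p \<partial>weighted_measure w) powr (1 / p)"
proof -
  have "continuous_on (sphere 0 1) (\<lambda>x. \<bar>h x\<bar> powr p)"
    using p by (intro continuous_on_powr' continuous_intros h) auto
  then show ?thesis by (simp add: wnorm_def integral_weighted_measure[OF cont_measurable])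
qed

lemma wnorm_powr:
  fixes h :: "real^'n \<Rightarrow> real"
  assumes h: "continuous_on (sphere 0 1) h" and p: "1 \<le> p"
  shows "wnorm w (ereal p) h powr p = (\<integral>x. \<bar>h x\<bar> powr p \<partial>weighted_measure w)"
  using p by (simp add: wnorm_eq[OF assms] powr_powr)

end

section \<open>Norms and near-best approximation\<close>

lemma bdd_above_abs_sphere:
  fixes h :: "real^'n \<Rightarrow> real"
  assumes "continuous_on (sphere 0 1) h"
  shows "bdd_above ((\<lambda>x. \<bar>h x\<bar>) ` sphere 0 1)"
proof -
  have "compact ((\<lambda>x. \<bar>h x\<bar>) ` sphere 0 1)"
    using assms by (intro compact_continuous_image continuous_intros) auto
  then show ?thesis by (intro bounded_imp_bdd_above compact_imp_bounded)
qed

lemma exists_unit_vector: "\<exists>x::real^'n. x \<in> sphere 0 1"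
  using vector_choose_size[of 1] by auto

lemma wnorm_infinity_upper:
  fixes h :: "real^'n \<Rightarrow> real"
  assumes "continuous_on (sphere 0 1) h" "x \<in> sphere 0 1"
  shows "\<bar>h x\<bar> \<le> wnorm w \<infinity> h"
  unfolding wnorm_def using bdd_above_abs_sphere[OF assms(1)] assms(2) by (auto intro: cSUP_upper)

lemma wnorm_infinity_le:
  fixes h :: "real^'n \<Rightarrow> real"
  assumes "\<And>x. x \<in> sphere 0 1 \<Longrightarrow> \<bar>h x\<bar> \<le> c"
  shows "wnorm w \<infinity> h \<le> c"
  unfolding wnorm_def using exists_unit_vector assms by (auto intro!: cSUP_least)

lemma wnorm_nonneg:
  fixes h :: "real^'n \<Rightarrow> real"
  assumes "continuous_on (sphere 0 1) h"
  shows "0 \<le> wnorm w p h"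
proof (cases "p = \<infinity>")
  case True
  obtain x :: "real^'n" where "x \<in> sphere 0 1" using exists_unit_vector by blast
  then show ?thesis using wnorm_infinity_upper[OF assms, of x] True by (metis abs_ge_zero order_trans)
qed (simp add: wnorm_def)

text \<open>Each term of the sequence is at most the whole norm, for finite and infinite
  \<open>\<gamma>\<close>. The strict bound \<open>F\<close> leaves room for an infimum that is not
  known to be attained, and covers a Besov norm equal to 0.\<close>

lemma near_best_approximations:
  fixes f :: "real^'n \<Rightarrow> real"
  assumes f: "continuous_on (sphere 0 1) f" and \<Theta>: "\<And>t. 0 < t \<Longrightarrow> 0 < \<Theta> t" and gamma: "0 < \<gamma>"
    and besov: "in_besov \<Theta> \<gamma> w p f" and F: "besov_norm \<Theta> \<gamma> w p f < F"
  shows "\<exists>P\<in>sph_poly (2 ^ j). wnorm w p (\<lambda>x. f x - P x) < F * \<Theta> (1 / 2 ^ j)"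
proof -
  have \<Theta>j: "0 < \<Theta> (2 powr - real i)" for i by (intro \<Theta>) simp
  have nn: "0 \<le> wnorm w p (\<lambda>x. f x - P x)" if "P \<in> sph_poly i" for P i
    by (intro wnorm_nonneg continuous_intros f continuous_on_sph_poly[OF that])
  have ne: "{wnorm w p (\<lambda>x. f x - P x) | P. P \<in> sph_poly i} \<noteq> {}" for i
    using sph_poly_zero by blast
  have "0 \<le> best_approx w p i f" for i
    unfolding best_approx_def using nn by (intro cInf_greatest ne) auto
  then have b0: "0 \<le> besov_seq \<Theta> w p f i" for i
    unfolding besov_seq_def using less_imp_le[OF \<Theta>j] by simp
  have "besov_seq \<Theta> w p f j \<le> (if \<gamma> = \<infinity> then (SUP j. besov_seq \<Theta> w p f j)
      else (\<Sum>j. besov_seq \<Theta> w p f j powr real_of_ereal \<gamma>) powr (1 / real_of_ereal \<gamma>))"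
  proof (cases "\<gamma> = \<infinity>")
    case True
    then show ?thesis using besov by (auto simp: in_besov_def intro: cSUP_upper)
  next
    case False
    then obtain g where g: "\<gamma> = ereal g" "0 < g" using gamma by (cases \<gamma>) auto
    have sm: "summable (\<lambda>j. besov_seq \<Theta> w p f j powr g)" using besov False g by (simp add: in_besov_def)
    have "besov_seq \<Theta> w p f j powr g \<le> (\<Sum>j. besov_seq \<Theta> w p f j powr g)"
      using sum_le_suminf[OF sm, of "{j}"] by simp
    then have "besov_seq \<Theta> w p f j \<le> (\<Sum>j. besov_seq \<Theta> w p f j powr g) powr (1 / g)"
      by (intro le_powr_inverse g b0 suminf_nonneg sm) auto
    then show ?thesis using g by simp
  qed
  also have "\<dots> \<le> besov_norm \<Theta> \<gamma> w p f" unfolding besov_norm_def using wnorm_nonneg[OF f, of w p] by simp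
  also have "\<dots> < F" by (rule F)
  finally have "best_approx w p (2 ^ j) f < F * \<Theta> (2 powr - real j)"
    unfolding besov_seq_def using \<Theta>j[of j] by (simp add: pos_divide_less_eq)
  also have "2 powr - real j = 1 / 2 ^ j" by (simp add: powr_minus powr_realpow divide_inverse)
  finally have "Inf {wnorm w p (\<lambda>x. f x - P x) | P. P \<in> sph_poly (2 ^ j)} < F * \<Theta> (1 / 2 ^ j)"
    by (simp add: best_approx_def)
  from cInf_lessD[OF ne this] show ?thesis by blast
qed

lemma besov_norm_nonneg:
  fixes f :: "real^'n \<Rightarrow> real"
  assumes f: "continuous_on (sphere 0 1) f" and \<Theta>: "\<And>t. 0 < t \<Longrightarrow> 0 < \<Theta> t"
    and besov: "in_besov \<Theta> \<gamma> w p f"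
  shows "0 \<le> besov_norm \<Theta> \<gamma> w p f"
proof -
  have nn: "0 \<le> wnorm w p (\<lambda>x. f x - P x)" if "P \<in> sph_poly i" for P i
    by (intro wnorm_nonneg continuous_intros f continuous_on_sph_poly[OF that])
  have ne: "{wnorm w p (\<lambda>x. f x - P x) | P. P \<in> sph_poly 1} \<noteq> {}"
    using sph_poly_zero by blast
  have "0 \<le> best_approx w p 1 f"
    unfolding best_approx_def using nn by (intro cInf_greatest ne) auto
  then have b0: "0 \<le> besov_seq \<Theta> w p f 0"
    unfolding besov_seq_def using less_imp_le[OF \<Theta>[of 1]] by simp
  have "0 \<le> (SUP j. besov_seq \<Theta> w p f j)" if "\<gamma> = \<infinity>"
    using that besov b0 by (auto simp: in_besov_def intro: cSUP_upper2)
  then show ?thesis using wnorm_nonneg[OF f, of w p] by (auto simp: besov_norm_def)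
qed

text \<open>The gain in \<open>i\<close> comes entirely from the factor t^r; almost monotonicity
  keeps \<open>\<Theta>1\<close> from spoiling it.\<close>

lemma Phi_star_scaling:
  assumes \<Theta>1: "Phi_star s \<Theta>1" and \<Theta>: "\<forall>t\<ge>0. \<Theta> t = t powr r * \<Theta>1 t" and r: "0 < r"
  shows "\<exists>K>0. \<forall>n j i. 2 ^ j \<le> n \<longrightarrow> n < 2 * 2 ^ j \<longrightarrow>
    \<Theta> (1 / 2 ^ (j + i)) \<le> K * \<Theta> (1 / real n) * (2 powr - r) ^ i"
proof -
  have pos: "0 < \<Theta>1 t" if "0 < t" for t using \<Theta>1 that by (auto simp: Phi_star_def)
  obtain C where "\<forall>t\<in>{0..}. \<forall>t'\<in>{0..}. t \<le> t' \<longrightarrow> \<Theta>1 t \<le> C * \<Theta>1 t'"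
    using \<Theta>1 unfolding Phi_star_def almost_increasing_on_def by blast
  then have C: "\<And>t t'. 0 \<le> t \<Longrightarrow> t \<le> t' \<Longrightarrow> \<Theta>1 t \<le> C * \<Theta>1 t'" by auto
  \<comment> \<open>The constants in the definitions carry no sign; comparing a positive value with
    itself supplies the lower bound 1.\<close>
  have C1: "1 \<le> C" using C[of 1 1] pos[of 1] by (simp add: mult_le_cancel_right1)
  obtain D where D: "\<And>n t. 0 \<le> t \<Longrightarrow> 1 \<le> n \<Longrightarrow> \<Theta>1 (real n * t) \<le> D * real n powr s * \<Theta>1 t"
    using \<Theta>1 unfolding Phi_star_def by blast
  have D1: "1 \<le> D" using D[of 1 1] pos[of 1] by (simp add: mult_le_cancel_right1)
  define K where "K = 2 powr r * (C * (D * 2 powr s * C))"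
  have "0 < K" using C1 D1 by (simp add: K_def)
  moreover have "\<Theta> (1 / 2 ^ (j + i)) \<le> K * \<Theta> (1 / real n) * (2 powr - r) ^ i"
    if n: "2 ^ j \<le> n" "n < 2 * 2 ^ j" for n j i :: nat
  proof -
    have n': "2 ^ j \<le> real n" "real n < 2 * 2 ^ j"
      using n by (simp_all flip: of_nat_le_iff of_nat_less_iff[where 'a = real])
    have n0: "0 < real n" using n'(1) by (smt (verit) zero_less_power)
    have "\<Theta>1 (1 / 2 ^ (j + i)) \<le> C * \<Theta>1 (1 / 2 ^ j)"
      by (intro C) (auto simp: field_simps power_add)
    \<comment> \<open>Since \<open>1 / n\<close> may be smaller than 1/2^j, the growth condition
      with factor 2 steps below it, and almost monotonicity returns to \<open>1 / n\<close>.\<close>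
    also have "\<dots> \<le> C * (D * 2 powr s * \<Theta>1 (1 / (2 * 2 ^ j)))"
      using D[of "1 / (2 * 2 ^ j)" 2] C1 by (intro mult_left_mono) auto
    also have "\<dots> \<le> C * (D * 2 powr s * (C * \<Theta>1 (1 / real n)))"
      using C1 D1 n' n0 by (intro mult_left_mono C) (auto intro!: divide_left_mono)
    finally have 1: "\<Theta>1 (1 / 2 ^ (j + i)) \<le> C * (D * 2 powr s * C) * \<Theta>1 (1 / real n)" by (simp add: mult_ac)
    have "(1 / 2 ^ (j + i)) powr r = (1 / 2 ^ j) powr r * (2 powr - r) ^ i"
    proof -
      have "(1 / 2 ^ i) powr r = (2 powr - real i) powr r"
        by (simp add: powr_minus powr_realpow divide_inverse)
      also have "\<dots> = (2 powr - r) ^ i" by (simp add: powr_powr powr_power mult.commute)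
      finally show ?thesis using powr_mult[of "1 / 2 ^ j" "1 / 2 ^ i" r] by (simp add: power_add)
    qed
    also have "(1 / 2 ^ j) powr r \<le> (2 * (1 / real n)) powr r"
      using r n' n0 by (intro powr_mono2) (auto simp: field_simps)
    finally have 2: "(1 / 2 ^ (j + i)) powr r \<le> 2 powr r * (1 / real n) powr r * (2 powr - r) ^ i"
      unfolding powr_mult by (simp add: mult_right_mono)
    have "\<Theta> (1 / 2 ^ (j + i)) = (1 / 2 ^ (j + i)) powr r * \<Theta>1 (1 / 2 ^ (j + i))" using \<Theta> by simp
    also have "\<dots> \<le> (2 powr r * (1 / real n) powr r * (2 powr - r) ^ i) * (C * (D * 2 powr s * C) * \<Theta>1 (1 / real n))"
      using 1 2 less_imp_le[OF pos] by (intro mult_mono) auto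
    also have "\<dots> = K * \<Theta> (1 / real n) * (2 powr - r) ^ i" using \<Theta> by (simp add: K_def mult_ac)
    finally show ?thesis .
  qed
  ultimately show ?thesis by blast
qed

section \<open>From bounds in the mean and in the supremum norm to \<open>L_q\<close>\<close>

text \<open>Adding 1 to the total mass gives a base of at least 1, whose power 1/q is at most the
  base itself for every \<open>q\<close>.\<close>

lemma wnorm_le_const:
  fixes h :: "real^'n \<Rightarrow> real"
  assumes w: "doubling_weight w" and h: "continuous_on (sphere 0 1) h" and q: "1 \<le> q"
    and U: "0 < U" and sup: "\<And>x. x \<in> sphere 0 1 \<Longrightarrow> \<bar>h x\<bar> \<le> U"
  shows "wnorm w q h \<le> (measure (weighted_measure w) (sphere 0 1) + 1) * U"
proof -
  interpret finite_measure "weighted_measure w" by (rule finite_measure_weighted[OF w])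
  have sp: "space (weighted_measure w) = sphere 0 1" by (simp add: weighted_measure_def)
  let ?m = "measure (weighted_measure w) (sphere 0 1)"
  show ?thesis
  proof (cases q)
    case (real q')
    have q': "1 \<le> q'" using q real by simp
    have "(\<integral>x. \<bar>h x\<bar> powr q' \<partial>weighted_measure w) \<le> (\<integral>x. U powr q' \<partial>weighted_measure w)"
      using q' sup by (intro integral_mono_AE' AE_I2 integrable_const) (auto simp: sp intro!: powr_mono2)
    also have "\<dots> = U powr q' * ?m" by (simp add: sp)
    also have "\<dots> \<le> U powr q' * (?m + 1)" by (intro mult_left_mono) auto
    finally have "(\<integral>x. \<bar>h x\<bar> powr q' \<partial>weighted_measure w) powr (1 / q') \<le> (U powr q' * (?m + 1)) powr (1 / q')"
      using q' by (intro powr_mono2 Bochner_Integration.integral_nonneg) auto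
    also have "\<dots> = U * (?m + 1) powr (1 / q')" using U q' by (simp add: powr_mult powr_powr)
    also have "\<dots> \<le> U * (?m + 1) powr 1"
      using U q' by (intro mult_left_mono powr_mono) auto
    finally show ?thesis using real wnorm_eq[OF w h q'] by (simp add: mult.commute)
  next
    case PInf
    have "wnorm w q h \<le> U" unfolding PInf by (rule wnorm_infinity_le[OF sup])
    also have "\<dots> \<le> (?m + 1) * U" using U by (simp add: distrib_right)
    finally show ?thesis .
  qed (use q in auto)
qed

text \<open>For q <= p the finiteness of the measure is used; for finite q > p the surplus power
  |h|^(q - p) is bounded by the supremum, which yields the exponent (1/p - 1/q) s.\<close>

lemma wnorm_interpolation:
  fixes h :: "real^'n \<Rightarrow> real"
  assumes w: "doubling_weight w" and h: "continuous_on (sphere 0 1) h" and p: "1 \<le> p" and q: "1 \<le> q"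
    and U: "0 < U" and n: "1 \<le> n" and s: "0 < s"
    and int: "(\<integral>x. \<bar>h x\<bar> powr p \<partial>weighted_measure w) \<le> U powr p"
    and sup: "\<And>x. x \<in> sphere 0 1 \<Longrightarrow> \<bar>h x\<bar> \<le> real n powr (s / p) * U"
  shows "wnorm w q h \<le> (measure (weighted_measure w) (sphere 0 1) + 1) * U * real n powr (max 0 (1 / p - inv_exp q) * s)"
proof -
  interpret finite_measure "weighted_measure w" by (rule finite_measure_weighted[OF w])
  have sp: "space (weighted_measure w) = sphere 0 1" by (simp add: weighted_measure_def)
  have ic: "integrable (weighted_measure w) (\<lambda>x. \<bar>h x\<bar> powr t)" if "0 < t" for t
  proof -
    have c: "continuous_on (sphere 0 1) (\<lambda>x. \<bar>h x\<bar> powr t)"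
      using that by (intro continuous_on_powr' continuous_intros h) auto
    then have "(\<lambda>x. \<bar>h x\<bar> powr t) \<in> borel_measurable (weighted_measure w)"
      using cont_measurable[OF w] by (simp add: weighted_measure_def)
    moreover obtain b where "\<forall>x\<in>sphere 0 1. \<bar>h x\<bar> powr t \<le> b"
      using bdd_above_abs_sphere[OF c] by (auto simp: bdd_above_def)
    ultimately show ?thesis by (intro integrable_const_bound[where B = b]) (auto simp: sp)
  qed
  let ?m = "measure (weighted_measure w) (sphere 0 1)"
  have m0: "0 \<le> ?m" by simp
  show ?thesis
  proof (cases q)
    case (real t)
    have t: "1 \<le> t" using q real by simp
    have e: "inv_exp q = 1 / t" using real by (simp add: inv_exp_def)
    have wq: "wnorm w q h = (\<integral>x. \<bar>h x\<bar> powr t \<partial>weighted_measure w) powr (1 / t)"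
      using wnorm_eq[OF w h t] real by simp
    show ?thesis
    proof (cases "t \<le> p")
      case True
      have "(\<integral>x. \<bar>h x\<bar> powr t \<partial>weighted_measure w) \<le> (\<integral>x. U powr t * (1 + \<bar>h x\<bar> powr p / U powr p) \<partial>weighted_measure w)"
      proof (rule integral_mono)
        show "integrable (weighted_measure w) (\<lambda>x. U powr t * (1 + \<bar>h x\<bar> powr p / U powr p))"
          using p by (intro integrable_mult_right Bochner_Integration.integrable_add integrable_const integrable_divide ic) auto
        show "integrable (weighted_measure w) (\<lambda>x. \<bar>h x\<bar> powr t)" using t by (intro ic) auto
        fix x
        \<comment> \<open>Elementary substitute for Hoelder's inequality on a finite
          measure.\<close>
        have "(\<bar>h x\<bar> / U) powr t \<le> 1 + (\<bar>h x\<bar> / U) powr p"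
        proof (cases "\<bar>h x\<bar> / U \<le> 1")
          case True
          then have "(\<bar>h x\<bar> / U) powr t \<le> 1" using t U by (intro powr_le1) auto
          also have "\<dots> \<le> 1 + (\<bar>h x\<bar> / U) powr p" by simp
          finally show ?thesis .
        next
          case False
          then have "(\<bar>h x\<bar> / U) powr t \<le> (\<bar>h x\<bar> / U) powr p" using \<open>t \<le> p\<close> by (intro powr_mono) auto
          then show ?thesis by simp
        qed
        then have "U powr t * (\<bar>h x\<bar> / U) powr t \<le> U powr t * (1 + (\<bar>h x\<bar> / U) powr p)"
          by (intro mult_left_mono) auto
        then show "\<bar>h x\<bar> powr t \<le> U powr t * (1 + \<bar>h x\<bar> powr p / U powr p)"
          using U by (simp add: powr_divide)
      qed
      also have "\<dots> = U powr t * (?m + (\<integral>x. \<bar>h x\<bar> powr p \<partial>weighted_measure w) / U powr p)"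
        using p ic[of p] by (simp add: sp)
      also have "\<dots> \<le> U powr t * (?m + 1)"
        using int U by (intro mult_left_mono add_left_mono) auto
      finally have "wnorm w q h \<le> (U powr t * (?m + 1)) powr (1 / t)"
        unfolding wq using t by (intro powr_mono2 Bochner_Integration.integral_nonneg) auto
      also have "\<dots> = U * (?m + 1) powr (1 / t)" using U t by (simp add: powr_mult powr_powr)
      also have "\<dots> \<le> U * (?m + 1) powr 1"
        using U t by (intro mult_left_mono powr_mono) auto
      also have "\<dots> = (?m + 1) * U * 1" by simp
      also have "\<dots> \<le> (?m + 1) * U * real n powr (max 0 (1 / p - inv_exp q) * s)"
        using U n s by (intro mult_left_mono ge_one_powr_ge_zero) auto
      finally show ?thesis .
    next
      case False
      let ?V = "real n powr (s / p) * U"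
      have V: "0 < ?V" using n U by simp
      have "(\<integral>x. \<bar>h x\<bar> powr t \<partial>weighted_measure w) \<le> (\<integral>x. ?V powr (t - p) * \<bar>h x\<bar> powr p \<partial>weighted_measure w)"
      proof (rule integral_mono)
        show "integrable (weighted_measure w) (\<lambda>x. ?V powr (t - p) * \<bar>h x\<bar> powr p)"
          using p by (intro integrable_mult_right ic) auto
        show "integrable (weighted_measure w) (\<lambda>x. \<bar>h x\<bar> powr t)" using t by (intro ic) auto
        fix x assume "x \<in> space (weighted_measure w)"
        then have x: "x \<in> sphere 0 1" by (simp add: sp)
        have "\<bar>h x\<bar> powr t = \<bar>h x\<bar> powr (t - p) * \<bar>h x\<bar> powr p" by (simp add: powr_add[symmetric])
        also have "\<dots> \<le> ?V powr (t - p) * \<bar>h x\<bar> powr p"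
          using False sup[OF x] by (intro mult_right_mono powr_mono2) auto
        finally show "\<bar>h x\<bar> powr t \<le> ?V powr (t - p) * \<bar>h x\<bar> powr p" .
      qed
      also have "\<dots> = ?V powr (t - p) * (\<integral>x. \<bar>h x\<bar> powr p \<partial>weighted_measure w)" by (rule integral_mult_right_zero)
      also have "\<dots> \<le> ?V powr (t - p) * U powr p" by (intro mult_left_mono int) auto
      also have "\<dots> = real n powr (s / p * (t - p)) * U powr t"
        using U n by (simp add: powr_mult powr_powr powr_add[symmetric] mult.assoc)
      finally have "wnorm w q h \<le> (real n powr (s / p * (t - p)) * U powr t) powr (1 / t)"
        unfolding wq using t by (intro powr_mono2 Bochner_Integration.integral_nonneg) auto
      also have "\<dots> = real n powr (s / p * (t - p) / t) * U" using U t by (simp add: powr_mult powr_powr)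
      also have "s / p * (t - p) / t = max 0 (1 / p - inv_exp q) * s"
      proof -
        have "1 / t \<le> 1 / p" using False p by (intro divide_left_mono) auto
        then show ?thesis using p t unfolding e by (simp add: max_def field_simps)
      qed
      also have "real n powr (max 0 (1 / p - inv_exp q) * s) * U
         \<le> (?m + 1) * (real n powr (max 0 (1 / p - inv_exp q) * s) * U)"
        using U by (simp add: distrib_right)
      finally show ?thesis by (simp add: mult_ac)
    qed
  next
    case PInf
    have "wnorm w q h \<le> real n powr (s / p) * U" unfolding PInf by (rule wnorm_infinity_le[OF sup])
    also have "\<dots> \<le> (?m + 1) * (real n powr (s / p) * U)" using U by (simp add: distrib_right)
    finally show ?thesis using PInf p by (simp add: inv_exp_def mult_ac max_def)
  qed (use q in auto)
qed

section \<open>Minimality at the nodes\<close>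

lemma disc_norm_le_iff:
  assumes "1 \<le> p" and "\<And>k. k < N \<Longrightarrow> 0 \<le> \<tau> k" and le: "disc_norm (ereal p) N X \<tau> f \<le> disc_norm (ereal p) N X \<tau> g"
  shows "(\<Sum>k<N. \<tau> k * \<bar>f (X k)\<bar> powr p) \<le> (\<Sum>k<N. \<tau> k * \<bar>g (X k)\<bar> powr p)"
proof -
  let ?a = "\<lambda>f. \<Sum>k<N. \<tau> k * \<bar>f (X k)\<bar> powr p"
  have nn: "0 \<le> ?a f" for f using assms(2) by (intro sum_nonneg mult_nonneg_nonneg) auto
  have "(?a f powr (1 / p)) powr p \<le> (?a g powr (1 / p)) powr p"
    using le assms(1) by (intro powr_mono2[of p]) (simp_all add: disc_norm_def)
  then show ?thesis using nn assms(1) by (simp add: powr_powr)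
qed

text \<open>\<open>P\<close> is a competitor, so |f - L| <= T at the nodes. Hence |P - L| <= 2T
  there, and the Marcinkiewicz-Zygmund inequality extends this to 2 C T on the sphere.\<close>

lemma least_approx_infinity:
  fixes f :: "real^'n \<Rightarrow> real"
  assumes MZ: "\<forall>P\<in>sph_poly n. (SUP x\<in>sphere 0 1. \<bar>P x\<bar>) \<le> C * Max {\<bar>P (X k)\<bar> | k. k < N}"
    and N: "0 < N" and X: "\<And>k. k < N \<Longrightarrow> X k \<in> sphere 0 1" and C: "0 \<le> C"
    and P: "P \<in> sph_poly n" and L: "least_lp_approx \<infinity> N X \<tau> n f L"
    and T: "\<And>x. x \<in> sphere 0 1 \<Longrightarrow> \<bar>f x - P x\<bar> \<le> T" and x: "x \<in> sphere 0 1"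
  shows "\<bar>f x - L x\<bar> \<le> (1 + 2 * C) * T"
proof -
  have L': "L \<in> sph_poly n" using L by (simp add: least_lp_approx_def)
  have PL: "(\<lambda>x. P x - L x) \<in> sph_poly n" by (rule sph_poly_diff[OF P L'])
  have im: "{\<bar>g (X k)\<bar> | k. k < N} = (\<lambda>k. \<bar>g (X k)\<bar>) ` {..<N}" for g :: "real^'n \<Rightarrow> real" by auto
  have le: "Max {\<bar>g (X k)\<bar> | k. k < N} \<le> b \<longleftrightarrow> (\<forall>k<N. \<bar>g (X k)\<bar> \<le> b)" for g :: "real^'n \<Rightarrow> real" and b
    unfolding im using N by (subst Max_le_iff) auto
  have "Max {\<bar>f (X k) - P (X k)\<bar> | k. k < N} \<le> T"
    using le[of "\<lambda>x. f x - P x" T] T X by auto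
  moreover have "Max {\<bar>f (X k) - L (X k)\<bar> | k. k < N} \<le> Max {\<bar>f (X k) - P (X k)\<bar> | k. k < N}"
    using L P by (auto simp: least_lp_approx_def disc_norm_def)
  ultimately have fL: "\<bar>f (X k) - L (X k)\<bar> \<le> T" if "k < N" for k
    using le[of "\<lambda>x. f x - L x" T] that by auto
  have M: "Max {\<bar>P (X k) - L (X k)\<bar> | k. k < N} \<le> 2 * T"
    using le[of "\<lambda>x. P x - L x" "2 * T"] fL T X by fastforce
  have "\<bar>P x - L x\<bar> \<le> (SUP x\<in>sphere 0 1. \<bar>P x - L x\<bar>)"
    by (intro cSUP_upper x bdd_above_abs_sphere continuous_on_sph_poly[OF PL])
  also have "\<dots> \<le> C * Max {\<bar>P (X k) - L (X k)\<bar> | k. k < N}" using MZ PL by auto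
  also have "\<dots> \<le> C * (2 * T)" by (intro mult_left_mono M C)
  finally show ?thesis using T[OF x] by (simp add: algebra_simps)
qed

theorem theorem3p1:
  fixes w :: "real^'n \<Rightarrow> real"
    and p q \<gamma> :: ereal
    and r s sw :: real
    and \<Theta> \<Theta>1 :: "real \<Rightarrow> real"
    and N :: "nat \<Rightarrow> nat"
    and X :: "nat \<Rightarrow> nat \<Rightarrow> real^'n"
    and \<tau> :: "nat \<Rightarrow> nat \<Rightarrow> real"
  assumes dim: "CARD('n) \<ge> 2"
    and p: "1 \<le> p" and q: "1 \<le> q"
    and gamma: "0 < \<gamma>"
    and r: "0 < r"
    and s: "1 \<le> s"
    and Theta1: "Phi_star s \<Theta>1"
    and Theta_def: "\<forall>t\<ge>0. \<Theta> t = t powr r * \<Theta>1 t"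
    and Theta: "Phi_star s \<Theta>"
    and w: "doubling_weight w"
    and sw: "critical_index w sw"
    and MZ: "MZ_families w p N X \<tau>"
    and r_sw: "sw * inv_exp p < r"
  shows "\<exists>C>0. \<forall>n::nat. \<forall>f L. n \<ge> 1 \<longrightarrow> continuous_on (sphere 0 1) f \<longrightarrow>
           in_besov \<Theta> \<gamma> w p f \<longrightarrow> least_lp_approx p (N n) (X n) (\<tau> n) n f L \<longrightarrow>
           wnorm w q (\<lambda>x. f x - L x)
             \<le> C * \<Theta> (1 / real n) * real n powr (max 0 (inv_exp p - inv_exp q) * sw)
                 * besov_norm \<Theta> \<gamma> w p f"
proof -
  have \<Theta>_pos: "0 < \<Theta> t" if "0 < t" for t using Theta that by (auto simp: Phi_star_def)
  obtain K where K: "0 < K" and scale: "\<And>n j i. 2 ^ j \<le> n \<Longrightarrow> n < 2 * 2 ^ j \<Longrightarrow>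
      \<Theta> (1 / 2 ^ (j + i)) \<le> K * \<Theta> (1 / real n) * (2 powr - r) ^ i"
    using Phi_star_scaling[OF Theta1 Theta_def r] by blast
  have node: "0 < N n" "k < N n \<Longrightarrow> X n k \<in> sphere 0 1" "k < N n \<Longrightarrow> 0 < \<tau> n k" for n k
    using MZ by (auto simp: MZ_families_def)
  let ?m = "measure (weighted_measure w) (sphere 0 1)"
  let ?e = "max 0 (inv_exp p - inv_exp q) * sw"
  \<comment> \<open>Common form for both cases of \<open>p\<close>, in which only the amplitude
    \<open>T\<close> of a geometric rate is left of the smoothness.\<close>
  have "\<exists>C>0. \<forall>n m f L P T. 1 \<le> n \<longrightarrow> m \<le> n \<longrightarrow> n < 2 * m \<longrightarrow> 0 < T \<longrightarrow>
     continuous_on (sphere 0 1) f \<longrightarrow> least_lp_approx p (N n) (X n) (\<tau> n) n f L \<longrightarrow>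
     (\<forall>i. P i \<in> sph_poly (2 ^ i * m)) \<longrightarrow> (\<forall>i. wnorm w p (\<lambda>x. f x - P i x) \<le> T * (2 powr - r) ^ i) \<longrightarrow>
     wnorm w q (\<lambda>x. f x - L x) \<le> C * T * real n powr ?e"
  proof (cases "p = \<infinity>")
    case True
    obtain C' where "\<forall>n. \<forall>P\<in>sph_poly n. (SUP x\<in>sphere 0 1. \<bar>P x\<bar>) \<le> C' * Max {\<bar>P (X n k)\<bar> | k. k < N n}"
      using MZ True by (auto simp: MZ_families_def)
    note C' = this[rule_format]
    \<comment> \<open>\<open>C'\<close> may be negative; the replacement is justified because the
      maximum is nonnegative, as seen at node 0.\<close>
    define C where "C = max 0 C'"
    have C0: "0 \<le> C" by (simp add: C_def)
    have C: "\<forall>P\<in>sph_poly n. (SUP x\<in>sphere 0 1. \<bar>P x\<bar>) \<le> C * Max {\<bar>P (X n k)\<bar> | k. k < N n}" for n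
    proof
      fix P :: "real^'n \<Rightarrow> real" assume P: "P \<in> sph_poly n"
      have "0 \<le> \<bar>P (X n 0)\<bar>" by simp
      also have "\<dots> \<le> Max {\<bar>P (X n k)\<bar> | k. k < N n}" using node(1)[of n] by (intro Max_ge) auto
      finally have "C' * Max {\<bar>P (X n k)\<bar> | k. k < N n} \<le> C * Max {\<bar>P (X n k)\<bar> | k. k < N n}"
        by (intro mult_right_mono) (auto simp: C_def)
      then show "(SUP x\<in>sphere 0 1. \<bar>P x\<bar>) \<le> C * Max {\<bar>P (X n k)\<bar> | k. k < N n}"
        using C'[OF P] by linarith
    qed
    have bound: "wnorm w q (\<lambda>x. f x - L x) \<le> (?m + 1) * (1 + 2 * C) * T * real n powr ?e"
      if n: "1 \<le> n" and m: "m \<le> n" and T: "0 < T" and f: "continuous_on (sphere 0 1) f"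
        and L: "least_lp_approx p (N n) (X n) (\<tau> n) n f L" and P: "\<forall>i. P i \<in> sph_poly (2 ^ i * m)"
        and fP: "\<forall>i. wnorm w p (\<lambda>x. f x - P i x) \<le> T * (2 powr - r) ^ i" for n m f L P T
    proof -
      have P0: "P 0 \<in> sph_poly n" using P[rule_format, of 0] m by (auto intro: sph_poly_mono)
      have L': "L \<in> sph_poly n" using L by (simp add: least_lp_approx_def)
      have "\<bar>f x - P 0 x\<bar> \<le> T" if "x \<in> sphere 0 1" for x
        using wnorm_infinity_upper[of "\<lambda>x. f x - P 0 x" x w] fP[rule_format, of 0] True that
          continuous_on_diff[OF f continuous_on_sph_poly[OF P0]] by auto
      then have "\<bar>f x - L x\<bar> \<le> (1 + 2 * C) * T" if "x \<in> sphere 0 1" for x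
        using least_approx_infinity[OF C node(1) node(2) C0 P0 L[unfolded True]] that by blast
      then have "wnorm w q (\<lambda>x. f x - L x) \<le> (?m + 1) * ((1 + 2 * C) * T)"
        using C0 T by (intro wnorm_le_const w q continuous_intros f continuous_on_sph_poly[OF L']) auto
      also have "\<dots> = (?m + 1) * (1 + 2 * C) * T * 1" by simp
      also have "\<dots> \<le> (?m + 1) * (1 + 2 * C) * T * real n powr ?e"
        using C0 T n sw by (intro mult_left_mono ge_one_powr_ge_zero) (auto simp: critical_index_def)
      finally show ?thesis .
    qed
    show ?thesis
    proof (rule exI[of _ "(?m + 1) * (1 + 2 * C)"], intro conjI allI impI)
      show "0 < (?m + 1) * (1 + 2 * C)" using C0 by (intro mult_pos_pos) (auto intro: add_nonneg_pos)
    qed (rule bound)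
  next
    case False
    then obtain t where pt: "p = ereal t" and t: "1 \<le> t" using p by (cases p) auto
    obtain C0 where "doubling_sphere (weighted_measure w) sw C0" using doubling_sphere_weighted[OF w sw] by blast
    then interpret doubling_sphere "weighted_measure w" sw C0 .
    obtain A B where A: "0 < A" and B: "0 < B" and mz: "\<And>n P. P \<in> sph_poly n \<Longrightarrow>
         A * wnorm w p P powr t \<le> (\<Sum>k<N n. \<tau> n k * \<bar>P (X n k)\<bar> powr t) \<and>
         (\<Sum>k<N n. \<tau> n k * \<bar>P (X n k)\<bar> powr t) \<le> B * wnorm w p P powr t"
      using MZ pt by (auto simp: MZ_families_def)
    have wI: "wnorm w p P powr t = (\<integral>x. \<bar>P x\<bar> powr t \<partial>weighted_measure w)" if "P \<in> sph_poly n" for P n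
      unfolding pt by (rule wnorm_powr[OF w continuous_on_sph_poly[OF that] t])
    have upper: "MZ_upper t B (weighted_measure w) n (N n) (X n) (\<tau> n)" for n
      using mz wI node by (auto simp: MZ_upper_def intro: less_imp_le)
    \<comment> \<open>\<open>doubling_weight\<close> admits the zero weight. It is excluded by the
      upper bound for the constant polynomial 1, since the node weights are positive.\<close>
    have pos: "0 < ?m"
    proof (rule ccontr)
      assume "\<not> 0 < ?m"
      then have m0: "?m = 0" using measure_nonneg[of "weighted_measure w" "sphere 0 1"] by linarith
      have "(\<Sum>k<N 0. \<tau> 0 k * \<bar>1::real\<bar> powr t) \<le> B * (\<integral>x. \<bar>1::real\<bar> powr t \<partial>weighted_measure w)"
        using mz[OF sph_poly_const[of 1 0]] wI[OF sph_poly_const[of 1 0]] by auto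
      then have "(\<Sum>k<N 0. \<tau> 0 k) \<le> 0" using m0 by (simp add: space_M)
      moreover have "0 < (\<Sum>k<N 0. \<tau> 0 k)" using node node(1)[of 0] by (intro sum_pos) (auto simp: lessThan_empty_iff)
      ultimately show False by simp
    qed
    have rt: "sw / t < r" using r_sw t by (simp add: pt inv_exp_def)
    obtain C where C: "0 < C" and core: "\<forall>n m N X \<tau> f L P T. 1 \<le> n \<longrightarrow> m \<le> n \<longrightarrow> n < 2 * m \<longrightarrow> 0 < T \<longrightarrow>
      continuous_on (sphere 0 1) f \<longrightarrow>
      (\<forall>i. P i \<in> sph_poly (2 ^ i * m)) \<longrightarrow>
      (\<forall>i. (\<integral>y. \<bar>f y - P i y\<bar> powr t \<partial>weighted_measure w) \<le> (T * (2 powr - r) ^ i) powr t) \<longrightarrow>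
      MZ_upper t B (weighted_measure w) n N X \<tau> \<longrightarrow>
      (\<forall>Q\<in>sph_poly n. A * (\<integral>y. \<bar>Q y\<bar> powr t \<partial>weighted_measure w) \<le> (\<Sum>k<N. \<tau> k * \<bar>Q (X k)\<bar> powr t)) \<longrightarrow>
      L \<in> sph_poly n \<longrightarrow>
      (\<forall>Q\<in>sph_poly n. (\<Sum>k<N. \<tau> k * \<bar>f (X k) - L (X k)\<bar> powr t) \<le> (\<Sum>k<N. \<tau> k * \<bar>f (X k) - Q (X k)\<bar> powr t)) \<longrightarrow>
      (\<integral>y. \<bar>f y - L y\<bar> powr t \<partial>weighted_measure w) \<le> (C * T) powr t \<and>
      (\<forall>x\<in>sphere 0 1. \<bar>f x - L x\<bar> \<le> C * real n powr (sw / t) * T)"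
      using least_approx_core[OF t pos A B rt] by (elim exE conjE)
    have bound: "wnorm w q (\<lambda>x. f x - L x) \<le> (?m + 1) * C * T * real n powr ?e"
      if n: "1 \<le> n" and m: "m \<le> n" "n < 2 * m" and T: "0 < T" and f: "continuous_on (sphere 0 1) f"
        and L: "least_lp_approx p (N n) (X n) (\<tau> n) n f L" and P: "\<forall>i. P i \<in> sph_poly (2 ^ i * m)"
        and fP: "\<forall>i. wnorm w p (\<lambda>x. f x - P i x) \<le> T * (2 powr - r) ^ i" for n m f L P T
    proof -
      have L': "L \<in> sph_poly n" using L by (simp add: least_lp_approx_def)
      have cfP: "continuous_on (sphere 0 1) (\<lambda>x. f x - P i x)" for i
        using P continuous_on_sph_poly by (intro continuous_intros f) blast
      have "(\<integral>y. \<bar>f y - P i y\<bar> powr t \<partial>weighted_measure w) \<le> (T * (2 powr - r) ^ i) powr t" for i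
        unfolding wnorm_powr[OF w cfP t, symmetric] using t fP wnorm_nonneg[OF cfP] by (intro powr_mono2) (auto simp: pt)
      moreover have "\<forall>Q\<in>sph_poly n. A * (\<integral>y. \<bar>Q y\<bar> powr t \<partial>weighted_measure w) \<le> (\<Sum>k<N n. \<tau> n k * \<bar>Q (X n k)\<bar> powr t)"
        using mz wI by auto
      moreover have "(\<Sum>k<N n. \<tau> n k * \<bar>f (X n k) - L (X n k)\<bar> powr t) \<le> (\<Sum>k<N n. \<tau> n k * \<bar>f (X n k) - Q (X n k)\<bar> powr t)"
        if "Q \<in> sph_poly n" for Q
        using L that node(3) unfolding least_lp_approx_def pt
        by (intro disc_norm_le_iff[OF t, of "N n" "\<tau> n" "X n" "\<lambda>x. f x - L x" "\<lambda>x. f x - Q x"]) (auto intro: less_imp_le)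
      ultimately have "(\<integral>y. \<bar>f y - L y\<bar> powr t \<partial>weighted_measure w) \<le> (C * T) powr t \<and>
        (\<forall>x\<in>sphere 0 1. \<bar>f x - L x\<bar> \<le> C * real n powr (sw / t) * T)"
        using core[rule_format, of n m T f P "N n" "X n" "\<tau> n" L] n m T f P upper L' by blast
      then have "wnorm w q (\<lambda>x. f x - L x) \<le> (?m + 1) * (C * T) * real n powr (max 0 (1 / t - inv_exp q) * sw)"
        using C T n s_pos
        by (intro wnorm_interpolation w continuous_intros f continuous_on_sph_poly[OF L'] t q) (auto simp: mult_ac)
      then show ?thesis by (simp add: pt inv_exp_def mult.assoc)
    qed
    show ?thesis
    proof (rule exI[of _ "(?m + 1) * C"], intro conjI allI impI)
      show "0 < (?m + 1) * C" using C by (intro mult_pos_pos) (auto intro: add_nonneg_pos)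
    qed (rule bound)
  qed
  then obtain C where C: "0 < C" and main: "\<And>n m f L P T. 1 \<le> n \<Longrightarrow> m \<le> n \<Longrightarrow> n < 2 * m \<Longrightarrow> 0 < T \<Longrightarrow>
     continuous_on (sphere 0 1) f \<Longrightarrow> least_lp_approx p (N n) (X n) (\<tau> n) n f L \<Longrightarrow>
     \<forall>i. P i \<in> sph_poly (2 ^ i * m) \<Longrightarrow> \<forall>i. wnorm w p (\<lambda>x. f x - P i x) \<le> T * (2 powr - r) ^ i \<Longrightarrow>
     wnorm w q (\<lambda>x. f x - L x) \<le> C * T * real n powr ?e"
    by blast
  have "wnorm w q (\<lambda>x. f x - L x) \<le> C * K * \<Theta> (1 / real n) * real n powr ?e * besov_norm \<Theta> \<gamma> w p f"
    if n: "1 \<le> n" and f: "continuous_on (sphere 0 1) f" and besov: "in_besov \<Theta> \<gamma> w p f"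
      and L: "least_lp_approx p (N n) (X n) (\<tau> n) n f L" for n f L
  proof -
    define b where "b = C * K * \<Theta> (1 / real n) * real n powr ?e"
    have b: "0 < b" using C K n \<Theta>_pos[of "1 / real n"] by (simp add: b_def)
    \<comment> \<open>Near-best approximations exist for every \<open>F\<close> above the norm;
      \<open>dense_ge\<close> removes the slack afterwards.\<close>
    have est: "wnorm w q (\<lambda>x. f x - L x) \<le> b * F" if F: "besov_norm \<Theta> \<gamma> w p f < F" for F
    proof -
      have F0: "0 < F" using besov_norm_nonneg[OF f \<Theta>_pos besov] F by linarith
      \<comment> \<open>The largest power of two up to \<open>n\<close> serves as \<open>m\<close>,
        so that \<open>P (j + i)\<close> has degree 2^i m.\<close>
      obtain j where j: "2 ^ j \<le> n" "n < 2 ^ (j + 1)" using ex_power_ivl1[of 2 n] n by auto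
      have j2: "n < 2 * 2 ^ j" using j by simp
      obtain P where P: "\<And>i. P i \<in> sph_poly (2 ^ i) \<and> wnorm w p (\<lambda>x. f x - P i x) < F * \<Theta> (1 / 2 ^ i)"
        using near_best_approximations[OF f \<Theta>_pos gamma besov F] by metis
      let ?T = "F * (K * \<Theta> (1 / real n))"
      have "wnorm w q (\<lambda>x. f x - L x) \<le> C * ?T * real n powr ?e"
      proof (rule main[OF n j(1) j2 _ f L, of _ "\<lambda>i. P (j + i)"])
        show "0 < ?T" using F0 K n \<Theta>_pos[of "1 / real n"] by simp
        show "\<forall>i. P (j + i) \<in> sph_poly (2 ^ i * 2 ^ j)" using P by (simp add: power_add[symmetric] add.commute)
        show "\<forall>i. wnorm w p (\<lambda>x. f x - P (j + i) x) \<le> ?T * (2 powr - r) ^ i"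
        proof
          fix i
          have "wnorm w p (\<lambda>x. f x - P (j + i) x) \<le> F * \<Theta> (1 / 2 ^ (j + i))" using P by (intro less_imp_le) blast
          also have "\<dots> \<le> F * (K * \<Theta> (1 / real n) * (2 powr - r) ^ i)"
            using F0 by (intro mult_left_mono scale j j2) auto
          finally show "wnorm w p (\<lambda>x. f x - P (j + i) x) \<le> ?T * (2 powr - r) ^ i" by (simp add: mult.assoc)
        qed
      qed
      then show ?thesis by (simp add: b_def mult_ac)
    qed
    have "wnorm w q (\<lambda>x. f x - L x) / b \<le> besov_norm \<Theta> \<gamma> w p f"
    proof (rule dense_ge)
      fix F assume "besov_norm \<Theta> \<gamma> w p f < F"
      then show "wnorm w q (\<lambda>x. f x - L x) / b \<le> F" using est[of F] b by (simp add: pos_divide_le_eq mult.commute)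
    qed
    then show ?thesis using b by (simp add: b_def pos_divide_le_eq mult_ac)
  qed
  then show ?thesis using C K by (intro exI[of _ "C * K"]) auto
qed

end
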